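(* Let $\tau>0$ and let $(\gamma_n)_{n\ge1}$ be a decreasing sequence of positive step-sizes with $\sum_{n=1}^\infty\gamma_n^2<\infty$ and $\sum_{n=1}^\infty\gamma_n=\infty$. Starting from arbitrary Hermitian matrices $\mathbf{Y}_k(1)$ with $\mathbf{X}_k(1)=\exp(\mathbf{Y}_k(1))/\operatorname{tr}[\exp(\mathbf{Y}_k(1))]$, let all users $k\in\{1,\dots,K\}$ update synchronously at every $n\ge1$ by $$\mathbf{Y}_k(n+1)=\mathbf{Y}_k(n)+\gamma_n\big(\hat{\mathbf{V}}_k(n)-\tau\mathbf{Y}_k(n)\big),\qquad \mathbf{X}_k(n+1)=\frac{\exp(\mathbf{Y}_k(n+1))}{\operatorname{tr}[\exp(\mathbf{Y}_k(n+1))]},$$ where $$\hat{\mathbf{V}}_k(n)=\mathbf{H}_k(n)^\dagger\,\mathbf{W}(\mathbf{X}(n);\mathbf{H}(n))^{-1}\,\mathbf{H}_k(n).$$ Then there is a function $\varepsilon(\tau)$ with $\varepsilon(\tau)\to0$ as $\tau\to0^+$ such that, for every $\tau>0$, the iterates $\mathbf{X}(n)=(\mathbf{X}_1(n),\dots,\mathbf{X}_K(n))$ converge almost surely to a point within distance $\varepsilon(\tau)$ of a Nash equilibrium of the rate maximization game.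
   Context: There are $K$ users; user $k$ has $M_k$ transmit antennas and transmit power $P_k>0$, and the receiver has $N$ antennas. The channel matrices $\mathbf{H}(n)=(\mathbf{H}_1(n),\dots,\mathbf{H}_K(n))$, $\mathbf{H}_k(n)\in\mathbb{C}^{N\times M_k}$, evolve over $n$ as a bounded stationary ergodic process; $\mathbb{E}$ without conditioning, applied to functions of $\mathbf{H}=(\mathbf{H}_1,\dots,\mathbf{H}_K)$, is expectation over its stationary law. Set $\mathbf{W}(\mathbf{X};\mathbf{H})=\mathbf{I}+\sum_\ell P_\ell\mathbf{H}_\ell\mathbf{X}_\ell\mathbf{H}_\ell^\dagger$. User $k$'s action set is $\mathcal{X}_k=\{\mathbf{X}_k\in\mathbb{C}^{M_k\times M_k}\text{ Hermitian}:\mathbf{X}_k\succeq0,\ \operatorname{tr}(\mathbf{X}_k)=1\}$. The rate maximization game has utilities $$u_k(\mathbf{X})=\mathbb{E}\Big[\log\det\Big(\mathbf{I}+\sum_\ell P_\ell\mathbf{H}_\ell\mathbf{X}_\ell\mathbf{H}_\ell^\dagger\Big)-\log\det\Big(\mathbf{I}+\sum_{\ell\ne k}P_\ell\mathbf{H}_\ell\mathbf{X}_\ell\mathbf{H}_\ell^\dagger\Big)\Big],$$ each user $k$ unilaterally maximizing $u_k$ over $\mathcal{X}_k$. A Nash equilibrium is a profile $\mathbf{X}^*\in\prod_k\mathcal{X}_k$ with $u_k(\mathbf{X}^* )\ge u_k(\mathbf{X}_k;\mathbf{X}^*_{-k})$ for all $k$ and all $\mathbf{X}_k\in\mathcal{X}_k$,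 where $(\mathbf{X}_k;\mathbf{X}^*_{-k})$ replaces the $k$-th component of $\mathbf{X}^*$ by $\mathbf{X}_k$. Standing unbiasedness assumption: with $\mathcal{F}_n$ the filtration induced by the history $\mathbf{X}(1),\dots,\mathbf{X}(n)$, one has $\mathbb{E}[\hat{\mathbf{V}}_k(n)\mid\mathcal{F}_n]=\mathbf{V}_k(\mathbf{X}(n))$ for all $k,n$, where $\mathbf{V}_k(\mathbf{X})=\mathbb{E}[\mathbf{H}_k^\dagger\mathbf{W}(\mathbf{X};\mathbf{H})^{-1}\mathbf{H}_k]$ (the gradient of user $k$'s rate with respect to the unnormalized covariance matrix $P_k\mathbf{X}_k$). *)

theory Defs
  imports "HOL-Probability.Probability" "Jordan_Normal_Form.Schur_Decomposition"
    "Jordan_Normal_Form.Gauss_Jordan_Elimination"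
begin

(* Conventions. The finite type 'u is the set of users. The vector M gives the numbers of
   transmit antennas, P the transmit powers and N is the number of receive antennas. Channel
   realisations h :: 'u => complex mat and covariance profiles X :: 'u => complex mat have
   dimensions depending on the user, so the matrices are those of Jordan_Normal_Form. Time is
   counted from 1; the values at time 0 of all sequences below are irrelevant. *)

section \<open>Matrices\<close>

definition mat_inv :: "complex mat \<Rightarrow> complex mat" where
  "mat_inv A = the (mat_inverse A)"

definition mat_trace :: "complex mat \<Rightarrow> complex" where
  "mat_trace A = (\<Sum>i<dim_row A. A $$ (i, i))"

definition mat_exp :: "complex mat \<Rightarrow> complex mat" where
  "mat_exp A = mat (dim_row A) (dim_col A)
     (\<lambda>(i, j). \<Sum>r. (A ^\<^sub>m r) $$ (i, j) / fact r)"

definition hermitian_mat :: "nat \<Rightarrow> complex mat \<Rightarrow> bool" where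
  "hermitian_mat n A \<longleftrightarrow> A \<in> carrier_mat n n \<and> mat_adjoint A = A"

definition psd_mat :: "nat \<Rightarrow> complex mat \<Rightarrow> bool" where
  "psd_mat n A \<longleftrightarrow> hermitian_mat n A \<and> (\<forall>v\<in>carrier_vec n. 0 \<le> Re ((A *\<^sub>v v) \<bullet>c v))"

(* Only applied to Hermitian positive definite matrices, whose determinant is real and positive. *)
definition log_det :: "complex mat \<Rightarrow> real" where
  "log_det A = ln (Re (Determinant.det A))"

(* Frobenius distance on profiles. *)
definition profile_dist ::
  "('u::finite \<Rightarrow> nat) \<Rightarrow> ('u \<Rightarrow> complex mat) \<Rightarrow> ('u \<Rightarrow> complex mat) \<Rightarrow> real" where
  "profile_dist M A B =
     sqrt (\<Sum>k\<in>UNIV. \<Sum>i<M k. \<Sum>j<M k. (cmod (A k $$ (i, j) - B k $$ (i, j)))\<^sup>2)"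

section \<open>Stationary ergodic processes\<close>

(* Processes Z 0, Z 1, ... with values in the measurable space S, described through their law on
   the one-sided sequence space. *)
definition stationary_process :: "'w measure \<Rightarrow> 's measure \<Rightarrow> (nat \<Rightarrow> 'w \<Rightarrow> 's) \<Rightarrow> bool" where
  "stationary_process \<Omega> S Z \<longleftrightarrow>
     distr \<Omega> (Pi\<^sub>M UNIV (\<lambda>_::nat. S)) (\<lambda>\<omega> n. Z (Suc n) \<omega>) =
     distr \<Omega> (Pi\<^sub>M UNIV (\<lambda>_::nat. S)) (\<lambda>\<omega> n. Z n \<omega>)"

definition ergodic_process :: "'w measure \<Rightarrow> 's measure \<Rightarrow> (nat \<Rightarrow> 'w \<Rightarrow> 's) \<Rightarrow> bool" where
  "ergodic_process \<Omega> S Z \<longleftrightarrow>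
     (\<forall>A\<in>sets (Pi\<^sub>M UNIV (\<lambda>_::nat. S)).
        {s \<in> space (Pi\<^sub>M UNIV (\<lambda>_::nat. S)). (\<lambda>n. s (Suc n)) \<in> A} = A \<longrightarrow>
        measure \<Omega> {\<omega> \<in> space \<Omega>. (\<lambda>n. Z n \<omega>) \<in> A} \<in> {0, 1})"

section \<open>The channel process\<close>

definition channel_idx :: "nat \<Rightarrow> ('u \<Rightarrow> nat) \<Rightarrow> ('u \<times> nat \<times> nat) set" where
  "channel_idx N M = {(k, i, j). i < N \<and> j < M k}"

definition channel_space :: "nat \<Rightarrow> ('u \<Rightarrow> nat) \<Rightarrow> ('u \<times> nat \<times> nat \<Rightarrow> complex) measure" where
  "channel_space N M = Pi\<^sub>M (channel_idx N M) (\<lambda>_. borel)"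

definition channel_entries ::
  "nat \<Rightarrow> ('u \<Rightarrow> nat) \<Rightarrow> ('u \<Rightarrow> complex mat) \<Rightarrow> ('u \<times> nat \<times> nat \<Rightarrow> complex)" where
  "channel_entries N M h = (\<lambda>(k, i, j)\<in>channel_idx N M. h k $$ (i, j))"

definition channel_process ::
  "'w measure \<Rightarrow> nat \<Rightarrow> ('u \<Rightarrow> nat) \<Rightarrow> (nat \<Rightarrow> 'w \<Rightarrow> 'u \<Rightarrow> complex mat) \<Rightarrow> bool" where
  "channel_process \<Omega> N M H \<longleftrightarrow>
     (\<forall>n\<ge>1. \<forall>\<omega>\<in>space \<Omega>. \<forall>k. H n \<omega> k \<in> carrier_mat N (M k)) \<and>
     (\<forall>n\<ge>1. (\<lambda>\<omega>. channel_entries N M (H n \<omega>)) \<in> measurable \<Omega> (channel_space N M)) \<and>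
     (\<exists>B. \<forall>n\<ge>1. AE \<omega> in \<Omega>. \<forall>k. \<forall>i<N. \<forall>j<M k. cmod (H n \<omega> k $$ (i, j)) \<le> B) \<and>
     stationary_process \<Omega> (channel_space N M) (\<lambda>n \<omega>. channel_entries N M (H (Suc n) \<omega>)) \<and>
     ergodic_process \<Omega> (channel_space N M) (\<lambda>n \<omega>. channel_entries N M (H (Suc n) \<omega>))"

section \<open>The rate maximization game\<close>

(* The identity plus the signal covariances of the users in S: W(X;h) for S = UNIV, and the
   noise-plus-interference matrix of user k for S = UNIV - {k}. *)
definition signal_cov ::
  "nat \<Rightarrow> ('u \<Rightarrow> real) \<Rightarrow> 'u set \<Rightarrow> ('u \<Rightarrow> complex mat) \<Rightarrow> ('u \<Rightarrow> complex mat) \<Rightarrow> complex mat" where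
  "signal_cov N P S X h = 1\<^sub>m N + mat N N
     (\<lambda>ij. \<Sum>l\<in>S. complex_of_real (P l) * (h l * X l * mat_adjoint (h l)) $$ ij)"

abbreviation W_mat ::
  "nat \<Rightarrow> ('u \<Rightarrow> real) \<Rightarrow> ('u \<Rightarrow> complex mat) \<Rightarrow> ('u \<Rightarrow> complex mat) \<Rightarrow> complex mat" where
  "W_mat N P X h \<equiv> signal_cov N P UNIV X h"

definition action_set :: "nat \<Rightarrow> complex mat set" where
  "action_set m = {X. psd_mat m X \<and> mat_trace X = 1}"

(* As the process is stationary, the expectation over the stationary law is the expectation of
   the corresponding function of H 1; similarly in grad_rate. *)
definition utility ::
  "'w measure \<Rightarrow> nat \<Rightarrow> ('u \<Rightarrow> real) \<Rightarrow> (nat \<Rightarrow> 'w \<Rightarrow> 'u \<Rightarrow> complex mat) \<Rightarrow>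
   'u \<Rightarrow> ('u \<Rightarrow> complex mat) \<Rightarrow> real" where
  "utility \<Omega> N P H k X =
     (\<integral>\<omega>. (log_det (W_mat N P X (H 1 \<omega>)) - log_det (signal_cov N P (UNIV - {k}) X (H 1 \<omega>))) \<partial>\<Omega>)"

definition nash_equilibrium ::
  "'w measure \<Rightarrow> nat \<Rightarrow> ('u \<Rightarrow> nat) \<Rightarrow> ('u \<Rightarrow> real) \<Rightarrow> (nat \<Rightarrow> 'w \<Rightarrow> 'u \<Rightarrow> complex mat) \<Rightarrow>
   ('u \<Rightarrow> complex mat) \<Rightarrow> bool" where
  "nash_equilibrium \<Omega> N M P H X \<longleftrightarrow>
     (\<forall>k. X k \<in> action_set (M k)) \<and>
     (\<forall>k. \<forall>Z\<in>action_set (M k). utility \<Omega> N P H k (X(k := Z)) \<le> utility \<Omega> N P H k X)"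

section \<open>The learning scheme\<close>

definition grad_inst ::
  "nat \<Rightarrow> ('u \<Rightarrow> real) \<Rightarrow> 'u \<Rightarrow> ('u \<Rightarrow> complex mat) \<Rightarrow> ('u \<Rightarrow> complex mat) \<Rightarrow> complex mat" where
  "grad_inst N P k X h = mat_adjoint (h k) * mat_inv (W_mat N P X h) * h k"

definition grad_rate ::
  "'w measure \<Rightarrow> nat \<Rightarrow> ('u \<Rightarrow> nat) \<Rightarrow> ('u \<Rightarrow> real) \<Rightarrow> (nat \<Rightarrow> 'w \<Rightarrow> 'u \<Rightarrow> complex mat) \<Rightarrow>
   'u \<Rightarrow> ('u \<Rightarrow> complex mat) \<Rightarrow> complex mat" where
  "grad_rate \<Omega> N M P H k X =
     mat (M k) (M k) (\<lambda>ij. \<integral>\<omega>. grad_inst N P k X (H 1 \<omega>) $$ ij \<partial>\<Omega>)"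

definition gibbs :: "complex mat \<Rightarrow> complex mat" where
  "gibbs Y = inverse (mat_trace (mat_exp Y)) \<cdot>\<^sub>m mat_exp Y"

definition learning_iterates ::
  "'w measure \<Rightarrow> nat \<Rightarrow> ('u \<Rightarrow> real) \<Rightarrow> (nat \<Rightarrow> 'w \<Rightarrow> 'u \<Rightarrow> complex mat) \<Rightarrow>
   real \<Rightarrow> (nat \<Rightarrow> real) \<Rightarrow> ('u \<Rightarrow> complex mat) \<Rightarrow>
   (nat \<Rightarrow> 'w \<Rightarrow> 'u \<Rightarrow> complex mat) \<Rightarrow> (nat \<Rightarrow> 'w \<Rightarrow> 'u \<Rightarrow> complex mat) \<Rightarrow> bool" where
  "learning_iterates \<Omega> N P H \<tau> \<gamma> Y1 Y X \<longleftrightarrow>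
     (\<forall>\<omega>\<in>space \<Omega>. \<forall>k.
        Y 1 \<omega> k = Y1 k \<and>
        (\<forall>n\<ge>1. X n \<omega> k = gibbs (Y n \<omega> k)) \<and>
        (\<forall>n\<ge>1. Y (n + 1) \<omega> k = Y n \<omega> k + complex_of_real (\<gamma> n) \<cdot>\<^sub>m
           (grad_inst N P k (X n \<omega>) (H n \<omega>) - complex_of_real \<tau> \<cdot>\<^sub>m Y n \<omega> k)))"

(* The sigma-algebra generated by X 1, ..., X n. *)
definition history ::
  "'w measure \<Rightarrow> ('u \<Rightarrow> nat) \<Rightarrow> (nat \<Rightarrow> 'w \<Rightarrow> 'u \<Rightarrow> complex mat) \<Rightarrow> nat \<Rightarrow> 'w measure" where
  "history \<Omega> M X n = sigma (space \<Omega>)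
     {{\<omega> \<in> space \<Omega>. X m \<omega> k $$ (i, j) \<in> B} | m k i j B.
        1 \<le> m \<and> m \<le> n \<and> i < M k \<and> j < M k \<and> B \<in> sets borel}"

(* The library's conditional expectation is real-valued, hence the split into real and imaginary
   parts of the matrix entries. *)
definition unbiased_gradients ::
  "'w measure \<Rightarrow> nat \<Rightarrow> ('u \<Rightarrow> nat) \<Rightarrow> ('u \<Rightarrow> real) \<Rightarrow> (nat \<Rightarrow> 'w \<Rightarrow> 'u \<Rightarrow> complex mat) \<Rightarrow>
   (nat \<Rightarrow> 'w \<Rightarrow> 'u \<Rightarrow> complex mat) \<Rightarrow> bool" where
  "unbiased_gradients \<Omega> N M P H X \<longleftrightarrow>
     (\<forall>n\<ge>1. \<forall>k. \<forall>i<M k. \<forall>j<M k. AE \<omega> in \<Omega>.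
        real_cond_exp \<Omega> (history \<Omega> M X n)
          (\<lambda>\<omega>'. Re (grad_inst N P k (X n \<omega>') (H n \<omega>') $$ (i, j))) \<omega>
        = Re (grad_rate \<Omega> N M P H k (X n \<omega>) $$ (i, j)) \<and>
        real_cond_exp \<Omega> (history \<Omega> M X n)
          (\<lambda>\<omega>'. Im (grad_inst N P k (X n \<omega>') (H n \<omega>') $$ (i, j))) \<omega>
        = Im (grad_rate \<Omega> N M P H k (X n \<omega>) $$ (i, j)))"

end

theory Submission
  imports Defs
begin

text \<open>
The second term of \<open>u\<^sub>k\<close> does not involve the covariance of user \<open>k\<close>, so the game has the potential
\<open>u(X) = E[log det W(X; H)]\<close>, which is concave, and its maximizers are Nash equilibria
(\<open>potential_maximizer_nash\<close>). The learning scheme ascends a regularization of it: \<open>gibbs\<close> is the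
gradient of \<open>Y \<mapsto> log tr exp Y\<close>, whose convex conjugate is the negative von Neumann entropy, and the
damping term \<open>-\<tau> Y\<close> turns the target into \<open>u(X) - \<tau> h(X)\<close>, where \<open>h\<close> is the power-weighted negative entropy.
A maximizer \<open>p\<close> of this function satisfies \<open>p\<^sub>k = gibbs (V\<^sub>k(p) / \<tau>)\<close>
(\<open>regularized_maximizer_fixed_point\<close>); it is the limit of the iterates. As \<open>\<tau>\<close> tends to 0 the bounded
entropy term disappears, and by compactness \<open>p\<close> approaches the maximizers of \<open>u\<close>
(\<open>regularized_maximizers_approach_nash\<close>). This gives \<open>\<epsilon>(\<tau>)\<close>.

Almost sure convergence comes from a Lyapunov function, the Bregman divergence \<open>F\<close> of \<open>log tr exp\<close>
between the current scores \<open>Y\<close> and the rest scores \<open>V(p) / \<tau>\<close>. In one step the drift of \<open>F\<close>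
splits into four parts (\<open>lyapunov_step\<close>): concavity of \<open>u\<close> makes the contribution of \<open>V(X) - V(p)\<close>
nonpositive; the damping contributes at most \<open>-\<tau> F\<close>; the gradient error is a martingale difference; the second
order remainder is of order \<open>\<gamma>\<^sub>n\<^sup>2\<close>. Hence \<open>E F\<close> tends to 0, and the maximal inequality for nonnegative
supermartingales, started late, upgrades this to almost sure convergence
(\<open>almost_supermartingale_contraction\<close>). Since \<open>F\<close> dominates the squared distance of \<open>X\<close> from \<open>p\<close>, the iterates
converge. The conditioning uses only the history of \<open>X\<close>, while \<open>F\<close> is written in terms of \<open>Y\<close>; but
\<open>F\<close> does not change when multiples of the identity are added to \<open>Y\<close>, so it is a function of \<open>X\<close>, and it is
measurable because the matrix logarithm is a power series (\<open>gibbs_objective_mat_log\<close>).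

All matrix inequalities are reduced to scalar ones by a single device. If \<open>A\<close> and \<open>B\<close> have eigenvalues \<open>a\<^sub>l\<close>, \<open>b\<^sub>m\<close>
and eigenvectors \<open>e\<^sub>l\<close>, \<open>f\<^sub>m\<close>, the trace of \<open>\<phi>(A) \<psi>(B)\<close> is the sum of \<open>w\<^sub>l\<^sub>m \<phi>(a\<^sub>l) \<psi>(b\<^sub>m)\<close>, where the
weights \<open>w\<^sub>l\<^sub>m = |\<langle>e\<^sub>l, f\<^sub>m\<rangle>|\<^sup>2\<close> form a doubly stochastic matrix that does not depend on \<open>\<phi>\<close> and \<open>\<psi>\<close>
(\<open>frob_spec_mixed\<close>). A scalar inequality in \<open>a\<^sub>l\<close> and \<open>b\<^sub>m\<close>, averaged with these weights,
becomes an inequality between traces. This needs the spectral theorem (\<open>hermitian_spectral\<close>).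
\<close>

section \<open>Matrices, adjoints and Hermitian matrices\<close>

lemma mat_mult_entry:
  assumes "A \<in> carrier_mat n m" "B \<in> carrier_mat m p" "i < n" "j < p"
  shows "(A * B) $$ (i, j) = (\<Sum>l<m. A $$ (i, l) * B $$ (l, j))"
  using assms by (auto simp: scalar_prod_def atLeast0LessThan)

lemma mat_adjoint_carrier: "A \<in> carrier_mat n m \<Longrightarrow> mat_adjoint A \<in> carrier_mat m n"
  by (auto simp: mat_adjoint_def mat_of_rows_def)

lemma mat_adjoint_entry:
  fixes A :: "complex mat"
  assumes "A \<in> carrier_mat n m" "i < m" "j < n"
  shows "mat_adjoint A $$ (i, j) = cnj (A $$ (j, i))"
  using assms by (auto simp: mat_adjoint_def mat_of_rows_def)

lemma mat_adjoint_mult: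
  fixes A B :: "complex mat"
  assumes A: "A \<in> carrier_mat n m" and B: "B \<in> carrier_mat m p"
  shows "mat_adjoint (A * B) = mat_adjoint B * mat_adjoint A"
proof (rule eq_matI)
  note c = mat_adjoint_carrier[OF A] mat_adjoint_carrier[OF B]
  fix i j assume "i < dim_row (mat_adjoint B * mat_adjoint A)" "j < dim_col (mat_adjoint B * mat_adjoint A)"
  hence ij: "i < p" "j < n" using c by auto
  have AB: "A * B \<in> carrier_mat n p" using A B by simp
  show "mat_adjoint (A * B) $$ (i, j) = (mat_adjoint B * mat_adjoint A) $$ (i, j)"
    unfolding mat_adjoint_entry[OF AB ij] mat_mult_entry[OF c(2,1) ij] mat_mult_entry[OF A B ij(2,1)]
    using ij A B by (auto simp: mat_adjoint_entry mult.commute intro!: sum.cong)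
qed (use A B mat_adjoint_carrier[OF A] mat_adjoint_carrier[OF B] mat_adjoint_carrier[of "A*B" n p] in auto)

lemma mat_adjoint_adjoint:
  fixes A :: "complex mat"
  assumes A: "A \<in> carrier_mat n m"
  shows "mat_adjoint (mat_adjoint A) = A"
proof (rule eq_matI)
  note c = mat_adjoint_carrier[OF A] 
  note c' = mat_adjoint_carrier[OF c]
  { fix i j assume "i < dim_row A" "j < dim_col A"
    with A have "i < n" "j < m" by auto
    thus "mat_adjoint (mat_adjoint A) $$ (i, j) = A $$ (i, j)"
      by (simp add: mat_adjoint_entry[OF c] mat_adjoint_entry[OF A]) }
  show "dim_row (mat_adjoint (mat_adjoint A)) = dim_row A" "dim_col (mat_adjoint (mat_adjoint A)) = dim_col A"
    using c' A by auto
qed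

lemma hermitian_entry:
  "hermitian_mat n A \<longleftrightarrow> A \<in> carrier_mat n n \<and> (\<forall>i<n. \<forall>j<n. A $$ (j, i) = cnj (A $$ (i, j)))"
proof
  assume h: "hermitian_mat n A"
  hence A: "A \<in> carrier_mat n n" and e: "mat_adjoint A = A" by (auto simp: hermitian_mat_def)
  have "A $$ (j, i) = cnj (A $$ (i, j))" if "i < n" "j < n" for i j
    using mat_adjoint_entry[OF A that(2,1)] unfolding e .
  thus "A \<in> carrier_mat n n \<and> (\<forall>i<n. \<forall>j<n. A $$ (j, i) = cnj (A $$ (i, j)))" using A by blast
next
  assume h: "A \<in> carrier_mat n n \<and> (\<forall>i<n. \<forall>j<n. A $$ (j, i) = cnj (A $$ (i, j)))"
  hence A: "A \<in> carrier_mat n n" by blast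
  have "mat_adjoint A = A"
  proof (rule eq_matI)
    fix i j assume "i < dim_row A" "j < dim_col A"
    hence "i < n" "j < n" using A by auto
    thus "mat_adjoint A $$ (i, j) = A $$ (i, j)" using mat_adjoint_entry[OF A, of i j] h by metis
  qed (use A mat_adjoint_carrier[OF A] in auto)
  thus "hermitian_mat n A" using A by (simp add: hermitian_mat_def)
qed

lemma hermitian_carrier: "hermitian_mat n A \<Longrightarrow> A \<in> carrier_mat n n" by (simp add: hermitian_mat_def)

lemma hermitian_lincomb:
  assumes A: "hermitian_mat n A" and B: "hermitian_mat n B"
  shows "hermitian_mat n (A + complex_of_real c \<cdot>\<^sub>m B)"
  unfolding hermitian_entry
proof (intro conjI allI impI)
  note c = hermitian_carrier[OF A] hermitian_carrier[OF B]
  show "A + complex_of_real c \<cdot>\<^sub>m B \<in> carrier_mat n n" using c by simp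
  fix i j assume ij: "i < n" "j < n"
  have "A $$ (j, i) = cnj (A $$ (i, j))" "B $$ (j, i) = cnj (B $$ (i, j))"
    using A B ij unfolding hermitian_entry by blast+
  hence "A $$ (j, i) + complex_of_real c * B $$ (j, i) = cnj (A $$ (i, j) + complex_of_real c * B $$ (i, j))"
    by (simp only: complex_cnj_add complex_cnj_mult complex_cnj_complex_of_real)
  thus "(A + complex_of_real c \<cdot>\<^sub>m B) $$ (j, i) = cnj ((A + complex_of_real c \<cdot>\<^sub>m B) $$ (i, j))"
    using ij c by (simp only: index_add_mat index_smult_mat carrier_matD)
qed

lemma hermitian_smult:
  assumes A: "hermitian_mat n A"
  shows "hermitian_mat n (complex_of_real c \<cdot>\<^sub>m A)"
proof -
  note A' = hermitian_carrier[OF A]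
  have "complex_of_real c \<cdot>\<^sub>m A = A + complex_of_real (c - 1) \<cdot>\<^sub>m A"
    using A' by (intro eq_matI) (auto simp: algebra_simps)
  thus ?thesis using hermitian_lincomb[OF A A, of "c - 1"] by metis
qed

lemma hermitian_diff:
  assumes A: "hermitian_mat n A" and B: "hermitian_mat n B"
  shows "hermitian_mat n (A - B)"
proof -
  have "A - B = A + complex_of_real (-1) \<cdot>\<^sub>m B"
    using hermitian_carrier[OF A] hermitian_carrier[OF B] by (intro eq_matI) auto
  thus ?thesis using hermitian_lincomb[OF A B, of "-1"] by simp
qed

section \<open>The spectral theorem for Hermitian matrices\<close>

definition unitary_mat :: "nat \<Rightarrow> complex mat \<Rightarrow> bool" where
  "unitary_mat n U \<longleftrightarrow> U \<in> carrier_mat n n \<and> mat_adjoint U * U = 1\<^sub>m n \<and> U * mat_adjoint U = 1\<^sub>m n"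

text \<open>The matrix with orthonormal eigenvectors the columns of \<open>U\<close> and eigenvalues \<open>\<alpha>\<close>. With \<open>U\<close> fixed, applying a
function to the matrix means applying it to \<open>\<alpha>\<close>.\<close>

definition spec_mat :: "nat \<Rightarrow> complex mat \<Rightarrow> (nat \<Rightarrow> real) \<Rightarrow> complex mat" where
  "spec_mat n U \<alpha> = U * mat_diag n (\<lambda>l. complex_of_real (\<alpha> l)) * mat_adjoint U"

lemma unitary_carrier: "unitary_mat n U \<Longrightarrow> U \<in> carrier_mat n n"
  by (simp add: unitary_mat_def)

lemma spec_mat_carrier: "U \<in> carrier_mat n n \<Longrightarrow> spec_mat n U \<alpha> \<in> carrier_mat n n"
  using mat_adjoint_carrier[of U n n] by (auto simp: spec_mat_def)

lemma spec_mat_entry: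
  assumes U: "U \<in> carrier_mat n n" and ij: "i < n" "j < n"
  shows "spec_mat n U \<alpha> $$ (i, j) = (\<Sum>l<n. U $$ (i, l) * complex_of_real (\<alpha> l) * cnj (U $$ (j, l)))"
proof -
  have "U * mat_diag n (\<lambda>l. complex_of_real (\<alpha> l)) \<in> carrier_mat n n" using U by simp
  from mat_mult_entry[OF this mat_adjoint_carrier[OF U] ij] show ?thesis
    unfolding spec_mat_def using ij U
    by (simp add: mat_diag_mult_right[OF U] mat_adjoint_entry[OF U])
qed

lemma spec_mat_hermitian: "U \<in> carrier_mat n n \<Longrightarrow> hermitian_mat n (spec_mat n U \<alpha>)"
  unfolding hermitian_entry by (auto simp: spec_mat_carrier spec_mat_entry mult_ac intro!: sum.cong)

lemma unitary_cols:
  assumes "unitary_mat n U" "l < n" "m < n"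
  shows "(\<Sum>i<n. cnj (U $$ (i, l)) * U $$ (i, m)) = (if l = m then 1 else 0)"
proof -
  from assms have U: "U \<in> carrier_mat n n" and e: "mat_adjoint U * U = 1\<^sub>m n" by (auto simp: unitary_mat_def)
  have "(mat_adjoint U * U) $$ (l, m) = (\<Sum>i<n. cnj (U $$ (i, l)) * U $$ (i, m))"
    using assms(2,3) by (simp add: mat_mult_entry[OF mat_adjoint_carrier[OF U] U] mat_adjoint_entry[OF U])
  thus ?thesis using assms(2,3) unfolding e by simp
qed

lemma unitary_rows:
  assumes "unitary_mat n U" "i < n" "j < n"
  shows "(\<Sum>l<n. U $$ (i, l) * cnj (U $$ (j, l))) = (if i = j then 1 else 0)"
proof -
  from assms have U: "U \<in> carrier_mat n n" and e: "U * mat_adjoint U = 1\<^sub>m n" by (auto simp: unitary_mat_def)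
  have "(U * mat_adjoint U) $$ (i, j) = (\<Sum>l<n. U $$ (i, l) * cnj (U $$ (j, l)))"
    using assms(2,3) by (simp add: mat_mult_entry[OF U mat_adjoint_carrier[OF U]] mat_adjoint_entry[OF U])
  thus ?thesis using assms(2,3) unfolding e by simp
qed

lemma unitary_matI:
  assumes U: "U \<in> carrier_mat n n"
    and c: "\<And>l m. l < n \<Longrightarrow> m < n \<Longrightarrow> (\<Sum>i<n. cnj (U $$ (i, l)) * U $$ (i, m)) = (if l = m then 1 else 0)"
  shows "unitary_mat n U"
proof -
  note U' = mat_adjoint_carrier[OF U]
  have 1: "mat_adjoint U * U = 1\<^sub>m n"
  proof (rule eq_matI)
    fix i j assume "i < dim_row (1\<^sub>m n :: complex mat)" "j < dim_col (1\<^sub>m n :: complex mat)"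
    hence ij: "i < n" "j < n" by auto
    show "(mat_adjoint U * U) $$ (i, j) = 1\<^sub>m n $$ (i, j)"
      unfolding mat_mult_entry[OF U' U ij] using c[OF ij] ij by (simp add: mat_adjoint_entry[OF U])
  qed (use U U' in auto)
  show ?thesis unfolding unitary_mat_def using U 1 mat_mult_left_right_inverse[OF U' U 1] by simp
qed

lemma unitary_mult:
  assumes "unitary_mat n U" "unitary_mat n V"
  shows "unitary_mat n (U * V)"
proof -
  from assms have U: "U \<in> carrier_mat n n" "mat_adjoint U * U = 1\<^sub>m n"
    and V: "V \<in> carrier_mat n n" "mat_adjoint V * V = 1\<^sub>m n" by (auto simp: unitary_mat_def)
  note U' = mat_adjoint_carrier[OF U(1)] and V' = mat_adjoint_carrier[OF V(1)]
  have "mat_adjoint (U * V) * (U * V) = mat_adjoint V * (mat_adjoint U * U) * V"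
    using U(1) V(1) U' V' by (simp add: mat_adjoint_mult[OF U(1) V(1)] assoc_mult_mat[where ?n\<^sub>1=n and ?n\<^sub>2=n and ?n\<^sub>3=n and ?n\<^sub>4=n])
  also have "\<dots> = 1\<^sub>m n" using U V V' by simp
  finally have 1: "mat_adjoint (U * V) * (U * V) = 1\<^sub>m n" .
  have UV: "U * V \<in> carrier_mat n n" using U V by simp
  show ?thesis unfolding unitary_mat_def
    using UV 1 mat_mult_left_right_inverse[OF mat_adjoint_carrier[OF UV] UV 1] by simp
qed

text \<open>Gram-Schmidt applied to a basis that starts with \<open>v\<close> keeps \<open>v\<close> in the first place; it remains to
normalize the columns.\<close>

lemma unitary_with_first_col:
  fixes v :: "complex vec"
  assumes v: "v \<in> carrier_vec n" and v0: "v \<noteq> 0\<^sub>v n" and n: "0 < n"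
  obtains U c where "unitary_mat n U" "\<And>i. i < n \<Longrightarrow> U $$ (i, 0) = c * v $ i"
proof -
  interpret cof_vec_space n "TYPE(complex)" .
  define b where "b = basis_completion v"
  define ws where "ws = gram_schmidt n b"
  from basis_completion[OF v v0, folded b_def]
  have dist_b: "distinct b" 
    and indep: "\<not> lin_dep (set b)" and b: "set b \<subseteq> carrier_vec n" and hdb: "hd b = v" 
    and len_b: "length b = n" by auto
  from hdb len_b n obtain vs where bv: "b = v # vs" by (cases b, auto)
  from gram_schmidt_result[OF b dist_b indep refl, folded ws_def]
  have ws: "set ws \<subseteq> carrier_vec n" "corthogonal ws" "length ws = n" 
    by (auto simp: len_b)
  have hdws: "ws ! 0 = v" using gram_schmidt_hd[OF v, of vs, folded bv] ws(3) n
    unfolding ws_def by (metis hd_conv_nth length_0_conv less_numeral_extra(3))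
  have ip: "ws ! l \<bullet>c ws ! m = (\<Sum>i<n. ws ! l $ i * cnj (ws ! m $ i))" if "l < n" "m < n" for l m
  proof -
    have "ws ! l \<in> carrier_vec n" "ws ! m \<in> carrier_vec n" using ws that by auto
    thus ?thesis by (auto simp: scalar_prod_def atLeast0LessThan)
  qed
  define r where "r l = sqrt (\<Sum>i<n. (cmod (ws ! l $ i))\<^sup>2)" for l
  have rr: "ws ! l \<bullet>c ws ! l = complex_of_real ((r l)\<^sup>2)" if "l < n" for l
    unfolding ip[OF that that] r_def complex_norm_square[symmetric] by (simp add: sum_nonneg)
  have r0: "r l \<noteq> 0" if "l < n" for l
    using rr[OF that] corthogonalD[OF ws(2), of l l] that ws(3) by auto
  define U where "U = mat n n (\<lambda>(i, l). ws ! l $ i / complex_of_real (r l))"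
  have U: "U \<in> carrier_mat n n" by (simp add: U_def)
  have "unitary_mat n U"
  proof (rule unitary_matI[OF U])
    fix l m assume lm: "l < n" "m < n"
    have "(\<Sum>i<n. cnj (U $$ (i, l)) * U $$ (i, m)) = (ws ! m \<bullet>c ws ! l) / complex_of_real (r l * r m)"
      unfolding ip[OF lm(2,1)] sum_divide_distrib using lm
      by (intro sum.cong) (auto simp: U_def field_simps)
    also have "\<dots> = (if l = m then 1 else 0)"
      using corthogonalD[OF ws(2), of m l] lm ws(3) rr[of l] r0[of l] by (auto simp: power2_eq_square)
    finally show "(\<Sum>i<n. cnj (U $$ (i, l)) * U $$ (i, m)) = (if l = m then 1 else 0)" .
  qed
  moreover have "U $$ (i, 0) = (1 / complex_of_real (r 0)) * v $ i" if "i < n" for i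
    using that n by (simp add: U_def hdws)
  ultimately show ?thesis using that by blast
qed

lemma hermitian_conj:
  assumes "hermitian_mat n A" "U \<in> carrier_mat n m"
  shows "hermitian_mat m (mat_adjoint U * A * U)"
proof -
  from assms have A: "A \<in> carrier_mat n n" "mat_adjoint A = A" by (auto simp: hermitian_mat_def)
  note U' = mat_adjoint_carrier[OF assms(2)]
  have "mat_adjoint (mat_adjoint U * A * U) = mat_adjoint U * (mat_adjoint A * mat_adjoint (mat_adjoint U))"
    using mat_adjoint_mult[OF mult_carrier_mat[OF U' A(1)] assms(2)] mat_adjoint_mult[OF U' A(1)]
      A U' assms(2) mat_adjoint_adjoint[OF assms(2)] by (simp add: assoc_mult_mat[OF U' A(1) assms(2)])
  also have "\<dots> = mat_adjoint U * A * U"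
    using A U' assms(2) by (simp add: mat_adjoint_adjoint[OF assms(2)] assoc_mult_mat[of _ m n _ n _ m])
  finally show ?thesis using A U' assms(2) by (auto simp: hermitian_mat_def)
qed

lemma mult_assoc5:
  fixes A B C D E :: "complex mat"
  assumes "A \<in> carrier_mat n n" "B \<in> carrier_mat n n" "C \<in> carrier_mat n n" "D \<in> carrier_mat n n"
    "E \<in> carrier_mat n n"
  shows "A * (B * C * D) * E = A * B * C * (D * E)"
  using assms by (simp add: assoc_mult_mat[where ?n\<^sub>1=n and ?n\<^sub>2=n and ?n\<^sub>3=n and ?n\<^sub>4=n] mult_carrier_mat[of _ n n])

text \<open>Induction on the dimension: conjugating by a unitary matrix whose first column is an eigenvector splits off a
block of size one, because in a Hermitian matrix the first row vanishes beyond the diagonal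
as soon as the first column does.\<close>

theorem hermitian_spectral:
  assumes "hermitian_mat n A"
  obtains U a where "unitary_mat n U" "A = spec_mat n U a"
proof -
  have "\<exists>U a. unitary_mat n U \<and> A = spec_mat n U a" using assms
  proof (induction n arbitrary: A)
    case 0
    hence A: "A \<in> carrier_mat 0 0" by (simp add: hermitian_mat_def)
    have "unitary_mat 0 (1\<^sub>m 0)" by (rule unitary_matI) auto
    moreover have "A = spec_mat 0 (1\<^sub>m 0) (\<lambda>_. 0)"
      using A spec_mat_carrier[of "1\<^sub>m 0" 0 "\<lambda>_. 0"] by (intro eq_matI) auto
    ultimately show ?case by blast
  next
    case (Suc n)
    let ?N = "Suc n"
    from Suc.prems have A: "A \<in> carrier_mat ?N ?N" by (simp add: hermitian_mat_def)
    have "degree (char_poly A) = ?N" using degree_monic_char_poly[OF A] by simp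
    hence "\<not> constant (poly (char_poly A))" by (simp add: constant_degree)
    then obtain e where "poly (char_poly A) e = 0" using fundamental_theorem_of_algebra by blast
    hence "eigenvalue A e" using eigenvalue_root_char_poly[OF A] by simp
    then obtain v where v: "v \<in> carrier_vec ?N" "v \<noteq> 0\<^sub>v ?N" "A *\<^sub>v v = e \<cdot>\<^sub>v v"
      unfolding eigenvalue_def eigenvector_def using A by auto
    obtain U c where U: "unitary_mat ?N U" and Uv: "\<And>i. i < ?N \<Longrightarrow> U $$ (i, 0) = c * v $ i"
      using unitary_with_first_col[OF v(1,2)] by auto
    note Uc = unitary_carrier[OF U] note U' = mat_adjoint_carrier[OF Uc]
    \<comment> \<open>In the new basis the first column is \<open>e\<close> times the first unit vector.\<close>
    define B where "B = mat_adjoint U * A * U"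
    have hB: "hermitian_mat ?N B" unfolding B_def by (rule hermitian_conj[OF Suc.prems Uc])
    hence B: "B \<in> carrier_mat ?N ?N" by (simp add: hermitian_mat_def)
    have AU: "(A * U) $$ (i, 0) = e * U $$ (i, 0)" if "i < ?N" for i
    proof -
      have "(A * U) $$ (i, 0) = (\<Sum>l<?N. A $$ (i, l) * U $$ (l, 0))"
        using mat_mult_entry[OF A Uc that] by simp
      also have "\<dots> = c * (\<Sum>l<?N. A $$ (i, l) * v $ l)"
        unfolding sum_distrib_left by (intro sum.cong) (auto simp: Uv)
      also have "(\<Sum>l<?N. A $$ (i, l) * v $ l) = (A *\<^sub>v v) $ i"
        using A v(1) that by (auto simp: scalar_prod_def atLeast0LessThan)
      also have "\<dots> = e * v $ i" unfolding v(3) using v(1) that by simp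
      finally show ?thesis using Uv[OF that] by simp
    qed
    have B0: "B $$ (i, 0) = (if i = 0 then e else 0)" if "i < ?N" for i
    proof -
      have "B = mat_adjoint U * (A * U)" unfolding B_def using U' A Uc by (rule assoc_mult_mat)
      hence "B $$ (i, 0) = (\<Sum>l<?N. mat_adjoint U $$ (i, l) * (A * U) $$ (l, 0))"
        using mat_mult_entry[OF U' mult_carrier_mat[OF A Uc] that, of 0] by simp
      also have "\<dots> = (\<Sum>l<?N. e * (cnj (U $$ (l, i)) * U $$ (l, 0)))"
        by (rule sum.cong[OF refl]) (use that in \<open>simp add: AU mat_adjoint_entry[OF Uc]\<close>)
      also have "\<dots> = e * (\<Sum>l<?N. cnj (U $$ (l, i)) * U $$ (l, 0))" by (rule sum_distrib_left[symmetric])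
      also have "\<dots> = (if i = 0 then e else 0)" using unitary_cols[OF U that, of 0] by simp
      finally show ?thesis .
    qed
    have Bh: "B $$ (j, i) = cnj (B $$ (i, j))" if "i < ?N" "j < ?N" for i j
      using hB that unfolding hermitian_entry by blast
    have e_real: "complex_of_real (Re e) = e"
      using Bh[of 0 0] B0[of 0] by (simp add: complex_eq_iff)
    define B' where "B' = mat n n (\<lambda>(i, j). B $$ (Suc i, Suc j))"
    have "hermitian_mat n B'" unfolding hermitian_entry B'_def by (auto intro: Bh)
    then obtain V b where V: "unitary_mat n V" and Bs: "B' = spec_mat n V b" using Suc.IH by blast
    note Vc = unitary_carrier[OF V]
    \<comment> \<open>The eigenvectors of the remaining block, bordered by the first unit vector.\<close>
    define W where "W = mat ?N ?N (\<lambda>(i, l). if i = 0 then (if l = 0 then 1 else 0)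
       else if l = 0 then 0 else V $$ (i - 1, l - 1))"
    have Wc: "W \<in> carrier_mat ?N ?N" by (simp add: W_def)
    have W: "unitary_mat ?N W"
    proof (rule unitary_matI[OF Wc])
      fix l m assume lm: "l < ?N" "m < ?N"
      show "(\<Sum>i<?N. cnj (W $$ (i, l)) * W $$ (i, m)) = (if l = m then 1 else 0)"
        unfolding sum.lessThan_Suc_shift using lm unitary_cols[OF V, of "l - 1" "m - 1"]
        by (cases l; cases m) (auto simp: W_def)
    qed
    have BW: "B = spec_mat ?N W (case_nat (Re e) b)"
    proof (rule eq_matI)
      fix i j assume "i < dim_row (spec_mat ?N W (case_nat (Re e) b))" "j < dim_col (spec_mat ?N W (case_nat (Re e) b))"
      hence ij: "i < ?N" "j < ?N" using spec_mat_carrier[OF Wc, of "case_nat (Re e) b"] by auto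
      have "spec_mat ?N W (case_nat (Re e) b) $$ (i, j) =
        (if i = 0 then (if j = 0 then e else 0) else if j = 0 then 0 else B $$ (i, j))"
      proof (cases i; cases j)
        fix i' j' assume s: "i = Suc i'" "j = Suc j'"
        have "B $$ (i, j) = B' $$ (i', j')" using ij s by (simp add: B'_def)
        also have "\<dots> = (\<Sum>l<n. V $$ (i', l) * complex_of_real (b l) * cnj (V $$ (j', l)))"
          unfolding Bs using ij s by (simp add: spec_mat_entry[OF Vc])
        finally show ?thesis unfolding spec_mat_entry[OF Wc ij] sum.lessThan_Suc_shift using ij s
          by (simp add: W_def)
      qed (use ij e_real spec_mat_entry[OF Wc ij, of "case_nat (Re e) b", unfolded sum.lessThan_Suc_shift] in
          \<open>auto simp: W_def\<close>)
      moreover have "B $$ (0, j) = (if j = 0 then e else 0)" using Bh[of j 0] B0[of j] ij e_real B0[of 0] by auto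
      ultimately show "B $$ (i, j) = spec_mat ?N W (case_nat (Re e) b) $$ (i, j)"
        using B0[of i] ij by auto
    qed (use B spec_mat_carrier[OF Wc, of "case_nat (Re e) b"] in auto)
    have "U * B * mat_adjoint U = (U * mat_adjoint U) * A * (U * mat_adjoint U)"
      unfolding B_def using U' A Uc
      by (simp add: assoc_mult_mat[where ?n\<^sub>1="?N" and ?n\<^sub>2="?N" and ?n\<^sub>3="?N" and ?n\<^sub>4="?N"])
    also have "\<dots> = A" using U A by (simp add: unitary_mat_def)
    finally have AB: "A = U * B * mat_adjoint U" by simp
    have "A = spec_mat ?N (U * W) (case_nat (Re e) b)"
      unfolding AB BW spec_mat_def mat_adjoint_mult[OF Uc Wc]
      by (rule mult_assoc5[OF Uc Wc mat_diag_dim mat_adjoint_carrier[OF Wc] U'])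
    thus ?case using unitary_mult[OF U W] by blast
  qed
  thus ?thesis using that by blast
qed

section \<open>The Frobenius pairing\<close>

text \<open>For Hermitian matrices this is the trace of the product; as a real inner product it makes sense for all
matrices and behaves well under sums over entries.\<close>

definition frob :: "nat \<Rightarrow> complex mat \<Rightarrow> complex mat \<Rightarrow> real" where
  "frob n A B = (\<Sum>i<n. \<Sum>j<n. Re (A $$ (i, j) * cnj (B $$ (i, j))))"

lemma frob_commute: "frob n A B = frob n B A"
  unfolding frob_def by (intro sum.cong refl) (simp add: mult.commute)

lemma frob_diff_right:
  "B \<in> carrier_mat n n \<Longrightarrow> C \<in> carrier_mat n n \<Longrightarrow> frob n A (B - C) = frob n A B - frob n A C"
  unfolding frob_def sum_subtractf[symmetric] by (intro sum.cong refl) (simp add: algebra_simps)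

lemma frob_add_right:
  "B \<in> carrier_mat n n \<Longrightarrow> C \<in> carrier_mat n n \<Longrightarrow> frob n A (B + C) = frob n A B + frob n A C"
  unfolding frob_def sum.distrib[symmetric] by (intro sum.cong refl) (simp add: algebra_simps)

lemma frob_smult_right:
  "B \<in> carrier_mat n n \<Longrightarrow> frob n A (complex_of_real c \<cdot>\<^sub>m B) = c * frob n A B"
  unfolding frob_def sum_distrib_left by (intro sum.cong refl) (simp add: algebra_simps)

lemma frob_diff_left:
  "B \<in> carrier_mat n n \<Longrightarrow> C \<in> carrier_mat n n \<Longrightarrow> frob n (B - C) A = frob n B A - frob n C A"
  by (simp add: frob_commute[of n _ A] frob_diff_right)

lemma frob_add_left:
  "B \<in> carrier_mat n n \<Longrightarrow> C \<in> carrier_mat n n \<Longrightarrow> frob n (B + C) A = frob n B A + frob n C A"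
  by (simp add: frob_commute[of n _ A] frob_add_right)

lemma frob_smult_left:
  "B \<in> carrier_mat n n \<Longrightarrow> frob n (complex_of_real c \<cdot>\<^sub>m B) A = c * frob n B A"
  by (simp add: frob_commute[of n _ A] frob_smult_right)

lemma frob_diff_swap:
  assumes "A \<in> carrier_mat n n" "B \<in> carrier_mat n n"
  shows "frob n (A - B) (A - B) = frob n (B - A) (B - A)"
  using assms by (simp add: frob_diff_left frob_diff_right)

lemma frob_self: "frob n A A = (\<Sum>i<n. \<Sum>j<n. (cmod (A $$ (i, j)))\<^sup>2)"
  unfolding frob_def by (intro sum.cong refl) (simp add: complex_norm_square[symmetric] complex_mod_mult_cnj del: of_real_power)

lemma frob_self_nonneg: "0 \<le> frob n A A"
  unfolding frob_self by (intro sum_nonneg) simp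

lemma frob_entry_le:
  assumes "i < n" "j < n"
  shows "(cmod (A $$ (i, j)))\<^sup>2 \<le> frob n A A"
proof -
  have "(cmod (A $$ (i, j)))\<^sup>2 \<le> (\<Sum>j<n. (cmod (A $$ (i, j)))\<^sup>2)"
    using assms by (intro member_le_sum) auto
  also have "\<dots> \<le> frob n A A" unfolding frob_self
    using assms by (intro member_le_sum[of i "{..<n}" "\<lambda>i. \<Sum>j<n. (cmod (A $$ (i, j)))\<^sup>2"]) (auto intro: sum_nonneg)
  finally show ?thesis .
qed

lemma sum_swap4:
  "(\<Sum>i\<in>A. \<Sum>j\<in>B. \<Sum>l\<in>C. \<Sum>m\<in>D. f i j l m) = (\<Sum>l\<in>C. \<Sum>m\<in>D. \<Sum>i\<in>A. \<Sum>j\<in>B. f i j l m)"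
proof -
  have "(\<Sum>i\<in>A. \<Sum>j\<in>B. \<Sum>l\<in>C. \<Sum>m\<in>D. f i j l m) = (\<Sum>i\<in>A. \<Sum>l\<in>C. \<Sum>m\<in>D. \<Sum>j\<in>B. f i j l m)"
    by (rule sum.cong[OF refl], subst sum.swap, rule sum.cong[OF refl], rule sum.swap)
  also have "\<dots> = (\<Sum>l\<in>C. \<Sum>m\<in>D. \<Sum>i\<in>A. \<Sum>j\<in>B. f i j l m)"
    by (subst sum.swap, rule sum.cong[OF refl], rule sum.swap)
  finally show ?thesis .
qed

lemma conj_entry:
  assumes X: "X \<in> carrier_mat m m" and H: "H \<in> carrier_mat n m" and ab: "a < n" "b < n"
  shows "(H * X * mat_adjoint H) $$ (a, b) = (\<Sum>i<m. \<Sum>j<m. H $$ (a, i) * X $$ (i, j) * cnj (H $$ (b, j)))"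
proof -
  have "(H * X * mat_adjoint H) $$ (a, b) = (\<Sum>j<m. (\<Sum>i<m. H $$ (a, i) * X $$ (i, j)) * cnj (H $$ (b, j)))"
    unfolding mat_mult_entry[OF mult_carrier_mat[OF H X] mat_adjoint_carrier[OF H] ab] using ab
    by (intro sum.cong refl) (simp add: mat_mult_entry[OF H X] mat_adjoint_entry[OF H] del: index_mult_mat)
  also have "\<dots> = (\<Sum>i<m. \<Sum>j<m. H $$ (a, i) * X $$ (i, j) * cnj (H $$ (b, j)))"
    unfolding sum_distrib_right by (rule sum.swap)
  finally show ?thesis .
qed

text \<open>Conjugation by \<open>H\<close> and by its adjoint are adjoint maps for the pairing; this carries gradients from the space of
received signals to the covariance of one user.\<close>

lemma frob_conj:
  assumes X: "X \<in> carrier_mat m m" and G: "G \<in> carrier_mat n n" and H: "H \<in> carrier_mat n m"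
  shows "frob n (H * X * mat_adjoint H) G = frob m X (mat_adjoint H * G * H)"
proof -
  note H' = mat_adjoint_carrier[OF H]
  have L: "(H * X * mat_adjoint H) $$ (a, b) = (\<Sum>i<m. \<Sum>j<m. H $$ (a, i) * X $$ (i, j) * cnj (H $$ (b, j)))"
    if "a < n" "b < n" for a b
    by (rule conj_entry[OF X H that])
  have R: "(mat_adjoint H * G * H) $$ (i, j) = (\<Sum>a<n. \<Sum>b<n. cnj (H $$ (a, i)) * G $$ (a, b) * H $$ (b, j))"
    if "i < m" "j < m" for i j
  proof -
    have "(mat_adjoint H * G * H) $$ (i, j) =
        (\<Sum>a<n. \<Sum>b<n. mat_adjoint H $$ (i, a) * G $$ (a, b) * cnj (mat_adjoint H $$ (j, b)))"
      using conj_entry[OF G H' that] unfolding mat_adjoint_adjoint[OF H] .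
    also have "\<dots> = (\<Sum>a<n. \<Sum>b<n. cnj (H $$ (a, i)) * G $$ (a, b) * H $$ (b, j))"
      using that by (intro sum.cong refl) (simp add: mat_adjoint_entry[OF H])
    finally show ?thesis .
  qed
  have "frob n (H * X * mat_adjoint H) G = Re (\<Sum>a<n. \<Sum>b<n. \<Sum>i<m. \<Sum>j<m.
      H $$ (a, i) * X $$ (i, j) * cnj (H $$ (b, j)) * cnj (G $$ (a, b)))"
    unfolding frob_def Re_sum[symmetric]
    by (intro arg_cong[where f = Re] sum.cong refl) (simp add: L sum_distrib_right del: index_mult_mat)
  also have "\<dots> = Re (\<Sum>i<m. \<Sum>j<m. \<Sum>a<n. \<Sum>b<n.
      H $$ (a, i) * X $$ (i, j) * cnj (H $$ (b, j)) * cnj (G $$ (a, b)))"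
    by (subst sum_swap4) (rule refl)
  also have "\<dots> = frob m X (mat_adjoint H * G * H)"
    unfolding frob_def Re_sum[symmetric]
    by (intro arg_cong[where f = Re] sum.cong refl)
      (simp add: R sum_distrib_left mult_ac del: index_mult_mat)
  finally show ?thesis .
qed

lemma frob_cauchy_schwarz: "\<bar>frob n A B\<bar> \<le> sqrt (frob n A A) * sqrt (frob n B B)"
proof -
  let ?I = "{..<n} \<times> {..<n}"
  have le: "\<bar>Re (x * cnj y)\<bar> \<le> \<bar>cmod x\<bar> * \<bar>cmod y\<bar>" for x y
    using abs_Re_le_cmod[of "x * cnj y"] by (simp only: norm_mult complex_mod_cnj abs_norm_cancel)
  have "\<bar>frob n A B\<bar> \<le> (\<Sum>x\<in>?I. \<bar>cmod (A $$ x)\<bar> * \<bar>cmod (B $$ x)\<bar>)"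
    unfolding frob_def sum.cartesian_product
    by (rule order_trans[OF sum_abs], rule sum_mono) (use le in \<open>auto simp del: times_complex.sel\<close>)
  also have "\<dots> \<le> L2_set (\<lambda>x. cmod (A $$ x)) ?I * L2_set (\<lambda>x. cmod (B $$ x)) ?I"
    by (rule L2_set_mult_ineq)
  finally show ?thesis by (simp add: L2_set_def frob_self sum.cartesian_product split_beta)
qed

abbreviation fnorm :: "nat \<Rightarrow> complex mat \<Rightarrow> real" where
  "fnorm n A \<equiv> sqrt (frob n A A)"

lemma frob_le_fnorm: "frob n A B \<le> fnorm n A * fnorm n B"
  using frob_cauchy_schwarz[of n A B] by simp

lemma fnorm_triangle:
  assumes "A \<in> carrier_mat n n" "B \<in> carrier_mat n n"
  shows "fnorm n (A + B) \<le> fnorm n A + fnorm n B"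
proof (rule real_le_lsqrt)
  have "frob n (A + B) (A + B) = frob n A A + 2 * frob n A B + frob n B B"
    using assms by (simp add: frob_add_left frob_add_right frob_commute[of n B A])
  also have "\<dots> \<le> frob n A A + 2 * (fnorm n A * fnorm n B) + frob n B B"
    using frob_le_fnorm[of n A B] by simp
  also have "\<dots> = (fnorm n A + fnorm n B)\<^sup>2" by (simp add: power2_sum frob_self_nonneg)
  finally show "frob n (A + B) (A + B) \<le> (fnorm n A + fnorm n B)\<^sup>2" .
qed (simp add: frob_self_nonneg)

lemma fnorm_smult:
  assumes "A \<in> carrier_mat n n"
  shows "fnorm n (complex_of_real c \<cdot>\<^sub>m A) = \<bar>c\<bar> * fnorm n A"
  using assms by (simp add: frob_smult_left frob_smult_right real_sqrt_mult mult.assoc[symmetric])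

lemma fnorm_diff_triangle:
  assumes "A \<in> carrier_mat n n" "B \<in> carrier_mat n n"
  shows "fnorm n (A - B) \<le> fnorm n A + fnorm n B"
proof -
  have e: "A - B = A + complex_of_real (-1) \<cdot>\<^sub>m B" using assms by (intro eq_matI) auto
  show ?thesis unfolding e using fnorm_triangle[of A n "complex_of_real (-1) \<cdot>\<^sub>m B"] fnorm_smult[OF assms(2), of "-1"] assms
    by simp
qed

lemma frob_diff_0_imp_eq:
  assumes A: "A \<in> carrier_mat n n" and B: "B \<in> carrier_mat n n" and z: "frob n (A - B) (A - B) \<le> 0"
  shows "A = B"
proof (rule eq_matI)
  fix i j assume "i < dim_row B" "j < dim_col B"
  hence ij: "i < n" "j < n" using B by auto
  have "(cmod ((A - B) $$ (i, j)))\<^sup>2 \<le> 0" using frob_entry_le[OF ij, of "A - B"] z by linarith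
  thus "A $$ (i, j) = B $$ (i, j)" using A B ij by simp
qed (use A B in auto)

section \<open>Functional calculus in an eigenbasis\<close>

lemma unitary_adjoint: "unitary_mat n U \<Longrightarrow> unitary_mat n (mat_adjoint U)"
  using mat_adjoint_carrier[of U n n] mat_adjoint_adjoint[of U n n] by (auto simp: unitary_mat_def)

lemma spec_mat_mult:
  assumes "unitary_mat n U"
  shows "spec_mat n U \<alpha> * spec_mat n U \<beta> = spec_mat n U (\<lambda>l. \<alpha> l * \<beta> l)"
proof -
  from assms have U: "U \<in> carrier_mat n n" "mat_adjoint U * U = 1\<^sub>m n" by (auto simp: unitary_mat_def)
  note U' = mat_adjoint_carrier[OF U(1)]
  let ?D = "\<lambda>\<alpha>. mat_diag n (\<lambda>l. complex_of_real (\<alpha> l))"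
  have D: "?D \<alpha> \<in> carrier_mat n n" for \<alpha> by simp
  note as = assoc_mult_mat[where ?n\<^sub>1=n and ?n\<^sub>2=n and ?n\<^sub>3=n and ?n\<^sub>4=n]
  have "spec_mat n U \<alpha> * spec_mat n U \<beta> = U * (?D \<alpha> * (mat_adjoint U * U) * ?D \<beta>) * mat_adjoint U"
    unfolding spec_mat_def using U(1) U' D[of \<alpha>] D[of \<beta>]
    by (simp add: as mult_carrier_mat[of _ n n] del: mat_diag_diag)
  also have "?D \<alpha> * (mat_adjoint U * U) * ?D \<beta> = ?D (\<lambda>l. \<alpha> l * \<beta> l)"
    unfolding U(2) right_mult_one_mat[OF D] by simp
  finally show ?thesis unfolding spec_mat_def .
qed

lemma spec_mat_one: "unitary_mat n U \<Longrightarrow> spec_mat n U (\<lambda>_. 1) = 1\<^sub>m n"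
  unfolding spec_mat_def by (auto simp: unitary_mat_def)

lemma spec_mat_pow:
  assumes "unitary_mat n U"
  shows "spec_mat n U \<alpha> ^\<^sub>m r = spec_mat n U (\<lambda>l. \<alpha> l ^ r)"
proof (induction r)
  case 0
  show ?case using spec_mat_carrier[OF unitary_carrier[OF assms], of \<alpha>] spec_mat_one[OF assms] by simp
next
  case (Suc r)
  show ?case using Suc spec_mat_mult[OF assms] by (simp add: mult.commute)
qed

lemma spec_mat_smult:
  assumes U: "U \<in> carrier_mat n n"
  shows "complex_of_real c \<cdot>\<^sub>m spec_mat n U \<alpha> = spec_mat n U (\<lambda>l. c * \<alpha> l)"
  using spec_mat_carrier[OF U, of \<alpha>] spec_mat_carrier[OF U, of "\<lambda>l. c * \<alpha> l"]
  by (intro eq_matI) (auto simp: spec_mat_entry[OF U] sum_distrib_left mult_ac)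

lemma spec_mat_diff:
  assumes U: "U \<in> carrier_mat n n"
  shows "spec_mat n U \<alpha> - spec_mat n U \<beta> = spec_mat n U (\<lambda>l. \<alpha> l - \<beta> l)"
proof (rule eq_matI)
  note c = spec_mat_carrier[OF U, of \<alpha>] spec_mat_carrier[OF U, of "\<lambda>l. \<alpha> l - \<beta> l"] spec_mat_carrier[OF U, of \<beta>]
  fix i j assume "i < dim_row (spec_mat n U (\<lambda>l. \<alpha> l - \<beta> l))" "j < dim_col (spec_mat n U (\<lambda>l. \<alpha> l - \<beta> l))"
  hence ij: "i < n" "j < n" using c by auto
  show "(spec_mat n U \<alpha> - spec_mat n U \<beta>) $$ (i, j) = spec_mat n U (\<lambda>l. \<alpha> l - \<beta> l) $$ (i, j)"
    using c ij by (simp add: spec_mat_entry[OF U ij] algebra_simps flip: sum_subtractf)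
qed (use spec_mat_carrier[OF U, of \<alpha>] spec_mat_carrier[OF U, of "\<lambda>l. \<alpha> l - \<beta> l"] spec_mat_carrier[OF U, of \<beta>] in auto)

lemma spec_mat_sums:
  assumes U: "U \<in> carrier_mat n n" and s: "\<And>l. l < n \<Longrightarrow> (\<lambda>r. f r l) sums g l" and ij: "i < n" "j < n"
  shows "(\<lambda>r. spec_mat n U (f r) $$ (i, j)) sums spec_mat n U g $$ (i, j)"
  unfolding spec_mat_entry[OF U ij]
  by (intro sums_sum sums_mult sums_mult2) (auto intro!: sums_of_real s)

lemma spec_mat_exp:
  assumes "unitary_mat n U"
  shows "mat_exp (spec_mat n U a) = spec_mat n U (\<lambda>l. exp (a l))"
proof (rule eq_matI)
  note U = unitary_carrier[OF assms]
  note c = spec_mat_carrier[OF U, of a] spec_mat_carrier[OF U, of "\<lambda>l. exp (a l)"]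
  fix i j assume "i < dim_row (spec_mat n U (\<lambda>l. exp (a l)))" "j < dim_col (spec_mat n U (\<lambda>l. exp (a l)))"
  hence ij: "i < n" "j < n" using c by auto
  have "(spec_mat n U a ^\<^sub>m r) $$ (i, j) / fact r = spec_mat n U (\<lambda>l. a l ^ r /\<^sub>R fact r) $$ (i, j)" for r
    unfolding spec_mat_pow[OF assms] spec_mat_entry[OF U ij] sum_divide_distrib
    by (intro sum.cong refl) (simp add: divide_simps)
  moreover have "(\<lambda>r. spec_mat n U (\<lambda>l. a l ^ r /\<^sub>R fact r) $$ (i, j)) sums spec_mat n U (\<lambda>l. exp (a l)) $$ (i, j)"
    by (rule spec_mat_sums[OF U exp_converges ij])
  ultimately show "mat_exp (spec_mat n U a) $$ (i, j) = spec_mat n U (\<lambda>l. exp (a l)) $$ (i, j)"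
    using ij c sums_unique[of _ "spec_mat n U (\<lambda>l. exp (a l)) $$ (i, j)"] by (simp add: mat_exp_def)
qed (use spec_mat_carrier[OF unitary_carrier[OF assms], of a]
      spec_mat_carrier[OF unitary_carrier[OF assms], of "\<lambda>l. exp (a l)"] in \<open>auto simp: mat_exp_def\<close>)

lemma spec_mat_trace:
  assumes "unitary_mat n U"
  shows "mat_trace (spec_mat n U a) = complex_of_real (\<Sum>l<n. a l)"
proof -
  note U = unitary_carrier[OF assms]
  have "mat_trace (spec_mat n U a) = (\<Sum>i<n. \<Sum>l<n. U $$ (i, l) * complex_of_real (a l) * cnj (U $$ (i, l)))"
    unfolding mat_trace_def using spec_mat_carrier[OF U, of a] by (auto simp: spec_mat_entry[OF U])
  also have "\<dots> = (\<Sum>l<n. complex_of_real (a l) * (\<Sum>i<n. cnj (U $$ (i, l)) * U $$ (i, l)))"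
    by (subst sum.swap) (simp add: sum_distrib_left mult_ac)
  also have "\<dots> = complex_of_real (\<Sum>l<n. a l)" by (simp add: unitary_cols[OF assms])
  finally show ?thesis .
qed

lemma spec_mat_det:
  assumes "unitary_mat n U"
  shows "Determinant.det (spec_mat n U a) = complex_of_real (\<Prod>l<n. a l)"
proof -
  let ?D = "mat_diag n (\<lambda>l. complex_of_real (a l))"
  from assms have U: "U \<in> carrier_mat n n" "mat_adjoint U * U = 1\<^sub>m n" by (auto simp: unitary_mat_def)
  note U' = mat_adjoint_carrier[OF U(1)]
  have D: "?D \<in> carrier_mat n n" by simp
  have 1: "Determinant.det (mat_adjoint U) * Determinant.det U = 1"
    using det_mult[OF U' U(1)] U(2) by simp
  have "Determinant.det ?D = prod_list (diag_mat ?D)"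
    by (rule det_upper_triangular[OF _ D]) (auto simp: upper_triangular_def mat_diag_def)
  also have "diag_mat ?D = map (\<lambda>l. complex_of_real (a l)) [0..<n]"
    unfolding diag_mat_def by (simp add: mat_diag_def)
  also have "prod_list \<dots> = (\<Prod>l<n. complex_of_real (a l))"
    by (simp add: prod.list_conv_set_nth atLeast0LessThan)
  finally have "Determinant.det ?D = complex_of_real (\<Prod>l<n. a l)" by simp
  thus ?thesis unfolding spec_mat_def
    using 1 by (simp add: det_mult[OF mult_carrier_mat[OF U(1) D] U'] det_mult[OF U(1) D] mult_ac)
qed

lemma mat_inv_eqI:
  assumes A: "A \<in> carrier_mat n n" and B: "B \<in> carrier_mat n n" and AB: "A * B = 1\<^sub>m n" and BA: "B * A = 1\<^sub>m n"
  shows "mat_inv A = B"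
proof -
  have "A \<in> Units (ring_mat TYPE(complex) n ())"
    using assms by (auto simp: Units_def ring_mat_simps)
  with mat_inverse(1)[OF A, of "()"] obtain C where C: "mat_inverse A = Some C" by (cases "mat_inverse A") auto
  with mat_inverse(2)[OF A] have C': "A * C = 1\<^sub>m n" "C * A = 1\<^sub>m n" "C \<in> carrier_mat n n" by auto
  have "C = C * (A * B)" using C' AB by simp
  also have "\<dots> = (C * A) * B" by (rule assoc_mult_mat[OF C'(3) A B, symmetric])
  also have "\<dots> = B" using C' B by simp
  finally show ?thesis using C by (simp add: mat_inv_def)
qed

lemma spec_mat_inv:
  assumes "unitary_mat n U" "\<And>l. l < n \<Longrightarrow> a l \<noteq> 0"
  shows "mat_inv (spec_mat n U a) = spec_mat n U (\<lambda>l. inverse (a l))"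
proof -
  note U = unitary_carrier[OF assms(1)]
  have e: "spec_mat n U f = 1\<^sub>m n" if "\<And>l. l < n \<Longrightarrow> f l = 1" for f
  proof -
    have "spec_mat n U f = spec_mat n U (\<lambda>_. 1)"
      unfolding spec_mat_def using that by (intro arg_cong2[where f = "(*)"] refl) (auto simp: mat_diag_def)
    thus ?thesis using spec_mat_one[OF assms(1)] by simp
  qed
  show ?thesis
    by (rule mat_inv_eqI[OF spec_mat_carrier[OF U] spec_mat_carrier[OF U]];
        unfold spec_mat_mult[OF assms(1)]; rule e; simp add: assms(2))
qed

text \<open>The weights \<open>w\<^sub>l\<^sub>m\<close> that compare two eigenbases.\<close>

definition overlap :: "nat \<Rightarrow> complex mat \<Rightarrow> complex mat \<Rightarrow> nat \<Rightarrow> nat \<Rightarrow> real" where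
  "overlap n U V l m = (cmod (\<Sum>i<n. cnj (U $$ (i, l)) * V $$ (i, m)))\<^sup>2"

lemma overlap_nonneg: "0 \<le> overlap n U V l m" by (simp add: overlap_def)

lemma overlap_as_entry:
  assumes "unitary_mat n U" "unitary_mat n V" "l < n" "m < n"
  shows "complex_of_real (overlap n U V l m) =
    (mat_adjoint U * V) $$ (l, m) * cnj ((mat_adjoint U * V) $$ (l, m))"
proof -
  note U = unitary_carrier[OF assms(1)] note V = unitary_carrier[OF assms(2)]
  have "(mat_adjoint U * V) $$ (l, m) = (\<Sum>i<n. cnj (U $$ (i, l)) * V $$ (i, m))"
    unfolding mat_mult_entry[OF mat_adjoint_carrier[OF U] V assms(3,4)]
    by (intro sum.cong refl) (simp add: mat_adjoint_entry[OF U] assms)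
  thus ?thesis unfolding overlap_def complex_norm_square by simp
qed

lemma overlap_row_sum:
  assumes "unitary_mat n U" "unitary_mat n V" "l < n"
  shows "(\<Sum>m<n. overlap n U V l m) = 1"
proof -
  have "complex_of_real (\<Sum>m<n. overlap n U V l m) = 1"
    using unitary_rows[OF unitary_mult[OF unitary_adjoint[OF assms(1)] assms(2)] assms(3) assms(3)]
    by (simp add: overlap_as_entry[OF assms] del: index_mult_mat)
  thus ?thesis by (metis of_real_eq_1_iff)
qed

lemma overlap_col_sum:
  assumes "unitary_mat n U" "unitary_mat n V" "m < n"
  shows "(\<Sum>l<n. overlap n U V l m) = 1"
proof -
  have "complex_of_real (\<Sum>l<n. overlap n U V l m) = 1"
    using unitary_cols[OF unitary_mult[OF unitary_adjoint[OF assms(1)] assms(2)] assms(3) assms(3)]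
    by (simp add: overlap_as_entry[OF assms(1,2) _ assms(3)] mult.commute del: index_mult_mat)
  thus ?thesis by (metis of_real_eq_1_iff)
qed

lemma frob_spec:
  assumes U: "U \<in> carrier_mat n n" and V: "V \<in> carrier_mat n n"
  shows "frob n (spec_mat n U \<alpha>) (spec_mat n V \<beta>) = (\<Sum>l<n. \<Sum>m<n. overlap n U V l m * (\<alpha> l * \<beta> m))"
proof -
  have "frob n (spec_mat n U \<alpha>) (spec_mat n V \<beta>) = Re (\<Sum>i<n. \<Sum>j<n. \<Sum>l<n. \<Sum>m<n.
     (U $$ (i, l) * complex_of_real (\<alpha> l) * cnj (U $$ (j, l))) * (cnj (V $$ (i, m)) * complex_of_real (\<beta> m) * V $$ (j, m)))"
    unfolding frob_def Re_sum[symmetric]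
    by (intro arg_cong[where f = Re] sum.cong refl) (simp add: spec_mat_entry[OF U] spec_mat_entry[OF V] sum_product)
  also have "\<dots> = Re (\<Sum>l<n. \<Sum>m<n. \<Sum>i<n. \<Sum>j<n.
     (U $$ (i, l) * complex_of_real (\<alpha> l) * cnj (U $$ (j, l))) * (cnj (V $$ (i, m)) * complex_of_real (\<beta> m) * V $$ (j, m)))"
    by (subst sum_swap4) (rule refl)
  also have "\<dots> = Re (\<Sum>l<n. \<Sum>m<n. complex_of_real (\<alpha> l * \<beta> m) *
      ((\<Sum>j<n. cnj (U $$ (j, l)) * V $$ (j, m)) * cnj (\<Sum>i<n. cnj (U $$ (i, l)) * V $$ (i, m))))"
    by (intro arg_cong[where f = Re] sum.cong refl)
      (simp add: sum_product sum_distrib_left mult_ac, rule sum.swap)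
  also have "\<dots> = (\<Sum>l<n. \<Sum>m<n. overlap n U V l m * (\<alpha> l * \<beta> m))"
    unfolding overlap_def complex_norm_square[symmetric] by (simp add: mult.commute flip: of_real_mult of_real_power)
  finally show ?thesis .
qed

lemma frob_spec_same:
  assumes U: "unitary_mat n U"
  shows "frob n (spec_mat n U \<alpha>) (spec_mat n U \<beta>) = (\<Sum>l<n. \<alpha> l * \<beta> l)"
proof -
  have "overlap n U U l m = (if l = m then 1 else 0)" if "l < n" "m < n" for l m
    unfolding overlap_def unitary_cols[OF U that] by simp
  hence "(\<Sum>l<n. \<Sum>m<n. overlap n U U l m * (\<alpha> l * \<beta> m)) = (\<Sum>l<n. \<Sum>m<n. if l = m then \<alpha> l * \<beta> m else 0)"
    by (intro sum.cong refl) simp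
  thus ?thesis unfolding frob_spec[OF unitary_carrier[OF U] unitary_carrier[OF U]] by simp
qed

text \<open>With the weights of the two bases all four pairings take the form of one double sum, the pure ones because rows
and columns of the weights sum to one. Any expression that is bilinear in functions of the two matrices can
therefore be estimated term by term.\<close>

lemma frob_spec_mixed:
  assumes U: "unitary_mat n U" and V: "unitary_mat n V"
  shows "frob n (spec_mat n U \<alpha>) (spec_mat n V \<beta>) = (\<Sum>l<n. \<Sum>m<n. overlap n U V l m * (\<alpha> l * \<beta> m))"
    and "frob n (spec_mat n V \<beta>) (spec_mat n U \<alpha>) = (\<Sum>l<n. \<Sum>m<n. overlap n U V l m * (\<alpha> l * \<beta> m))"
    and "frob n (spec_mat n U \<alpha>) (spec_mat n U \<alpha>') = (\<Sum>l<n. \<Sum>m<n. overlap n U V l m * (\<alpha> l * \<alpha>' l))"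
    and "frob n (spec_mat n V \<beta>) (spec_mat n V \<beta>') = (\<Sum>l<n. \<Sum>m<n. overlap n U V l m * (\<beta> m * \<beta>' m))"
proof -
  note rs = overlap_row_sum[OF U V] and cs = overlap_col_sum[OF U V]
  show 1: "frob n (spec_mat n U \<alpha>) (spec_mat n V \<beta>) = (\<Sum>l<n. \<Sum>m<n. overlap n U V l m * (\<alpha> l * \<beta> m))"
    by (rule frob_spec[OF unitary_carrier[OF U] unitary_carrier[OF V]])
  show "frob n (spec_mat n V \<beta>) (spec_mat n U \<alpha>) = (\<Sum>l<n. \<Sum>m<n. overlap n U V l m * (\<alpha> l * \<beta> m))"
    unfolding frob_commute[of n "spec_mat n V \<beta>"] by (rule 1)
  have "(\<Sum>l<n. \<alpha> l * \<alpha>' l) = (\<Sum>l<n. (\<Sum>m<n. overlap n U V l m) * (\<alpha> l * \<alpha>' l))" by (simp add: rs)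
  thus "frob n (spec_mat n U \<alpha>) (spec_mat n U \<alpha>') = (\<Sum>l<n. \<Sum>m<n. overlap n U V l m * (\<alpha> l * \<alpha>' l))"
    unfolding frob_spec_same[OF U] by (simp add: sum_distrib_right)
  have "(\<Sum>m<n. \<beta> m * \<beta>' m) = (\<Sum>m<n. (\<Sum>l<n. overlap n U V l m) * (\<beta> m * \<beta>' m))" by (simp add: cs)
  also have "\<dots> = (\<Sum>l<n. \<Sum>m<n. overlap n U V l m * (\<beta> m * \<beta>' m))"
    unfolding sum_distrib_right by (rule sum.swap)
  finally show "frob n (spec_mat n V \<beta>) (spec_mat n V \<beta>') = (\<Sum>l<n. \<Sum>m<n. overlap n U V l m * (\<beta> m * \<beta>' m))"
    unfolding frob_spec_same[OF V] .
qed

section \<open>The log-partition function and the log-determinant\<close>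

definition log_trace_exp :: "complex mat \<Rightarrow> real" where
  "log_trace_exp Y = ln (Re (mat_trace (mat_exp Y)))"

lemma spec_log_trace_exp: "unitary_mat n U \<Longrightarrow> log_trace_exp (spec_mat n U a) = ln (\<Sum>l<n. exp (a l))"
  by (simp add: log_trace_exp_def spec_mat_exp spec_mat_trace)

lemma spec_gibbs:
  assumes "unitary_mat n U"
  shows "gibbs (spec_mat n U a) = spec_mat n U (\<lambda>l. exp (a l) / (\<Sum>l<n. exp (a l)))"
proof -
  have "inverse (mat_trace (mat_exp (spec_mat n U a))) = complex_of_real (inverse (\<Sum>l<n. exp (a l)))"
    by (simp add: spec_mat_exp[OF assms] spec_mat_trace[OF assms])
  thus ?thesis unfolding gibbs_def
    by (simp add: spec_mat_exp[OF assms] spec_mat_smult[OF unitary_carrier[OF assms]] divide_inverse mult.commute del: of_real_inverse)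
qed

lemma spec_log_det:
  assumes "unitary_mat n U" "\<And>l. l < n \<Longrightarrow> 0 < a l"
  shows "log_det (spec_mat n U a) = (\<Sum>l<n. ln (a l))"
  unfolding log_det_def spec_mat_det[OF assms(1)] Re_complex_of_real using assms(2) by (intro ln_prod) force+

lemma eigenvalue_sq_le:
  assumes "unitary_mat n U" "l < n"
  shows "(a l)\<^sup>2 \<le> frob n (spec_mat n U a) (spec_mat n U a)"
  using assms(2) member_le_sum[of l "{..<n}" "\<lambda>l. (a l)\<^sup>2"]
  by (simp add: frob_spec_same[OF assms(1)] power2_eq_square)

text \<open>Both the tangent inequality and the smoothness estimate compare \<open>exp\<close> with its linear or quadratic
approximation, averaged against one probability distribution: the overlaps of the two eigenbases weighted with
the eigenvalues of the Gibbs state. Here \<open>q\<close> is this distribution, and \<open>b m - a l\<close> the increment.\<close>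

lemma log_trace_exp_gap:
  assumes hA: "hermitian_mat n A" and hB: "hermitian_mat n B" and n: "0 < n"
  obtains q b a where
    "\<forall>l<n. \<forall>m<n. 0 \<le> (q l m :: real)" "(\<Sum>l<n. \<Sum>m<n. q l m) = 1"
    "frob n (gibbs A) (B - A) = (\<Sum>l<n. \<Sum>m<n. q l m * (b m - a l))"
    "exp (log_trace_exp B - log_trace_exp A) = (\<Sum>l<n. \<Sum>m<n. q l m * exp (b m - a l))"
    "\<forall>l<n. (a l)\<^sup>2 \<le> frob n A A" "\<forall>m<n. (b m)\<^sup>2 \<le> frob n B B"
    "(\<Sum>l<n. \<Sum>m<n. q l m * (b m - a l)\<^sup>2) \<le> frob n (B - A) (B - A)"
proof -
  obtain U a where U: "unitary_mat n U" and A: "A = spec_mat n U a" using hermitian_spectral[OF hA] .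
  obtain V b where V: "unitary_mat n V" and B: "B = spec_mat n V b" using hermitian_spectral[OF hB] .
  define w where "w = overlap n U V"
  have w: "0 \<le> w l m" for l m by (simp add: w_def overlap_nonneg)
  have rs: "(\<Sum>m<n. w l m) = 1" if "l < n" for l unfolding w_def by (rule overlap_row_sum[OF U V that])
  have cs: "(\<Sum>l<n. w l m) = 1" if "m < n" for m unfolding w_def by (rule overlap_col_sum[OF U V that])
  note fr = frob_spec_mixed[OF U V, folded w_def]
  note Uc = unitary_carrier[OF U] note Vc = unitary_carrier[OF V]
  define ZA where "ZA = (\<Sum>l<n. exp (a l))"
  define ZB where "ZB = (\<Sum>l<n. exp (b l))"
  have Z: "0 < ZA" "0 < ZB" unfolding ZA_def ZB_def using n by (auto intro!: sum_pos)
  define p where "p l = exp (a l) / ZA" for l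
  have p0: "0 \<le> p l" for l using Z by (simp add: p_def)
  have psum: "(\<Sum>l<n. p l) = 1" unfolding p_def sum_divide_distrib[symmetric] using Z by (simp add: ZA_def)
  have p1: "p l \<le> 1" if "l < n" for l
    using member_le_sum[of l "{..<n}" p] p0 that psum by simp
  define q where "q l m = w l m * p l" for l m
  have G: "gibbs A = spec_mat n U p" unfolding A spec_gibbs[OF U] p_def ZA_def ..
  have Dc: "A \<in> carrier_mat n n" "B \<in> carrier_mat n n"
    using hA hB by (auto simp: hermitian_mat_def)
  show ?thesis
  proof (rule that[of q b a])
    show "\<forall>l<n. \<forall>m<n. 0 \<le> q l m" using w p0 by (simp add: q_def)
    show "(\<Sum>l<n. \<Sum>m<n. q l m) = 1" unfolding q_def
      using rs psum by (simp add: sum_distrib_right[symmetric])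
    show "frob n (gibbs A) (B - A) = (\<Sum>l<n. \<Sum>m<n. q l m * (b m - a l))"
      unfolding frob_diff_right[OF Dc(2,1)] G
      unfolding A B fr q_def by (simp add: algebra_simps flip: sum_subtractf)
    \<comment> \<open>The factor \<open>exp (a l)\<close> in \<open>q l m\<close> cancels, which leaves the ratio of the two partition functions.\<close>
    have "(\<Sum>l<n. \<Sum>m<n. q l m * exp (b m - a l)) = (\<Sum>l<n. \<Sum>m<n. w l m * exp (b m) / ZA)"
      unfolding q_def p_def by (intro sum.cong refl) (simp add: exp_diff)
    also have "\<dots> = (\<Sum>m<n. (\<Sum>l<n. w l m) * exp (b m) / ZA)"
      by (subst sum.swap) (simp add: sum_distrib_right sum_divide_distrib)
    also have "\<dots> = ZB / ZA" by (simp add: cs ZB_def sum_divide_distrib)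
    finally have s: "(\<Sum>l<n. \<Sum>m<n. q l m * exp (b m - a l)) = ZB / ZA" .
    show "exp (log_trace_exp B - log_trace_exp A) = (\<Sum>l<n. \<Sum>m<n. q l m * exp (b m - a l))"
      unfolding s unfolding A B spec_log_trace_exp[OF U] spec_log_trace_exp[OF V]
        ZA_def[symmetric] ZB_def[symmetric] using Z by (simp add: exp_diff)
    show "\<forall>l<n. (a l)\<^sup>2 \<le> frob n A A" unfolding A using eigenvalue_sq_le[OF U] by blast
    show "\<forall>l<n. (b l)\<^sup>2 \<le> frob n B B" unfolding B using eigenvalue_sq_le[OF V] by blast
    have "(\<Sum>l<n. \<Sum>m<n. q l m * (b m - a l)\<^sup>2) \<le> (\<Sum>l<n. \<Sum>m<n. w l m * (b m - a l)\<^sup>2)"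
      unfolding q_def using p1 w by (intro sum_mono mult_right_mono) (auto intro: mult_left_le)
    also have "\<dots> = frob n (B - A) (B - A)"
      using Dc by (simp add: frob_diff_left frob_diff_right)
        (simp add: A B fr power2_eq_square algebra_simps flip: sum_subtractf sum.distrib)
    finally show "(\<Sum>l<n. \<Sum>m<n. q l m * (b m - a l)\<^sup>2) \<le> frob n (B - A) (B - A)" .
  qed
qed

text \<open>Jensen's inequality for \<open>exp\<close> (the Peierls-Bogoliubov inequality): the Gibbs state is the gradient of the convex
function \<open>log_trace_exp\<close>.\<close>

theorem log_trace_exp_tangent:
  assumes "hermitian_mat n A" "hermitian_mat n B" "0 < n"
  shows "log_trace_exp A + frob n (gibbs A) (B - A) \<le> log_trace_exp B"
proof -
  obtain q b a where q0: "\<forall>l<n. \<forall>m<n. 0 \<le> (q l m :: real)" and qs: "(\<Sum>l<n. \<Sum>m<n. q l m) = 1"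
    and t: "frob n (gibbs A) (B - A) = (\<Sum>l<n. \<Sum>m<n. q l m * (b m - a l))"
    and e: "exp (log_trace_exp B - log_trace_exp A) = (\<Sum>l<n. \<Sum>m<n. q l m * exp (b m - a l))"
    and a0: "\<forall>l<n. (a l)\<^sup>2 \<le> frob n A A" and b0: "\<forall>m<n. (b m)\<^sup>2 \<le> frob n B B"
    and v: "(\<Sum>l<n. \<Sum>m<n. q l m * (b m - a l)\<^sup>2) \<le> frob n (B - A) (B - A)"
    using log_trace_exp_gap[OF assms] .
  note q = q0[rule_format] and a = a0[rule_format] and b = b0[rule_format]
  define s where "s = frob n (gibbs A) (B - A)"
  \<comment> \<open>Jensen by hand: the tangent of \<open>exp\<close> at the mean \<open>s\<close> has mean \<open>exp s\<close>.\<close>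
  have "exp s = (\<Sum>l<n. \<Sum>m<n. q l m * (exp s * (1 + (b m - a l) - s)))"
  proof -
    have "(\<Sum>l<n. \<Sum>m<n. q l m * (exp s * (1 + (b m - a l) - s))) =
      exp s * ((1 - s) * (\<Sum>l<n. \<Sum>m<n. q l m) + (\<Sum>l<n. \<Sum>m<n. q l m * (b m - a l)))"
      by (simp add: sum_distrib_left sum.distrib[symmetric] algebra_simps)
    thus ?thesis unfolding qs t[symmetric] s_def[symmetric] by simp
  qed
  also have "\<dots> \<le> (\<Sum>l<n. \<Sum>m<n. q l m * exp (b m - a l))"
  proof (intro sum_mono mult_left_mono q)
    fix l m
    have "exp s * (1 + ((b m - a l) - s)) \<le> exp s * exp ((b m - a l) - s)"
      by (intro mult_left_mono exp_ge_add_one_self) simp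
    thus "exp s * (1 + (b m - a l) - s) \<le> exp (b m - a l)" by (simp add: exp_add[symmetric] algebra_simps)
  qed auto
  finally show ?thesis unfolding e[symmetric] s_def by simp
qed

text \<open>The increments are bounded by \<open>2 R\<close>, so \<open>exp\<close> lies below a quadratic there. The quadratic term is bounded by the
Frobenius norm because the eigenvalues of a Gibbs state are at most one.\<close>

theorem log_trace_exp_smooth:
  assumes "hermitian_mat n A" "hermitian_mat n B" "0 < n"
    and R: "frob n A A \<le> R\<^sup>2" "frob n B B \<le> R\<^sup>2" "0 \<le> R"
  shows "log_trace_exp B \<le> log_trace_exp A + frob n (gibbs A) (B - A) + exp (2 * R) * frob n (B - A) (B - A)"
proof -
  obtain q b a where q0: "\<forall>l<n. \<forall>m<n. 0 \<le> (q l m :: real)" and qs: "(\<Sum>l<n. \<Sum>m<n. q l m) = 1"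
    and t: "frob n (gibbs A) (B - A) = (\<Sum>l<n. \<Sum>m<n. q l m * (b m - a l))"
    and e: "exp (log_trace_exp B - log_trace_exp A) = (\<Sum>l<n. \<Sum>m<n. q l m * exp (b m - a l))"
    and a0: "\<forall>l<n. (a l)\<^sup>2 \<le> frob n A A" and b0: "\<forall>m<n. (b m)\<^sup>2 \<le> frob n B B"
    and v: "(\<Sum>l<n. \<Sum>m<n. q l m * (b m - a l)\<^sup>2) \<le> frob n (B - A) (B - A)"
    using log_trace_exp_gap[OF assms(1-3)] .
  note q = q0[rule_format] and a = a0[rule_format] and b = b0[rule_format]
  have quad: "exp x \<le> 1 + x + exp (2 * R) * x\<^sup>2" if "\<bar>x\<bar> \<le> 2 * R" for x :: real
  proof -
    obtain s where s: "\<bar>s\<bar> \<le> \<bar>x\<bar>" "exp x = (\<Sum>m<2. x ^ m / fact m) + exp s / fact 2 * x ^ 2"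
      using Maclaurin_exp_le by blast
    have "exp s / 2 * x\<^sup>2 \<le> exp (2 * R) * x\<^sup>2"
    proof (rule mult_right_mono)
      have "exp s \<le> exp (2 * R)" using s(1) that by simp
      thus "exp s / 2 \<le> exp (2 * R)" using exp_gt_zero[of s] by linarith
    qed simp
    thus ?thesis using s(2) by (simp add: numeral_2_eq_2)
  qed
  have "exp (log_trace_exp B - log_trace_exp A) \<le>
      (\<Sum>l<n. \<Sum>m<n. q l m * (1 + (b m - a l) + exp (2 * R) * (b m - a l)\<^sup>2))"
    unfolding e
  proof (intro sum_mono mult_left_mono q quad)
    fix l m assume "l \<in> {..<n}" "m \<in> {..<n}"
    hence "\<bar>a l\<bar> \<le> R" "\<bar>b m\<bar> \<le> R" using a[of l] b[of m] R
      by (auto simp flip: power2_le_iff_abs_le[OF R(3)])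
    thus "\<bar>b m - a l\<bar> \<le> 2 * R" by linarith
  qed auto
  also have "\<dots> = (\<Sum>l<n. \<Sum>m<n. q l m) + (\<Sum>l<n. \<Sum>m<n. q l m * (b m - a l)) +
      exp (2 * R) * (\<Sum>l<n. \<Sum>m<n. q l m * (b m - a l)\<^sup>2)"
    by (simp add: sum_distrib_left sum.distrib[symmetric] algebra_simps)
  also have "\<dots> = 1 + frob n (gibbs A) (B - A) + exp (2 * R) * (\<Sum>l<n. \<Sum>m<n. q l m * (b m - a l)\<^sup>2)"
    unfolding t qs ..
  also have "\<dots> \<le> 1 + frob n (gibbs A) (B - A) + exp (2 * R) * frob n (B - A) (B - A)"
    using v by simp
  finally show ?thesis
    using exp_ge_add_one_self[of "log_trace_exp B - log_trace_exp A"] by linarith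
qed

text \<open>The matrices that dominate the identity. The received signal covariances are of this kind, and the bound makes
inversion nonexpansive, whatever the channel.\<close>

definition ge_one_mat :: "nat \<Rightarrow> complex mat \<Rightarrow> bool" where
  "ge_one_mat n A \<longleftrightarrow> (\<exists>U a. unitary_mat n U \<and> A = spec_mat n U a \<and> (\<forall>l<n. 1 \<le> a l))"

lemma ge_one_mat_hermitian: "ge_one_mat n A \<Longrightarrow> hermitian_mat n A"
  by (auto simp: ge_one_mat_def intro: spec_mat_hermitian unitary_carrier)

lemma ge_one_mat_inv_hermitian: "ge_one_mat n A \<Longrightarrow> hermitian_mat n (mat_inv A)"
proof -
  assume "ge_one_mat n A"
  then obtain U a where U: "unitary_mat n U" and A: "A = spec_mat n U a" and a: "\<And>l. l < n \<Longrightarrow> 1 \<le> a l"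
    by (auto simp: ge_one_mat_def)
  have "a l \<noteq> 0" if "l < n" for l using a[OF that] by simp
  hence "mat_inv A = spec_mat n U (\<lambda>l. inverse (a l))" unfolding A by (rule spec_mat_inv[OF U])
  thus ?thesis using spec_mat_hermitian[OF unitary_carrier[OF U]] by simp
qed

lemma ge_one_mat_inv_carrier: "ge_one_mat n A \<Longrightarrow> mat_inv A \<in> carrier_mat n n"
  using ge_one_mat_inv_hermitian by (auto simp: hermitian_mat_def)

lemma ge_one_mat_inv_bound:
  assumes "ge_one_mat n A"
  shows "frob n (mat_inv A) (mat_inv A) \<le> real n"
proof -
  obtain U a where U: "unitary_mat n U" and A: "A = spec_mat n U a" and a: "\<And>l. l < n \<Longrightarrow> 1 \<le> a l"
    using assms by (auto simp: ge_one_mat_def)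
  have a0: "a l \<noteq> 0" if "l < n" for l using a[OF that] by simp
  have "mat_inv A = spec_mat n U (\<lambda>l. inverse (a l))" unfolding A by (rule spec_mat_inv[OF U a0])
  hence "frob n (mat_inv A) (mat_inv A) = (\<Sum>l<n. inverse (a l) * inverse (a l))"
    by (simp add: frob_spec_same[OF U])
  also have "\<dots> \<le> (\<Sum>l<n. 1)"
  proof (rule sum_mono)
    fix l assume "l \<in> {..<n}"
    hence "1 \<le> a l" using a by simp
    hence "0 \<le> inverse (a l)" "inverse (a l) \<le> 1" by (auto simp: inverse_le_1_iff)
    thus "inverse (a l) * inverse (a l) \<le> 1" using mult_le_one by blast
  qed
  finally show ?thesis by simp
qed

lemma log_det_nonneg:
  assumes "ge_one_mat n A"
  shows "0 \<le> log_det A"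
proof -
  obtain U a where U: "unitary_mat n U" and A: "A = spec_mat n U a" and a: "\<And>l. l < n \<Longrightarrow> 1 \<le> a l"
    using assms by (auto simp: ge_one_mat_def)
  have "log_det A = (\<Sum>l<n. ln (a l))" unfolding A using a by (intro spec_log_det[OF U]) force
  thus ?thesis using a by (auto intro!: sum_nonneg)
qed

text \<open>The four quantities that the concavity estimates compare, as averages over the same weights \<open>w\<close>. Each estimate is
then an inequality between two real numbers \<open>a l\<close> and \<open>b m\<close>.\<close>

lemma ge_one_mat_pair:
  assumes gA: "ge_one_mat n A" and gB: "ge_one_mat n B"
  obtains w a b where
    "\<forall>l<n. \<forall>m<n. 0 \<le> (w l m :: real)" "\<forall>l<n. 1 \<le> (a l :: real)" "\<forall>m<n. 1 \<le> (b m :: real)"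
    "log_det B - log_det A = (\<Sum>l<n. \<Sum>m<n. w l m * (ln (b m) - ln (a l)))"
    "frob n (mat_inv A) (B - A) = (\<Sum>l<n. \<Sum>m<n. w l m * (b m / a l - 1))"
    "frob n (B - A) (mat_inv A - mat_inv B) = (\<Sum>l<n. \<Sum>m<n. w l m * (b m - a l) * (1 / a l - 1 / b m))"
    "frob n (B - A) (B - A) = (\<Sum>l<n. \<Sum>m<n. w l m * (b m - a l)\<^sup>2)"
proof -
  obtain U a where U: "unitary_mat n U" and A: "A = spec_mat n U a" and a: "\<And>l. l < n \<Longrightarrow> 1 \<le> a l"
    using gA by (auto simp: ge_one_mat_def)
  obtain V b where V: "unitary_mat n V" and B: "B = spec_mat n V b" and b: "\<And>l. l < n \<Longrightarrow> 1 \<le> b l"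
    using gB by (auto simp: ge_one_mat_def)
  note Uc = unitary_carrier[OF U] note Vc = unitary_carrier[OF V]
  define w where "w = overlap n U V"
  note fr = frob_spec_mixed[OF U V, folded w_def]
  have Ac: "A \<in> carrier_mat n n" "B \<in> carrier_mat n n" "mat_inv A \<in> carrier_mat n n" "mat_inv B \<in> carrier_mat n n"
    using spec_mat_carrier[OF Uc] spec_mat_carrier[OF Vc] ge_one_mat_inv_carrier[OF gA] ge_one_mat_inv_carrier[OF gB]
    by (auto simp: A B)
  have a0: "a l \<noteq> 0" if "l < n" for l using a[OF that] by simp
  have b0: "b l \<noteq> 0" if "l < n" for l using b[OF that] by simp
  have iA: "mat_inv A = spec_mat n U (\<lambda>l. inverse (a l))" unfolding A by (rule spec_mat_inv[OF U a0])
  have iB: "mat_inv B = spec_mat n V (\<lambda>l. inverse (b l))" unfolding B by (rule spec_mat_inv[OF V b0])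
  show ?thesis
  proof (rule that[of w a b])
    show "\<forall>l<n. \<forall>m<n. 0 \<le> w l m" by (simp add: w_def overlap_nonneg)
    have "log_det A = (\<Sum>l<n. ln (a l))" unfolding A using a by (intro spec_log_det[OF U]) force
    also have "\<dots> = (\<Sum>l<n. \<Sum>m<n. w l m * ln (a l))"
      unfolding w_def by (simp add: overlap_row_sum[OF U V] flip: sum_distrib_right)
    finally have la: "log_det A = \<dots>" .
    have "log_det B = (\<Sum>l<n. ln (b l))" unfolding B using b by (intro spec_log_det[OF V]) force
    also have "\<dots> = (\<Sum>l<n. \<Sum>m<n. w l m * ln (b m))"
      unfolding w_def by (subst sum.swap) (simp add: overlap_col_sum[OF U V] flip: sum_distrib_right)
    finally have lb: "log_det B = \<dots>" .
    show "log_det B - log_det A = (\<Sum>l<n. \<Sum>m<n. w l m * (ln (b m) - ln (a l)))"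
      unfolding la lb by (simp add: algebra_simps flip: sum_subtractf)
    show "frob n (mat_inv A) (B - A) = (\<Sum>l<n. \<Sum>m<n. w l m * (b m / a l - 1))"
      unfolding frob_diff_right[OF Ac(2,1)] iA unfolding A B fr sum_subtractf[symmetric]
      by (intro sum.cong refl) (simp add: a0 field_simps)
    show "frob n (B - A) (mat_inv A - mat_inv B) = (\<Sum>l<n. \<Sum>m<n. w l m * (b m - a l) * (1 / a l - 1 / b m))"
      unfolding frob_diff_left[OF Ac(2,1)] frob_diff_right[OF Ac(3,4)] unfolding iA iB
      unfolding A B fr sum_subtractf[symmetric] by (intro sum.cong refl) (simp add: a0 b0 field_simps)
    show "frob n (B - A) (B - A) = (\<Sum>l<n. \<Sum>m<n. w l m * (b m - a l)\<^sup>2)"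
      unfolding frob_diff_left[OF Ac(2,1)] frob_diff_right[OF Ac(2,1)]
      unfolding A B fr sum_subtractf[symmetric] by (intro sum.cong refl) (simp add: power2_eq_square algebra_simps)
  qed (use a b in auto)
qed

text \<open>Concavity of \<open>log det\<close>, from \<open>ln x \<le> x - 1\<close> at \<open>x = b m / a l\<close>.\<close>

theorem log_det_tangent:
  assumes "ge_one_mat n A" "ge_one_mat n B"
  shows "log_det B \<le> log_det A + frob n (mat_inv A) (B - A)"
proof -
  obtain w a b where **: "\<forall>l<n. \<forall>m<n. 0 \<le> (w l m :: real)" "\<forall>l<n. 1 \<le> (a l :: real)" "\<forall>m<n. 1 \<le> (b m :: real)"
    "log_det B - log_det A = (\<Sum>l<n. \<Sum>m<n. w l m * (ln (b m) - ln (a l)))"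
    "frob n (mat_inv A) (B - A) = (\<Sum>l<n. \<Sum>m<n. w l m * (b m / a l - 1))"
    "frob n (B - A) (mat_inv A - mat_inv B) = (\<Sum>l<n. \<Sum>m<n. w l m * (b m - a l) * (1 / a l - 1 / b m))"
    "frob n (B - A) (B - A) = (\<Sum>l<n. \<Sum>m<n. w l m * (b m - a l)\<^sup>2)"
    using ge_one_mat_pair[OF assms] .
  note * = **[rule_format]
  have "log_det B - log_det A \<le> frob n (mat_inv A) (B - A)"
    unfolding *(4,5)
  proof (intro sum_mono mult_left_mono *(1))
    fix l m assume "l \<in> {..<n}" "m \<in> {..<n}"
    hence "1 \<le> a l" "1 \<le> b m" using * by auto
    thus "ln (b m) - ln (a l) \<le> b m / a l - 1" using ln_le_minus_one[of "b m / a l"] by (simp add: ln_div)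
  qed auto
  thus ?thesis by simp
qed

text \<open>The scalar identity behind both parts is \<open>(b - a) (1/a - 1/b) = (b - a)\<^sup>2 / (a b)\<close>, which is nonnegative and, for
\<open>a, b \<ge> 1\<close>, at most \<open>(b - a)\<^sup>2\<close>.\<close>

theorem mat_inv_antimono:
  assumes "ge_one_mat n A" "ge_one_mat n B"
  shows "frob n (B - A) (mat_inv B - mat_inv A) \<le> 0"
    and "frob n (B - A) (mat_inv A - mat_inv B) \<le> frob n (B - A) (B - A)"
proof -
  obtain w a b where **: "\<forall>l<n. \<forall>m<n. 0 \<le> (w l m :: real)" "\<forall>l<n. 1 \<le> (a l :: real)" "\<forall>m<n. 1 \<le> (b m :: real)"
    "log_det B - log_det A = (\<Sum>l<n. \<Sum>m<n. w l m * (ln (b m) - ln (a l)))"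
    "frob n (mat_inv A) (B - A) = (\<Sum>l<n. \<Sum>m<n. w l m * (b m / a l - 1))"
    "frob n (B - A) (mat_inv A - mat_inv B) = (\<Sum>l<n. \<Sum>m<n. w l m * (b m - a l) * (1 / a l - 1 / b m))"
    "frob n (B - A) (B - A) = (\<Sum>l<n. \<Sum>m<n. w l m * (b m - a l)\<^sup>2)"
    using ge_one_mat_pair[OF assms] .
  note * = **[rule_format]
  have e: "(b m - a l) * (1 / a l - 1 / b m) = (b m - a l)\<^sup>2 / (a l * b m)" if "l < n" "m < n" for l m
    using *(2)[OF that(1)] *(3)[OF that(2)] by (simp add: field_simps power2_eq_square)
  have "0 \<le> frob n (B - A) (mat_inv A - mat_inv B)"
    unfolding *(6) mult.assoc
  proof (intro sum_nonneg)
    fix l m assume "l \<in> {..<n}" "m \<in> {..<n}"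
    thus "0 \<le> w l m * ((b m - a l) * (1 / a l - 1 / b m))" using *(1)[of l m] *(2)[of l] *(3)[of m] by (simp add: e)
  qed
  thus "frob n (B - A) (mat_inv B - mat_inv A) \<le> 0"
    using ge_one_mat_inv_carrier[OF assms(1)] ge_one_mat_inv_carrier[OF assms(2)] by (simp add: frob_diff_right)
  show "frob n (B - A) (mat_inv A - mat_inv B) \<le> frob n (B - A) (B - A)"
    unfolding *(6,7) mult.assoc
  proof (intro sum_mono mult_left_mono *(1))
    fix l m assume lm: "l \<in> {..<n}" "m \<in> {..<n}"
    hence "1 \<le> a l * b m" using mult_mono[of 1 "a l" 1 "b m"] *(2)[of l] *(3)[of m] by simp
    hence "(b m - a l)\<^sup>2 / (a l * b m) \<le> (b m - a l)\<^sup>2 / 1" by (intro divide_left_mono) auto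
    thus "(b m - a l) * (1 / a l - 1 / b m) \<le> (b m - a l)\<^sup>2" using lm by (simp add: e)
  qed auto
qed

text \<open>The tangent inequality at \<open>B\<close> bounds \<open>log_det B\<close> from below with the gradient at \<open>B\<close>; replacing that gradient by
the one at \<open>A\<close> costs the second part of \<open>mat_inv_antimono\<close>.\<close>

corollary log_det_quadratic_lower:
  assumes "ge_one_mat n A" "ge_one_mat n B"
  shows "log_det A + frob n (mat_inv A) (B - A) - frob n (B - A) (B - A) \<le> log_det B"
proof -
  have c: "A \<in> carrier_mat n n" "B \<in> carrier_mat n n"
    using ge_one_mat_hermitian[OF assms(1)] ge_one_mat_hermitian[OF assms(2)] by (auto simp: hermitian_mat_def)
  have "log_det A \<le> log_det B + frob n (mat_inv B) (A - B)" by (rule log_det_tangent[OF assms(2,1)])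
  also have "frob n (mat_inv B) (A - B) = frob n (B - A) (mat_inv A - mat_inv B) - frob n (mat_inv A) (B - A)"
    using c ge_one_mat_inv_carrier[OF assms(1)] ge_one_mat_inv_carrier[OF assms(2)]
    by (simp add: frob_diff_right frob_diff_left frob_commute[of n "mat_inv _"])
  finally show ?thesis using mat_inv_antimono(2)[OF assms] by linarith
qed

section \<open>Positive semidefinite matrices and covariances\<close>

lemma conj_entry_bound:
  assumes X: "X \<in> carrier_mat m m" and H: "H \<in> carrier_mat n m" and ab: "a < n" "b < n"
    and B: "\<And>a i. a < n \<Longrightarrow> i < m \<Longrightarrow> cmod (H $$ (a, i)) \<le> B"
    and c: "\<And>i j. i < m \<Longrightarrow> j < m \<Longrightarrow> cmod (X $$ (i, j)) \<le> c" and "0 \<le> c"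
  shows "cmod ((H * X * mat_adjoint H) $$ (a, b)) \<le> (real m)\<^sup>2 * (B\<^sup>2 * c)"
proof -
  have "cmod ((H * X * mat_adjoint H) $$ (a, b)) \<le> (\<Sum>i<m. \<Sum>j<m. B\<^sup>2 * c)"
    unfolding conj_entry[OF X H ab]
  proof (intro order_trans[OF norm_sum] sum_mono)
    fix i j assume ij: "i \<in> {..<m}" "j \<in> {..<m}"
    have 0: "0 \<le> B" using B[OF ab(1), of i] ij order_trans[OF norm_ge_zero] by blast
    have "cmod (H $$ (a, i)) * cmod (X $$ (i, j)) * cmod (H $$ (b, j)) \<le> B * c * B"
      using ij ab 0 \<open>0 \<le> c\<close> by (intro mult_mono B c) auto
    thus "cmod (H $$ (a, i) * X $$ (i, j) * cnj (H $$ (b, j))) \<le> B\<^sup>2 * c"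
      by (simp add: norm_mult power2_eq_square mult_ac)
  qed
  thus ?thesis by (simp add: power2_eq_square)
qed

lemma frob_self_bound:
  assumes "\<And>i j. i < n \<Longrightarrow> j < n \<Longrightarrow> cmod (A $$ (i, j)) \<le> c"
  shows "frob n A A \<le> (real n * c)\<^sup>2"
proof -
  have "frob n A A \<le> (\<Sum>i<n. \<Sum>j<n. c\<^sup>2)"
    unfolding frob_self using assms by (intro sum_mono power_mono) auto
  thus ?thesis by (simp add: power2_eq_square mult_ac)
qed

lemma frob_entry_bound:
  assumes "frob n A A \<le> c\<^sup>2" "0 \<le> c" "i < n" "j < n"
  shows "cmod (A $$ (i, j)) \<le> c"
  using order_trans[OF frob_entry_le[OF assms(3,4)] assms(1)] assms(2) by (rule power2_le_imp_le)

lemma quadratic_form_entry: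
  assumes A: "A \<in> carrier_mat n n" and v: "v \<in> carrier_vec n"
  shows "Re ((A *\<^sub>v v) \<bullet>c v) = (\<Sum>i<n. \<Sum>j<n. Re (A $$ (i, j) * cnj (v $ i * cnj (v $ j))))"
proof -
  have "(A *\<^sub>v v) \<bullet>c v = (\<Sum>i<n. (\<Sum>j<n. A $$ (i, j) * v $ j) * cnj (v $ i))"
    using A v by (auto simp: scalar_prod_def atLeast0LessThan)
  also have "\<dots> = (\<Sum>i<n. \<Sum>j<n. A $$ (i, j) * cnj (v $ i * cnj (v $ j)))"
    by (simp add: sum_distrib_right sum_distrib_left mult_ac)
  finally show ?thesis by simp
qed

text \<open>The quadratic form at \<open>v\<close>, seen as the pairing with the rank-one matrix of \<open>v\<close>.\<close>

lemma psd_frob_rank_one: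
  assumes "psd_mat n A" "\<And>i j. i < n \<Longrightarrow> j < n \<Longrightarrow> E $$ (i, j) = v i * cnj (v j)"
  shows "0 \<le> frob n A E"
proof -
  have "frob n A E = Re ((A *\<^sub>v vec n v) \<bullet>c vec n v)"
    using assms by (subst quadratic_form_entry[of _ n]) (auto simp: frob_def psd_mat_def hermitian_mat_def)
  thus ?thesis using assms(1) by (simp add: psd_mat_def)
qed

lemma spec_mat_projection_entry:
  assumes U: "U \<in> carrier_mat n n" and "l < n" "i < n" "j < n"
  shows "spec_mat n U (\<lambda>l'. if l' = l then 1 else 0) $$ (i, j) = U $$ (i, l) * cnj (U $$ (j, l))"
proof -
  have "spec_mat n U (\<lambda>l'. if l' = l then 1 else 0) $$ (i, j) = (\<Sum>l'<n. if l' = l then U $$ (i, l) * cnj (U $$ (j, l)) else 0)"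
    unfolding spec_mat_entry[OF U assms(3,4)] by (intro sum.cong) auto
  thus ?thesis using assms(2) by simp
qed

text \<open>An eigenvalue is read off by pairing with the projection to its eigenvector; this turns statements about pairings
into statements about eigenvalues.\<close>

lemma eigenvalue_as_frob:
  assumes U: "unitary_mat n U" and "l < n"
  shows "a l = frob n (spec_mat n U a) (spec_mat n U (\<lambda>l'. if l' = l then 1 else 0))"
  unfolding frob_spec_same[OF U] using assms(2) by (simp add: if_distrib cong: if_cong)

text \<open>In an eigenbasis the quadratic form is the sum of the eigenvalues times squared moduli of coordinates.\<close>

lemma psd_spec_iff:
  assumes U: "unitary_mat n U"
  shows "psd_mat n (spec_mat n U a) \<longleftrightarrow> (\<forall>l<n. 0 \<le> a l)"
proof
  note Uc = unitary_carrier[OF U]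
  show "\<forall>l<n. 0 \<le> a l" if "psd_mat n (spec_mat n U a)"
    using psd_frob_rank_one[OF that spec_mat_projection_entry[OF Uc]] eigenvalue_as_frob[OF U] by metis
  assume a: "\<forall>l<n. 0 \<le> a l"
  have "0 \<le> Re ((spec_mat n U a *\<^sub>v v) \<bullet>c v)" if v: "v \<in> carrier_vec n" for v
  proof -
    have "Re ((spec_mat n U a *\<^sub>v v) \<bullet>c v) =
        Re (\<Sum>i<n. \<Sum>j<n. (\<Sum>l<n. U $$ (i, l) * complex_of_real (a l) * cnj (U $$ (j, l))) * cnj (v $ i * cnj (v $ j)))"
      using v by (subst quadratic_form_entry[OF spec_mat_carrier[OF Uc]]) (simp_all add: spec_mat_entry[OF Uc])
    also have "(\<Sum>i<n. \<Sum>j<n. (\<Sum>l<n. U $$ (i, l) * complex_of_real (a l) * cnj (U $$ (j, l))) * cnj (v $ i * cnj (v $ j)))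
        = (\<Sum>l<n. complex_of_real (a l) * ((\<Sum>j<n. cnj (U $$ (j, l)) * v $ j) * cnj (\<Sum>i<n. cnj (U $$ (i, l)) * v $ i)))"
    proof -
      \<comment> \<open>The trivial fourth sum makes \<open>sum_swap4\<close> applicable.\<close>
      have "(\<Sum>i<n. \<Sum>j<n. (\<Sum>l<n. U $$ (i, l) * complex_of_real (a l) * cnj (U $$ (j, l))) * cnj (v $ i * cnj (v $ j)))
        = (\<Sum>i<n. \<Sum>j<n. \<Sum>l<n. \<Sum>_<1::nat. complex_of_real (a l) * (cnj (U $$ (j, l)) * v $ j * (U $$ (i, l) * cnj (v $ i))))"
        by (simp add: sum_distrib_right sum_distrib_left mult_ac)
      also have "\<dots> = (\<Sum>l<n. \<Sum>_<1::nat. \<Sum>i<n. \<Sum>j<n. complex_of_real (a l) * (cnj (U $$ (j, l)) * v $ j * (U $$ (i, l) * cnj (v $ i))))"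
        by (rule sum_swap4)
      also have "\<dots> = (\<Sum>l<n. complex_of_real (a l) * ((\<Sum>j<n. cnj (U $$ (j, l)) * v $ j) * cnj (\<Sum>i<n. cnj (U $$ (i, l)) * v $ i)))"
        by (intro sum.cong refl) (subst (2) mult.commute, simp add: sum_product sum_distrib_left mult_ac)
      finally show ?thesis .
    qed
    also have "Re \<dots> = (\<Sum>l<n. a l * (cmod (\<Sum>j<n. cnj (U $$ (j, l)) * v $ j))\<^sup>2)"
      unfolding complex_norm_square[symmetric] by (simp flip: of_real_mult of_real_power)
    also have "\<dots> \<ge> 0" using a by (intro sum_nonneg) auto
    finally show ?thesis .
  qed
  thus "psd_mat n (spec_mat n U a)" unfolding psd_mat_def using spec_mat_hermitian[OF Uc] by blast
qed

lemma psd_hermitian: "psd_mat n A \<Longrightarrow> hermitian_mat n A" by (simp add: psd_mat_def)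

lemma action_set_spec:
  assumes "X \<in> action_set n"
  obtains U x where "unitary_mat n U" "X = spec_mat n U x" "\<And>l. l < n \<Longrightarrow> 0 \<le> x l" "(\<Sum>l<n. x l) = 1"
proof -
  from assms have X: "psd_mat n X" "mat_trace X = 1" by (auto simp: action_set_def)
  obtain U x where U: "unitary_mat n U" "X = spec_mat n U x" using hermitian_spectral[OF psd_hermitian[OF X(1)]] .
  have "\<And>l. l < n \<Longrightarrow> 0 \<le> x l" using X(1) unfolding U(2) psd_spec_iff[OF U(1)] by blast
  moreover have "complex_of_real (\<Sum>l<n. x l) = 1" using X(2) spec_mat_trace[OF U(1), of x] by (simp add: U(2))
  hence "(\<Sum>l<n. x l) = 1" by (metis of_real_eq_1_iff)
  ultimately show ?thesis using that U by blast
qed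

lemma action_set_specI:
  assumes "unitary_mat n U" "\<And>l. l < n \<Longrightarrow> 0 \<le> x l" "(\<Sum>l<n. x l) = 1"
  shows "spec_mat n U x \<in> action_set n"
  using assms unfolding action_set_def by (simp add: psd_spec_iff spec_mat_trace)

lemma action_set_hermitian: "X \<in> action_set n \<Longrightarrow> hermitian_mat n X"
  by (simp add: action_set_def psd_mat_def)

lemma action_set_carrier: "X \<in> action_set n \<Longrightarrow> X \<in> carrier_mat n n"
  by (rule hermitian_carrier[OF action_set_hermitian])

lemma action_set_frob_le:
  assumes "X \<in> action_set n"
  shows "frob n X X \<le> 1"
proof -
  obtain U x where U: "unitary_mat n U" "X = spec_mat n U x" and x: "\<And>l. l < n \<Longrightarrow> 0 \<le> x l" "(\<Sum>l<n. x l) = 1"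
    using action_set_spec[OF assms] by metis
  have "x l \<le> 1" if "l < n" for l using member_le_sum[of l "{..<n}" x] x that by simp
  hence "(\<Sum>l<n. x l * x l) \<le> (\<Sum>l<n. x l)" using x by (intro sum_mono) (simp add: mult_left_le)
  thus ?thesis unfolding U(2) frob_spec_same[OF U(1)] x(2) .
qed

lemma gibbs_action_set:
  assumes "hermitian_mat n Y" "0 < n"
  shows "gibbs Y \<in> action_set n"
proof -
  obtain U y where U: "unitary_mat n U" "Y = spec_mat n U y" using hermitian_spectral[OF assms(1)] .
  have Z: "0 < (\<Sum>l<n. exp (y l))" using assms(2) by (auto intro!: sum_pos)
  show ?thesis unfolding U(2) spec_gibbs[OF U(1)]
    using Z by (intro action_set_specI[OF U(1)]) (auto simp: sum_divide_distrib[symmetric])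
qed

lemma action_set_convex:
  assumes X: "X \<in> action_set n" and Y: "Y \<in> action_set n" and t: "0 \<le> t" "t \<le> 1"
  shows "X + complex_of_real t \<cdot>\<^sub>m (Y - X) \<in> action_set n"
proof -
  let ?Z = "X + complex_of_real t \<cdot>\<^sub>m (Y - X)"
  note Xc = action_set_carrier[OF X] and Yc = action_set_carrier[OF Y]
  have Zc: "?Z \<in> carrier_mat n n" using Xc Yc by (auto intro!: add_carrier_mat minus_carrier_mat)
  have Ze: "?Z $$ (i, j) = complex_of_real (1 - t) * X $$ (i, j) + complex_of_real t * Y $$ (i, j)"
    if "i < n" "j < n" for i j using that Xc Yc by (simp add: algebra_simps)
  have herm: "hermitian_mat n ?Z" unfolding hermitian_entry
  proof (intro conjI Zc allI impI)
    fix i j assume ij: "i < n" "j < n"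
    have "X $$ (j, i) = cnj (X $$ (i, j))" "Y $$ (j, i) = cnj (Y $$ (i, j))"
      using action_set_hermitian[OF X] action_set_hermitian[OF Y] ij unfolding hermitian_entry by blast+
    thus "?Z $$ (j, i) = cnj (?Z $$ (i, j))" unfolding Ze[OF ij] Ze[OF ij(2,1)] by simp
  qed
  have "0 \<le> Re ((?Z *\<^sub>v v) \<bullet>c v)" if v: "v \<in> carrier_vec n" for v
  proof -
    have lin: "Re ((?Z *\<^sub>v v) \<bullet>c v) = (1 - t) * Re ((X *\<^sub>v v) \<bullet>c v) + t * Re ((Y *\<^sub>v v) \<bullet>c v)"
      unfolding quadratic_form_entry[OF Zc v] quadratic_form_entry[OF Xc v] quadratic_form_entry[OF Yc v]
        sum_distrib_left sum.distrib[symmetric]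
      by (intro sum.cong refl) (simp add: Ze algebra_simps del: index_add_mat)
    show ?thesis unfolding lin using X Y v t by (auto simp: action_set_def psd_mat_def)
  qed
  moreover have "mat_trace ?Z = 1"
  proof -
    have "mat_trace ?Z = complex_of_real (1 - t) * mat_trace X + complex_of_real t * mat_trace Y"
      unfolding mat_trace_def sum_distrib_left using Zc Xc Yc
      by (simp add: Ze sum.distrib sum_distrib_left del: index_add_mat)
    thus ?thesis using X Y by (simp add: action_set_def)
  qed
  ultimately show ?thesis using herm by (auto simp: action_set_def psd_mat_def)
qed

section \<open>The covariance of the received signal\<close>

lemma signal_cov_carrier: "signal_cov N P S X h \<in> carrier_mat N N"
  by (simp add: signal_cov_def)

lemma signal_cov_entry:
  assumes "i < N" "j < N"
  shows "signal_cov N P S X h $$ (i, j) = (if i = j then 1 else 0) +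
    (\<Sum>l\<in>S. complex_of_real (P l) * (h l * X l * mat_adjoint (h l)) $$ (i, j))"
  using assms by (simp add: signal_cov_def)

context
  fixes N :: nat and M :: "'u::finite \<Rightarrow> nat" and P :: "'u \<Rightarrow> real" and h :: "'u \<Rightarrow> complex mat"
  assumes h: "\<And>k. h k \<in> carrier_mat N (M k)"
begin

lemma signal_cov_hermitian:
  assumes "\<And>k. hermitian_mat (M k) (X k)"
  shows "hermitian_mat N (signal_cov N P S X h)"
proof -
  have "hermitian_mat N (h l * X l * mat_adjoint (h l))" for l
    using hermitian_conj[OF assms mat_adjoint_carrier[OF h], of l] by (simp add: mat_adjoint_adjoint[OF h])
  hence e: "(h l * X l * mat_adjoint (h l)) $$ (j, i) = cnj ((h l * X l * mat_adjoint (h l)) $$ (i, j))"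
    if "i < N" "j < N" for i j l using that unfolding hermitian_entry by blast
  show ?thesis unfolding hermitian_entry
  proof (intro conjI allI impI)
    fix i j assume ij: "i < N" "j < N"
    show "signal_cov N P S X h $$ (j, i) = cnj (signal_cov N P S X h $$ (i, j))"
      unfolding signal_cov_entry[OF ij] signal_cov_entry[OF ij(2,1)] e[OF ij] by simp
  qed (rule signal_cov_carrier)
qed

text \<open>\<open>signal_cov\<close> is affine in the profile, and its linear part is a sum of conjugations.\<close>

lemma frob_signal_cov_diff:
  assumes X: "\<And>k. X k \<in> carrier_mat (M k) (M k)" and Y: "\<And>k. Y k \<in> carrier_mat (M k) (M k)"
    and G: "G \<in> carrier_mat N N"
  shows "frob N (signal_cov N P S X h - signal_cov N P S Y h) G =
    (\<Sum>l\<in>S. P l * frob (M l) (X l - Y l) (mat_adjoint (h l) * G * h l))"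
proof -
  have re: "Re (complex_of_real c * z) = c * Re z" for c z by simp
  have XY: "X l - Y l \<in> carrier_mat (M l) (M l)" for l by (rule minus_carrier_mat[OF Y])
  have d: "(h l * (X l - Y l) * mat_adjoint (h l)) $$ (i, j) =
      (h l * X l * mat_adjoint (h l)) $$ (i, j) - (h l * Y l * mat_adjoint (h l)) $$ (i, j)" if "i < N" "j < N" for i j l
    unfolding conj_entry[OF XY h that] conj_entry[OF X h that] conj_entry[OF Y h that]
    using X[of l] Y[of l] by (simp add: algebra_simps flip: sum_subtractf)
  have "frob N (signal_cov N P S X h - signal_cov N P S Y h) G =
     (\<Sum>i<N. \<Sum>j<N. \<Sum>l\<in>S. P l * Re ((h l * (X l - Y l) * mat_adjoint (h l)) $$ (i, j) * cnj (G $$ (i, j))))"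
    unfolding frob_def
  proof (intro sum.cong refl)
    fix i j assume "i \<in> {..<N}" "j \<in> {..<N}"
    hence ij: "i < N" "j < N" by auto
    have "(signal_cov N P S X h - signal_cov N P S Y h) $$ (i, j) =
       (\<Sum>l\<in>S. complex_of_real (P l) * (h l * (X l - Y l) * mat_adjoint (h l)) $$ (i, j))"
      using ij signal_cov_carrier[of N P S X h] signal_cov_carrier[of N P S Y h]
      by (simp add: signal_cov_entry d algebra_simps sum_subtractf del: index_mult_mat)
    thus "Re ((signal_cov N P S X h - signal_cov N P S Y h) $$ (i, j) * cnj (G $$ (i, j))) =
       (\<Sum>l\<in>S. P l * Re ((h l * (X l - Y l) * mat_adjoint (h l)) $$ (i, j) * cnj (G $$ (i, j))))"
      by (simp only: sum_distrib_right Re_sum mult.assoc re)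
  qed
  also have "\<dots> = (\<Sum>l\<in>S. P l * frob N (h l * (X l - Y l) * mat_adjoint (h l)) G)"
    unfolding frob_def sum_distrib_left
    by (rule trans[OF sum.cong[OF refl sum.swap] sum.swap])
  also have "\<dots> = (\<Sum>l\<in>S. P l * frob (M l) (X l - Y l) (mat_adjoint (h l) * G * h l))"
    by (simp add: frob_conj[OF XY G h])
  finally show ?thesis .
qed

text \<open>The excess of an eigenvalue over 1 is the pairing of a sum of conjugated covariances with a projection; moving
the conjugation to the projection gives a rank-one matrix, which pairs nonnegatively with a covariance.\<close>

lemma signal_cov_ge_one:
  assumes X: "\<And>k. psd_mat (M k) (X k)" and P: "\<And>k. 0 \<le> P k"
  shows "ge_one_mat N (signal_cov N P S X h)"
proof -
  have Xc: "X k \<in> carrier_mat (M k) (M k)" for k using X by (simp add: psd_mat_def hermitian_mat_def)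
  let ?W = "signal_cov N P S X h"
  obtain U a where U: "unitary_mat N U" and W: "?W = spec_mat N U a"
    using hermitian_spectral[OF signal_cov_hermitian[OF psd_hermitian[OF X]], of S] .
  note Uc = unitary_carrier[OF U]
  define Z :: "'u \<Rightarrow> complex mat" where "Z l = 0\<^sub>m (M l) (M l)" for l
  have Zc: "Z k \<in> carrier_mat (M k) (M k)" for k by (simp add: Z_def)
  have "1 \<le> a l" if l: "l < N" for l
  proof -
    let ?E = "spec_mat N U (\<lambda>l'. if l' = l then 1 else 0)"
    have Ec: "?E \<in> carrier_mat N N" by (rule spec_mat_carrier[OF Uc])
    note E = spec_mat_projection_entry[OF Uc l]
    have I: "signal_cov N P S Z h = 1\<^sub>m N"
    proof (rule eq_matI)
      fix i j assume "i < dim_row (1\<^sub>m N :: complex mat)" "j < dim_col (1\<^sub>m N :: complex mat)"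
      hence ij: "i < N" "j < N" by auto
      have "(h k * Z k * mat_adjoint (h k)) $$ (i, j) = 0" for k
        unfolding conj_entry[OF Zc h ij] by (simp add: Z_def)
      thus "signal_cov N P S Z h $$ (i, j) = 1\<^sub>m N $$ (i, j)" using ij by (simp add: signal_cov_entry del: index_mult_mat)
    qed (use signal_cov_carrier[of N P S Z h] in auto)
    have "0 \<le> (\<Sum>k\<in>S. P k * frob (M k) (X k - Z k) (mat_adjoint (h k) * ?E * h k))"
    proof (intro sum_nonneg mult_nonneg_nonneg P)
      fix k
      \<comment> \<open>The eigenvector, pulled back to the antennas of user \<open>k\<close>.\<close>
      define v where "v i = (\<Sum>a<N. cnj (h k $$ (a, i)) * U $$ (a, l))" for i
      have XZ: "X k - Z k = X k" using Xc[of k] by (intro eq_matI) (auto simp: Z_def)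
      show "0 \<le> frob (M k) (X k - Z k) (mat_adjoint (h k) * ?E * h k)" unfolding XZ
      proof (rule psd_frob_rank_one[OF X])
        fix i j assume ij: "i < M k" "j < M k"
        have "(mat_adjoint (h k) * ?E * h k) $$ (i, j) =
          (\<Sum>a<N. \<Sum>b<N. mat_adjoint (h k) $$ (i, a) * ?E $$ (a, b) * cnj (mat_adjoint (h k) $$ (j, b)))"
          using conj_entry[OF Ec mat_adjoint_carrier[OF h] ij] unfolding mat_adjoint_adjoint[OF h] .
        also have "\<dots> = (\<Sum>a<N. \<Sum>b<N. (cnj (h k $$ (a, i)) * U $$ (a, l)) * (h k $$ (b, j) * cnj (U $$ (b, l))))"
          using ij by (intro sum.cong refl) (simp add: mat_adjoint_entry[OF h] E)
        also have "\<dots> = v i * cnj (v j)" unfolding v_def by (simp add: sum_product)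
        finally show "(mat_adjoint (h k) * ?E * h k) $$ (i, j) = v i * cnj (v j)" .
      qed
    qed
    also have "\<dots> = frob N ?W ?E - frob N (1\<^sub>m N) ?E"
      unfolding frob_signal_cov_diff[OF Xc Zc Ec, symmetric] I
      by (rule frob_diff_left[OF signal_cov_carrier one_carrier_mat])
    also have "frob N ?W ?E = a l" unfolding W by (rule eigenvalue_as_frob[OF U l, symmetric])
    also have "frob N (1\<^sub>m N) ?E = 1" unfolding spec_mat_one[OF U, symmetric]
      by (rule eigenvalue_as_frob[OF U l, symmetric])
    finally show ?thesis by simp
  qed
  thus ?thesis unfolding ge_one_mat_def using U W by blast
qed

lemma grad_inst_hermitian:
  assumes "\<And>k. psd_mat (M k) (X k)" "\<And>k. 0 \<le> P k"
  shows "hermitian_mat (M k) (grad_inst N P k X h)"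
proof -
  have "ge_one_mat N (W_mat N P X h)" by (rule signal_cov_ge_one[OF assms])
  hence "hermitian_mat N (mat_inv (W_mat N P X h))" by (rule ge_one_mat_inv_hermitian)
  thus ?thesis unfolding grad_inst_def by (rule hermitian_conj[OF _ h])
qed

text \<open>The inverse of a matrix that dominates the identity has Frobenius norm at most \<open>sqrt N\<close>, so only the channel
matrices contribute to the bound.\<close>

lemma grad_inst_entry_bound:
  assumes X: "\<And>k. psd_mat (M k) (X k)" and P: "\<And>k. 0 \<le> P k"
    and B: "\<And>k i j. i < N \<Longrightarrow> j < M k \<Longrightarrow> cmod (h k $$ (i, j)) \<le> B"
    and ij: "i < M k" "j < M k"
  shows "cmod (grad_inst N P k X h $$ (i, j)) \<le> (real N)\<^sup>2 * (B\<^sup>2 * sqrt (real N))"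
proof -
  let ?G = "mat_inv (W_mat N P X h)"
  note g = signal_cov_ge_one[OF X P, of UNIV]
  note Gc = ge_one_mat_inv_carrier[OF g]
  have "cmod ((mat_adjoint (h k) * ?G * mat_adjoint (mat_adjoint (h k))) $$ (i, j)) \<le> (real N)\<^sup>2 * (B\<^sup>2 * sqrt (real N))"
  proof (rule conj_entry_bound[OF Gc mat_adjoint_carrier[OF h] ij])
    show "cmod (mat_adjoint (h k) $$ (a, i)) \<le> B" if "a < M k" "i < N" for a i
      using B[OF that(2,1)] by (simp add: mat_adjoint_entry[OF h that])
    show "cmod (?G $$ (i, j)) \<le> sqrt (real N)" if "i < N" "j < N" for i j
      by (rule frob_entry_bound[OF _ _ that]) (use ge_one_mat_inv_bound[OF g] in auto)
  qed simp
  thus ?thesis unfolding grad_inst_def mat_adjoint_adjoint[OF h] .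
qed

lemma log_det_W_tangent:
  assumes X: "\<And>k. psd_mat (M k) (X k)" and Y: "\<And>k. psd_mat (M k) (Y k)" and P: "\<And>k. 0 \<le> P k"
  shows "log_det (W_mat N P Y h) \<le> log_det (W_mat N P X h) +
    (\<Sum>k\<in>UNIV. P k * frob (M k) (Y k - X k) (grad_inst N P k X h))"
proof -
  note gX = signal_cov_ge_one[OF X P, of UNIV] and gY = signal_cov_ge_one[OF Y P, of UNIV]
  show ?thesis
    using log_det_tangent[OF gX gY]
    unfolding frob_commute[of N "mat_inv _"]
      frob_signal_cov_diff[OF hermitian_carrier[OF psd_hermitian[OF Y]] hermitian_carrier[OF psd_hermitian[OF X]] ge_one_mat_inv_carrier[OF gX]]
      grad_inst_def .
qed

lemma log_det_W_lower:
  assumes X: "\<And>k. psd_mat (M k) (X k)" and Y: "\<And>k. psd_mat (M k) (Y k)" and P: "\<And>k. 0 \<le> P k"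
  shows "log_det (W_mat N P X h) + (\<Sum>k\<in>UNIV. P k * frob (M k) (Y k - X k) (grad_inst N P k X h))
     - frob N (W_mat N P Y h - W_mat N P X h) (W_mat N P Y h - W_mat N P X h) \<le> log_det (W_mat N P Y h)"
proof -
  note gX = signal_cov_ge_one[OF X P, of UNIV] and gY = signal_cov_ge_one[OF Y P, of UNIV]
  show ?thesis
    using log_det_quadratic_lower[OF gX gY]
    unfolding frob_commute[of N "mat_inv _"]
      frob_signal_cov_diff[OF hermitian_carrier[OF psd_hermitian[OF Y]] hermitian_carrier[OF psd_hermitian[OF X]] ge_one_mat_inv_carrier[OF gX]]
      grad_inst_def .
qed

lemma grad_inst_monotone:
  assumes X: "\<And>k. psd_mat (M k) (X k)" and Y: "\<And>k. psd_mat (M k) (Y k)" and P: "\<And>k. 0 \<le> P k"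
  shows "(\<Sum>k\<in>UNIV. P k * (frob (M k) (Y k - X k) (grad_inst N P k Y h) - frob (M k) (Y k - X k) (grad_inst N P k X h))) \<le> 0"
proof -
  note gX = signal_cov_ge_one[OF X P, of UNIV] and gY = signal_cov_ge_one[OF Y P, of UNIV]
  have "frob N (W_mat N P Y h - W_mat N P X h) (mat_inv (W_mat N P Y h)) -
     frob N (W_mat N P Y h - W_mat N P X h) (mat_inv (W_mat N P X h)) \<le> 0"
    using mat_inv_antimono(1)[OF gX gY] ge_one_mat_inv_carrier[OF gX] ge_one_mat_inv_carrier[OF gY]
    by (simp add: frob_diff_right)
  thus ?thesis
    unfolding grad_inst_def 
      frob_signal_cov_diff[OF hermitian_carrier[OF psd_hermitian[OF Y]] hermitian_carrier[OF psd_hermitian[OF X]] ge_one_mat_inv_carrier[OF gX]]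
      frob_signal_cov_diff[OF hermitian_carrier[OF psd_hermitian[OF Y]] hermitian_carrier[OF psd_hermitian[OF X]] ge_one_mat_inv_carrier[OF gY]]
    by (simp add: right_diff_distrib sum_subtractf)
qed

lemma W_diff_frob_bound:
  assumes X: "\<And>k. X k \<in> carrier_mat (M k) (M k)" and Y: "\<And>k. Y k \<in> carrier_mat (M k) (M k)"
    and P: "\<And>k. 0 \<le> P k"
    and B: "\<And>k i j. i < N \<Longrightarrow> j < M k \<Longrightarrow> cmod (h k $$ (i, j)) \<le> B"
    and c: "\<And>k i j. i < M k \<Longrightarrow> j < M k \<Longrightarrow> cmod (Y k $$ (i, j) - X k $$ (i, j)) \<le> c" "0 \<le> c"
  shows "frob N (W_mat N P Y h - W_mat N P X h) (W_mat N P Y h - W_mat N P X h)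
    \<le> (real N * (\<Sum>k\<in>UNIV. P k * ((real (M k))\<^sup>2 * (B\<^sup>2 * c))))\<^sup>2"
proof (rule frob_self_bound)
  fix i j assume ij: "i < N" "j < N"
  have YX: "Y k - X k \<in> carrier_mat (M k) (M k)" for k by (rule minus_carrier_mat[OF X])
  have d: "(h l * (Y l - X l) * mat_adjoint (h l)) $$ (i, j) =
      (h l * Y l * mat_adjoint (h l)) $$ (i, j) - (h l * X l * mat_adjoint (h l)) $$ (i, j)" for l
    unfolding conj_entry[OF YX h ij] conj_entry[OF X h ij] conj_entry[OF Y h ij]
    using X[of l] Y[of l] by (simp add: algebra_simps flip: sum_subtractf)
  have "(W_mat N P Y h - W_mat N P X h) $$ (i, j) =
     (\<Sum>k\<in>UNIV. complex_of_real (P k) * (h k * (Y k - X k) * mat_adjoint (h k)) $$ (i, j))"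
    using ij signal_cov_carrier[of N P UNIV X h] signal_cov_carrier[of N P UNIV Y h]
    by (simp add: signal_cov_entry d algebra_simps sum_subtractf del: index_mult_mat)
  also have "cmod \<dots> \<le> (\<Sum>k\<in>UNIV. P k * ((real (M k))\<^sup>2 * (B\<^sup>2 * c)))"
  proof (intro order_trans[OF norm_sum] sum_mono)
    fix k :: 'u
    have "cmod ((h k * (Y k - X k) * mat_adjoint (h k)) $$ (i, j)) \<le> (real (M k))\<^sup>2 * (B\<^sup>2 * c)"
      by (rule conj_entry_bound[OF YX h ij B _ c(2)]) (use X[of k] Y[of k] c(1) in auto)
    thus "cmod (complex_of_real (P k) * (h k * (Y k - X k) * mat_adjoint (h k)) $$ (i, j)) \<le> P k * ((real (M k))\<^sup>2 * (B\<^sup>2 * c))"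
      using P[of k] by (simp add: norm_mult mult_left_mono del: index_mult_mat)
  qed
  finally show "cmod ((W_mat N P Y h - W_mat N P X h) $$ (i, j)) \<le> (\<Sum>k\<in>UNIV. P k * ((real (M k))\<^sup>2 * (B\<^sup>2 * c)))" .
qed

end

section \<open>Stochastic approximation with a contracting drift\<close>

text \<open>As soon as \<open>\<tau> \<gamma>\<^sub>n < 1\<close> the recursion forms convex combinations of \<open>r n\<close> and \<open>G / \<tau>\<close>; only finitely many steps come
before.\<close>

lemma stepsize_recursion_bounded:
  fixes \<gamma> r :: "nat \<Rightarrow> real"
  assumes \<tau>: "0 < \<tau>" and \<gamma>: "\<And>n. 0 < \<gamma> n" "\<gamma> \<longlonglongrightarrow> 0" and G: "0 \<le> G"
    and r: "\<And>n. r (Suc n) = \<bar>1 - \<tau> * \<gamma> n\<bar> * r n + \<gamma> n * G"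
  obtains R where "0 \<le> R" "\<And>n. r n \<le> R"
proof -
  have "eventually (\<lambda>n. \<gamma> n < 1 / \<tau>) sequentially"
    using \<gamma>(2) \<tau> by (intro order_tendstoD) auto
  then obtain n0 where n0: "\<And>n. n \<ge> n0 \<Longrightarrow> \<gamma> n < 1 / \<tau>" by (auto simp: eventually_sequentially)
  define R where "R = Max (insert (G / \<tau>) (insert 0 (r ` {..n0})))"
  have R: "G / \<tau> \<le> R" "0 \<le> R" "\<And>n. n \<le> n0 \<Longrightarrow> r n \<le> R" unfolding R_def by (auto intro!: Max_ge simp del: Max_insert)
  have "r n \<le> R" for n
  proof (induction n)
    case 0 show ?case using R(3)[of 0] by simp
  next
    case (Suc n)
    show ?case
    proof (cases "Suc n \<le> n0")
      case True thus ?thesis by (rule R(3))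
    next
      case False
      hence "\<gamma> n < 1 / \<tau>" using n0[of n] by simp
      hence t1: "\<tau> * \<gamma> n < 1" using \<tau> by (simp add: field_simps)
      have "r (Suc n) = (1 - \<tau> * \<gamma> n) * r n + \<gamma> n * G" unfolding r using t1 by simp
      also have "\<dots> \<le> (1 - \<tau> * \<gamma> n) * R + \<gamma> n * (\<tau> * R)"
        using Suc t1 \<gamma>(1)[of n] R(1) \<tau> by (intro add_mono mult_left_mono) (auto simp: field_simps)
      finally show ?thesis by (simp add: algebra_simps)
    qed
  qed
  thus ?thesis using R(2) that by blast
qed

text \<open>The tail sums absorb the second-order remainders of all later steps.\<close>

lemma square_tail:
  fixes \<gamma> :: "nat \<Rightarrow> real"
  assumes sq: "summable (\<lambda>n. (\<gamma> n)\<^sup>2)" and C: "0 \<le> C"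
  obtains t where "\<And>n. 0 \<le> t n" "\<And>n. t n = t (Suc n) + C * (\<gamma> n)\<^sup>2" "t \<longlonglongrightarrow> 0"
proof -
  have s: "summable (\<lambda>m. (\<gamma> (m + n))\<^sup>2)" for n using sq summable_iff_shift[of "\<lambda>n. (\<gamma> n)\<^sup>2"] by blast
  show ?thesis
  proof (rule that[of "\<lambda>n. C * (\<Sum>m. (\<gamma> (m + n))\<^sup>2)"])
    show "0 \<le> C * (\<Sum>m. (\<gamma> (m + n))\<^sup>2)" for n
      using C s by (intro mult_nonneg_nonneg suminf_nonneg) auto
    show "C * (\<Sum>m. (\<gamma> (m + n))\<^sup>2) = C * (\<Sum>m. (\<gamma> (m + Suc n))\<^sup>2) + C * (\<gamma> n)\<^sup>2" for n
    proof -
      have "(\<Sum>m. (\<gamma> (m + n))\<^sup>2) = (\<Sum>m. (\<gamma> (m + Suc n))\<^sup>2) + (\<gamma> n)\<^sup>2"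
        using suminf_split_head[OF s[of n]] by simp
      thus ?thesis by (simp only: distrib_left)
    qed
    show "(\<lambda>n. C * (\<Sum>m. (\<gamma> (m + n))\<^sup>2)) \<longlonglongrightarrow> 0"
      using tendsto_mult[OF tendsto_const suminf_exist_split2[OF sq], of C] by simp
  qed
qed

text \<open>Adding the tail of the remainders makes \<open>e\<close> decreasing, hence convergent, and summing the decrements shows that
\<open>\<gamma>\<^sub>n e\<^sub>n\<close> is summable. As \<open>\<gamma>\<^sub>n\<close> is not, the limit cannot be positive.\<close>

lemma stepsize_recursion_tendsto_0:
  fixes \<gamma> e :: "nat \<Rightarrow> real"
  assumes \<tau>: "0 < \<tau>" and \<gamma>: "\<And>n. 0 < \<gamma> n" and sq: "summable (\<lambda>n. (\<gamma> n)\<^sup>2)" and div: "\<not> summable \<gamma>"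
    and C: "0 \<le> C" and e0: "\<And>n. 0 \<le> e n"
    and e: "\<And>n. e (Suc n) \<le> (1 - \<tau> * \<gamma> n) * e n + C * (\<gamma> n)\<^sup>2"
  shows "e \<longlonglongrightarrow> 0"
proof -
  obtain t where t0: "\<And>n. 0 \<le> t n" and tS: "\<And>n. t n = t (Suc n) + C * (\<gamma> n)\<^sup>2" and tlim: "t \<longlonglongrightarrow> 0"
    using square_tail[OF sq C] by metis
  define v where "v n = e n + t n" for n
  have vS: "v (Suc n) \<le> v n - \<tau> * (\<gamma> n * e n)" for n using e[of n] tS[of n] by (simp add: v_def algebra_simps)
  have "decseq v" by (rule decseq_SucI) (use vS \<tau> \<gamma> e0 in \<open>smt (verit) mult_nonneg_nonneg\<close>)
  moreover have v0: "0 \<le> v n" for n using e0 t0 by (simp add: v_def)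
  ultimately obtain l where l: "v \<longlonglongrightarrow> l" by (metis decseq_convergent)
  have "e \<longlonglongrightarrow> l - 0" using tendsto_diff[OF l tlim] by (simp add: v_def)
  hence el: "e \<longlonglongrightarrow> l" by simp
  have l0: "0 \<le> l" using el e0 by (intro LIMSEQ_le_const) auto
  have "l = 0"
  proof (rule ccontr)
    assume "l \<noteq> 0"
    with l0 have "0 < l" by simp
    hence "eventually (\<lambda>n. l / 2 < e n) sequentially" using el by (intro order_tendstoD) auto
    then obtain n0 where n0: "\<And>n. n \<ge> n0 \<Longrightarrow> l / 2 < e n" by (auto simp: eventually_sequentially)
    have part: "\<tau> * (\<Sum>m<n. \<gamma> m * e m) \<le> v 0 - v n" for n
    proof (induction n)
      case (Suc n)
      have "\<tau> * (\<Sum>m<Suc n. \<gamma> m * e m) = \<tau> * (\<Sum>m<n. \<gamma> m * e m) + \<tau> * (\<gamma> n * e n)"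
        by (simp add: distrib_left)
      thus ?case using Suc vS[of n] by linarith
    qed simp
    have "summable (\<lambda>n. \<gamma> n * e n)"
    proof (rule bounded_imp_summable[where B = "v 0 / \<tau>"])
      show "0 \<le> \<gamma> n * e n" for n using \<gamma>[of n] e0[of n] by simp
      show "(\<Sum>m\<le>n. \<gamma> m * e m) \<le> v 0 / \<tau>" for n
        using part[of "Suc n"] v0[of "Suc n"] \<tau> by (simp add: field_simps lessThan_Suc_atMost)
    qed
    hence "summable (\<lambda>n. 2 / l * (\<gamma> n * e n))" by (rule summable_mult)
    moreover have "norm (\<gamma> n) \<le> 2 / l * (\<gamma> n * e n)" if "n \<ge> n0" for n
    proof -
      have "\<gamma> n * (l / 2) \<le> \<gamma> n * e n" using n0[OF that] \<gamma>[of n] by (intro mult_left_mono) auto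
      thus ?thesis using \<open>0 < l\<close> \<gamma>[of n] by (simp add: field_simps)
    qed
    ultimately have "summable \<gamma>" by (rule summable_comparison_test'[where N = n0])
    with div show False by simp
  qed
  with el show ?thesis by simp
qed

context prob_space
begin

text \<open>Ville's inequality. Stop when level \<open>a\<close> is first reached: what has been stopped carries mass at least \<open>a\<close> times its
probability, and on the remaining event \<open>B n\<close>, which is known at time \<open>n\<close>, the integral does not increase.\<close>

lemma supermartingale_maximal:
  fixes V :: "nat \<Rightarrow> 'a \<Rightarrow> real"
  assumes sub: "\<And>n. subalgebra M (F n)" and meas: "\<And>m n. m \<le> n \<Longrightarrow> V m \<in> borel_measurable (F n)"
    and int: "\<And>n. integrable M (V n)" and pos: "\<And>n. AE x in M. 0 \<le> V n x"
    and super: "\<And>n A. A \<in> sets (F n) \<Longrightarrow> (\<integral>x\<in>A. V (Suc n) x \<partial>M) \<le> (\<integral>x\<in>A. V n x \<partial>M)"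
    and a: "0 < a"
  shows "prob {x \<in> space M. \<exists>n\<ge>k. a \<le> V n x} \<le> expectation (V k) / a"
proof -
  have mM: "V n \<in> borel_measurable M" for n using int by auto
  have sp: "space (F n) = space M" for n using sub[of n] by (simp add: subalgebra_def)
  define B where "B n = {x \<in> space M. \<forall>j\<in>{k..n}. V j x < a}" for n
  define A where "A n = {x \<in> space M. \<exists>j\<in>{k..n}. a \<le> V j x}" for n
  have BF: "B n \<in> sets (F n)" for n
  proof -
    have "{x \<in> space (F n). \<forall>j\<in>{k..n}. V j x < a} \<in> sets (F n)"
      by (intro sets.sets_Collect_finite_All finite_atLeastAtMost) (use meas in auto)
    thus ?thesis by (simp add: B_def sp)
  qed
  have BM: "B n \<in> events" for n using BF[of n] sub[of n] by (auto simp: subalgebra_def)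
  have AB: "A n = space M - B n" for n by (auto simp: A_def B_def not_less)
  have AM: "A n \<in> events" for n using BM by (auto simp: AB)
  have int_on: "integrable M (\<lambda>x. indicator S x * V n x)" if "S \<in> events" for S n
    using integrable_mult_indicator[OF that int[of n]] by simp
  have set_e: "(\<integral>x\<in>S. V n x \<partial>M) = (\<integral>x. indicator S x * V n x \<partial>M)" for S n
    by (simp add: set_lebesgue_integral_def)
  have main: "a * prob (A n) + (\<integral>x\<in>B n. V n x \<partial>M) \<le> expectation (V k)" if "k \<le> n" for n using that
  proof (induction n rule: dec_induct)
    case base
    have "a * prob (A k) + (\<integral>x\<in>B k. V k x \<partial>M) = (\<integral>x. a * indicator (A k) x + indicator (B k) x * V k x \<partial>M)"
      unfolding set_e using AM[of k] int_on[OF BM] by (subst Bochner_Integration.integral_add) (auto simp: emeasure_eq_measure)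
    also have "\<dots> \<le> (\<integral>x. V k x \<partial>M)"
    proof (rule integral_mono_AE)
      show "integrable M (\<lambda>x. a * indicator (A k) x + indicator (B k) x * V k x)"
        using AM[of k] int_on[OF BM] by (intro Bochner_Integration.integrable_add) (auto simp: emeasure_eq_measure)
      show "AE x in M. a * indicator (A k) x + indicator (B k) x * V k x \<le> V k x"
        by (rule AE_I2) (auto simp: A_def B_def indicator_def)
    qed (rule int)
    finally show ?case .
  next
    case (step n)
    \<comment> \<open>The event that the level is first reached in this step.\<close>
    define D where "D = B n - B (Suc n)"
    have D: "D \<in> events" using BM by (auto simp: D_def)
    have An: "prob (A (Suc n)) = prob (A n) + prob D"
    proof -
      have "A (Suc n) = A n \<union> D" "A n \<inter> D = {}" using step(1) unfolding AB D_def
        by (auto simp: B_def atLeastAtMostSuc_conv)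
      thus ?thesis using finite_measure_Union[OF AM D] by simp
    qed
    have DV: "a \<le> V (Suc n) x" if x: "x \<in> D" for x
    proof -
      obtain j where "j \<in> {k..Suc n}" "a \<le> V j x" "\<forall>j\<in>{k..n}. V j x < a"
        using x by (auto simp: D_def B_def not_less)
      thus ?thesis by (cases "j = Suc n") (auto simp: le_Suc_eq not_le[symmetric])
    qed
    have "a * prob D + (\<integral>x\<in>B (Suc n). V (Suc n) x \<partial>M) =
        (\<integral>x. a * indicator D x + indicator (B (Suc n)) x * V (Suc n) x \<partial>M)"
      unfolding set_e using D int_on[OF BM] by (subst Bochner_Integration.integral_add) (auto simp: emeasure_eq_measure)
    also have "\<dots> \<le> (\<integral>x\<in>B n. V (Suc n) x \<partial>M)" unfolding set_e
    proof (rule integral_mono_AE)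
      show "integrable M (\<lambda>x. a * indicator D x + indicator (B (Suc n)) x * V (Suc n) x)"
        using D int_on[OF BM] by (intro Bochner_Integration.integrable_add) (auto simp: emeasure_eq_measure)
      have "B (Suc n) \<subseteq> B n" by (auto simp: B_def)
      thus "AE x in M. a * indicator D x + indicator (B (Suc n)) x * V (Suc n) x \<le> indicator (B n) x * V (Suc n) x"
        by (intro AE_I2) (use DV in \<open>auto simp: D_def indicator_def\<close>)
    qed (rule int_on[OF BM])
    also have "\<dots> \<le> (\<integral>x\<in>B n. V n x \<partial>M)" by (rule super[OF BF])
    finally show ?case using step.IH An by (simp add: algebra_simps)
  qed
  have le: "prob (A n) \<le> expectation (V k) / a" for n
  proof -
    have "A n \<subseteq> A (max k n)" by (auto simp: A_def)
    hence "prob (A n) \<le> prob (A (max k n))" by (intro finite_measure_mono AM)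
    moreover have "0 \<le> (\<integral>x\<in>B (max k n). V (max k n) x \<partial>M)"
      unfolding set_e by (rule integral_nonneg_AE[OF eventually_mono[OF pos[of "max k n"]]]) simp
    hence "a * prob (A (max k n)) \<le> expectation (V k)" using main[of "max k n"] by simp
    hence "prob (A (max k n)) \<le> expectation (V k) / a" using a by (simp add: field_simps)
    ultimately show ?thesis by linarith
  qed
  have "incseq A" by (rule incseq_SucI) (auto simp: A_def)
  hence "(\<lambda>n. prob (A n)) \<longlonglongrightarrow> prob (\<Union>n. A n)" using AM by (intro finite_Lim_measure_incseq) auto
  hence "prob (\<Union>n. A n) \<le> expectation (V k) / a" by (rule LIMSEQ_le_const2) (use le in auto)
  also have "(\<Union>n. A n) = {x \<in> space M. \<exists>n\<ge>k. a \<le> V n x}"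
    unfolding A_def by auto (metis atLeastAtMost_iff order_refl)
  finally show ?thesis .
qed

text \<open>The integrated recursion gives \<open>E U\<^sub>n \<longlonglongrightarrow> 0\<close>. Adding the tail of the remainders turns \<open>U\<close> into a nonnegative
supermartingale \<open>V\<close> whose expectation still tends to 0, so by the maximal inequality the probability that \<open>V\<close>
exceeds a level after time \<open>k\<close> tends to 0 as \<open>k\<close> grows.\<close>

theorem almost_supermartingale_contraction:
  fixes U :: "nat \<Rightarrow> 'a \<Rightarrow> real"
  assumes sub: "\<And>n. subalgebra M (F n)" and meas: "\<And>m n. m \<le> n \<Longrightarrow> U m \<in> borel_measurable (F n)"
    and int: "\<And>n. integrable M (U n)" and pos: "\<And>n. AE x in M. 0 \<le> U n x"
    and \<tau>: "0 < \<tau>" and \<gamma>: "\<And>n. 0 < \<gamma> n" and sq: "summable (\<lambda>n. (\<gamma> n)\<^sup>2)" and div: "\<not> summable \<gamma>" and C: "0 \<le> C"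
    and step: "\<And>n A. A \<in> sets (F n) \<Longrightarrow>
      (\<integral>x\<in>A. U (Suc n) x \<partial>M) \<le> (1 - \<tau> * \<gamma> n) * (\<integral>x\<in>A. U n x \<partial>M) + C * (\<gamma> n)\<^sup>2 * prob A"
  shows "AE x in M. (\<lambda>n. U n x) \<longlonglongrightarrow> 0"
proof -
  have sp: "space (F n) = space M" for n using sub[of n] by (simp add: subalgebra_def)
  have FM: "A \<in> sets (F n) \<Longrightarrow> A \<in> events" for A n using sub[of n] by (auto simp: subalgebra_def)
  define e where "e n = expectation (U n)" for n
  have full: "(\<integral>x\<in>space M. f x \<partial>M) = expectation f" for f :: "'a \<Rightarrow> real"
    unfolding set_lebesgue_integral_def by (intro Bochner_Integration.integral_cong) auto
  have "e \<longlonglongrightarrow> 0"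
  proof (rule stepsize_recursion_tendsto_0[OF \<tau> \<gamma> sq div C])
    show "0 \<le> e n" for n unfolding e_def by (rule integral_nonneg_AE[OF pos])
    show "e (Suc n) \<le> (1 - \<tau> * \<gamma> n) * e n + C * (\<gamma> n)\<^sup>2" for n
      using step[of "space M" n] sets.top[of "F n"] unfolding sp full e_def by (simp add: prob_space)
  qed
  obtain t where t0: "\<And>n. 0 \<le> t n" and tS: "\<And>n. t n = t (Suc n) + C * (\<gamma> n)\<^sup>2" and tlim: "t \<longlonglongrightarrow> 0"
    using square_tail[OF sq C] by metis
  define V where "V n x = U n x + t n" for n x
  have setV: "(\<integral>x\<in>A. V n x \<partial>M) = (\<integral>x\<in>A. U n x \<partial>M) + t n * prob A" if "A \<in> events" for A n
  proof -
    have "(\<integral>x\<in>A. V n x \<partial>M) = (\<integral>x. indicator A x * U n x + t n * indicator A x \<partial>M)"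
      unfolding set_lebesgue_integral_def V_def by (intro Bochner_Integration.integral_cong) (auto simp: algebra_simps)
    also have "\<dots> = (\<integral>x\<in>A. U n x \<partial>M) + t n * prob A"
      unfolding set_lebesgue_integral_def using that integrable_mult_indicator[OF that int[of n]]
      by (subst Bochner_Integration.integral_add) (auto simp: emeasure_eq_measure)
    finally show ?thesis .
  qed
  have max: "prob {x \<in> space M. \<exists>n\<ge>k. a \<le> V n x} \<le> expectation (V k) / a" if "0 < a" for a k
  proof (rule supermartingale_maximal[OF sub _ _ _ _ that])
    show "V m \<in> borel_measurable (F n)" if "m \<le> n" for m n unfolding V_def using meas[OF that] by auto
    show "integrable M (V n)" for n unfolding V_def using int by auto
    show "AE x in M. 0 \<le> V n x" for n using pos[of n] by (auto elim!: eventually_mono simp: V_def t0)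
    fix n A assume A: "A \<in> sets (F n)"
    have "0 \<le> (\<integral>x\<in>A. U n x \<partial>M)" unfolding set_lebesgue_integral_def
      by (rule integral_nonneg_AE[OF eventually_mono[OF pos[of n]]]) simp
    hence "0 \<le> \<tau> * \<gamma> n * (\<integral>x\<in>A. U n x \<partial>M)" using \<tau> \<gamma>[of n] by simp
    thus "(\<integral>x\<in>A. V (Suc n) x \<partial>M) \<le> (\<integral>x\<in>A. V n x \<partial>M)"
      unfolding setV[OF FM[OF A]] using step[OF A] tS[of n] by (simp add: algebra_simps)
  qed
  have Vlim: "(\<lambda>k. expectation (V k)) \<longlonglongrightarrow> 0"
  proof -
    have "expectation (V k) = e k + t k" for k
      using setV[OF sets.top, of k] unfolding full e_def by (simp add: prob_space)
    thus ?thesis using tendsto_add[OF \<open>e \<longlonglongrightarrow> 0\<close> tlim] by simp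
  qed
  have small: "AE x in M. \<exists>k. \<forall>n\<ge>k. V n x < a" if a: "0 < a" for a
  proof -
    have VM: "V n \<in> borel_measurable M" for n unfolding V_def using int[of n] by auto
    define Z where "Z = {x \<in> space M. \<forall>k. \<exists>n\<ge>k. a \<le> V n x}"
    have Z: "Z \<in> events" unfolding Z_def using VM by measurable
    have "prob Z \<le> expectation (V k) / a" for k
    proof -
      have "{x \<in> space M. \<exists>n\<ge>k. a \<le> V n x} \<in> events" using VM by measurable
      moreover have "Z \<subseteq> {x \<in> space M. \<exists>n\<ge>k. a \<le> V n x}" unfolding Z_def by blast
      ultimately have "prob Z \<le> prob {x \<in> space M. \<exists>n\<ge>k. a \<le> V n x}" by (intro finite_measure_mono)
      thus ?thesis using max[OF a, of k] by simp
    qed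
    hence "prob Z \<le> 0 / a" using a by (intro LIMSEQ_le_const[OF tendsto_divide[OF Vlim tendsto_const]]) auto
    hence "Z \<in> null_sets M" using Z by (intro null_setsI) (auto simp: emeasure_eq_measure measure_le_0_iff)
    hence "AE x in M. x \<notin> Z" by (rule AE_not_in)
    thus ?thesis using AE_space by eventually_elim (use not_le in \<open>auto simp: Z_def\<close>)
  qed
  have "AE x in M. \<forall>i::nat. \<exists>k. \<forall>n\<ge>k. V n x < 1 / real (Suc i)"
    unfolding AE_all_countable by (intro allI small) simp
  moreover have "AE x in M. \<forall>n. 0 \<le> U n x" unfolding AE_all_countable using pos by blast
  ultimately show ?thesis
  proof eventually_elim
    fix x assume x: "\<forall>i::nat. \<exists>k. \<forall>n\<ge>k. V n x < 1 / real (Suc i)" "\<forall>n. 0 \<le> U n x"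
    show "(\<lambda>n. U n x) \<longlonglongrightarrow> 0"
    proof (rule LIMSEQ_I)
      fix r :: real assume "0 < r"
      then obtain i where i: "1 / real (Suc i) < r" using nat_approx_posE by metis
      obtain k where "\<forall>n\<ge>k. V n x < 1 / real (Suc i)" using x(1) by blast
      hence "norm (U n x - 0) < r" if "k \<le> n" for n
        using that x(2)[rule_format, of n] t0[of n] i unfolding V_def by fastforce
      thus "\<exists>k. \<forall>n\<ge>k. norm (U n x - 0) < r" by blast
    qed
  qed
qed

end

section \<open>Measurability of matrix-valued functions\<close>

definition mat_measurable :: "'a measure \<Rightarrow> nat \<Rightarrow> nat \<Rightarrow> ('a \<Rightarrow> complex mat) \<Rightarrow> bool" where
  "mat_measurable F n m A \<longleftrightarrow> (\<forall>\<omega>\<in>space F. A \<omega> \<in> carrier_mat n m) \<and>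
     (\<forall>i<n. \<forall>j<m. (\<lambda>\<omega>. A \<omega> $$ (i, j)) \<in> borel_measurable F)"

lemma mat_measurable_carrier: "mat_measurable F n m A \<Longrightarrow> \<omega> \<in> space F \<Longrightarrow> A \<omega> \<in> carrier_mat n m"
  by (simp add: mat_measurable_def)

lemma mat_measurable_entry:
  "mat_measurable F n m A \<Longrightarrow> i < n \<Longrightarrow> j < m \<Longrightarrow> (\<lambda>\<omega>. A \<omega> $$ (i, j)) \<in> borel_measurable F"
  by (simp add: mat_measurable_def)

lemma mat_measurableI:
  assumes "\<And>\<omega>. \<omega> \<in> space F \<Longrightarrow> A \<omega> \<in> carrier_mat n m"
    and "\<And>i j \<omega>. i < n \<Longrightarrow> j < m \<Longrightarrow> \<omega> \<in> space F \<Longrightarrow> A \<omega> $$ (i, j) = f i j \<omega>"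
    and "\<And>i j. i < n \<Longrightarrow> j < m \<Longrightarrow> f i j \<in> borel_measurable F"
  shows "mat_measurable F n m A"
proof -
  have "(\<lambda>\<omega>. A \<omega> $$ (i, j)) \<in> borel_measurable F" if "i < n" "j < m" for i j
    using assms(2)[OF that] by (subst measurable_cong[of _ _ "f i j"]) (auto intro: assms(3)[OF that])
  thus ?thesis using assms(1) by (simp add: mat_measurable_def)
qed

lemma mat_measurable_cong:
  assumes "mat_measurable F n m A" "\<And>\<omega>. \<omega> \<in> space F \<Longrightarrow> B \<omega> = A \<omega>"
  shows "mat_measurable F n m B"
  by (rule mat_measurableI[where f = "\<lambda>i j \<omega>. A \<omega> $$ (i, j)"]) (use assms in \<open>auto simp: mat_measurable_def\<close>)

lemma mat_measurable_const: "A \<in> carrier_mat n m \<Longrightarrow> mat_measurable F n m (\<lambda>_. A)"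
  by (simp add: mat_measurable_def)

lemma mat_measurable_mult:
  assumes "mat_measurable F n m A" "mat_measurable F m p B"
  shows "mat_measurable F n p (\<lambda>\<omega>. A \<omega> * B \<omega>)"
  by (rule mat_measurableI[where f = "\<lambda>i j \<omega>. \<Sum>l<m. A \<omega> $$ (i, l) * B \<omega> $$ (l, j)"])
    (use assms in \<open>auto simp: mat_measurable_def intro!: mat_mult_entry mult_carrier_mat borel_measurable_sum borel_measurable_times\<close>)

lemma cnj_measurable: "f \<in> borel_measurable F \<Longrightarrow> (\<lambda>x. cnj (f x)) \<in> borel_measurable F"
  by (rule measurable_compose[OF _ borel_measurable_continuous_onI]) (auto intro!: continuous_intros)

lemma mat_measurable_adjoint:
  assumes "mat_measurable F n m A"
  shows "mat_measurable F m n (\<lambda>\<omega>. mat_adjoint (A \<omega>))"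
  by (rule mat_measurableI[where f = "\<lambda>i j \<omega>. cnj (A \<omega> $$ (j, i))"])
    (use assms in \<open>auto simp: mat_measurable_def intro!: mat_adjoint_carrier mat_adjoint_entry cnj_measurable\<close>)

lemma mat_measurable_smult:
  assumes "mat_measurable F n m A" "c \<in> borel_measurable F"
  shows "mat_measurable F n m (\<lambda>\<omega>. c \<omega> \<cdot>\<^sub>m A \<omega>)"
  by (rule mat_measurableI[where f = "\<lambda>i j \<omega>. c \<omega> * A \<omega> $$ (i, j)"])
    (use assms in \<open>auto simp: mat_measurable_def intro!: borel_measurable_times\<close>)

lemma mat_measurable_add:
  assumes "mat_measurable F n m A" "mat_measurable F n m B"
  shows "mat_measurable F n m (\<lambda>\<omega>. A \<omega> + B \<omega>)"
  by (rule mat_measurableI[where f = "\<lambda>i j \<omega>. A \<omega> $$ (i, j) + B \<omega> $$ (i, j)"])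
    (use assms in \<open>auto simp: mat_measurable_def intro!: borel_measurable_add\<close>)

lemma mat_measurable_diff:
  assumes "mat_measurable F n m A" "mat_measurable F n m B"
  shows "mat_measurable F n m (\<lambda>\<omega>. A \<omega> - B \<omega>)"
  by (rule mat_measurableI[where f = "\<lambda>i j \<omega>. A \<omega> $$ (i, j) - B \<omega> $$ (i, j)"])
    (use assms in \<open>auto simp: mat_measurable_def intro!: borel_measurable_diff minus_carrier_mat\<close>)

lemma mat_measurable_pow:
  assumes "mat_measurable F n n A"
  shows "mat_measurable F n n (\<lambda>\<omega>. A \<omega> ^\<^sub>m r)"
proof (induction r)
  case 0
  show ?case
    by (rule mat_measurable_cong[OF mat_measurable_const[of "1\<^sub>m n" n n]])
      (use mat_measurable_carrier[OF assms] in auto)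
next
  case (Suc r)
  show ?case using mat_measurable_mult[OF Suc assms] by simp
qed

lemma mat_measurable_exp:
  assumes "mat_measurable F n n A"
  shows "mat_measurable F n n (\<lambda>\<omega>. mat_exp (A \<omega>))"
proof (rule mat_measurableI[where f = "\<lambda>i j \<omega>. \<Sum>r. (A \<omega> ^\<^sub>m r) $$ (i, j) / fact r"])
  fix \<omega> assume "\<omega> \<in> space F"
  hence c: "A \<omega> \<in> carrier_mat n n" by (rule mat_measurable_carrier[OF assms])
  thus "mat_exp (A \<omega>) \<in> carrier_mat n n" by (simp add: mat_exp_def carrier_matD)
  show "mat_exp (A \<omega>) $$ (i, j) = (\<Sum>r. (A \<omega> ^\<^sub>m r) $$ (i, j) / fact r)" if "i < n" "j < n" for i j
    using that c by (simp add: mat_exp_def)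
next
  fix i j assume "i < n" "j < n"
  thus "(\<lambda>\<omega>. \<Sum>r. (A \<omega> ^\<^sub>m r) $$ (i, j) / fact r) \<in> borel_measurable F"
    by (intro borel_measurable_suminf borel_measurable_divide mat_measurable_entry[OF mat_measurable_pow[OF assms]]) auto
qed

lemma mat_trace_measurable:
  assumes "mat_measurable F n n A"
  shows "(\<lambda>\<omega>. mat_trace (A \<omega>)) \<in> borel_measurable F"
proof -
  have "(\<lambda>\<omega>. \<Sum>i<n. A \<omega> $$ (i, i)) \<in> borel_measurable F"
    using assms by (intro borel_measurable_sum) (auto intro: mat_measurable_entry)
  thus ?thesis using mat_measurable_carrier[OF assms]
    by (subst measurable_cong[where g = "\<lambda>\<omega>. \<Sum>i<n. A \<omega> $$ (i, i)"]) (auto simp: mat_trace_def)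
qed

lemma mat_measurable_gibbs:
  assumes "mat_measurable F n n A"
  shows "mat_measurable F n n (\<lambda>\<omega>. gibbs (A \<omega>))"
  unfolding gibbs_def
  by (intro mat_measurable_smult mat_measurable_exp borel_measurable_inverse
      mat_trace_measurable[OF mat_measurable_exp[OF assms]] assms)

lemma det_measurable:
  assumes "mat_measurable F n n A"
  shows "(\<lambda>\<omega>. Determinant.det (A \<omega>)) \<in> borel_measurable F"
proof -
  have "(\<lambda>\<omega>. \<Sum>p\<in>{p. p permutes {0..<n}}. signof p * (\<Prod>i = 0..<n. A \<omega> $$ (i, p i))) \<in> borel_measurable F"
  proof (intro borel_measurable_sum borel_measurable_times borel_measurable_prod borel_measurable_const)
    fix p i assume "p \<in> {p. p permutes {0..<n}}" "i \<in> {0..<n}"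
    hence "i < n" "p i < n" using permutes_in_image[of p "{0..<n}" i] by auto
    thus "(\<lambda>\<omega>. A \<omega> $$ (i, p i)) \<in> borel_measurable F" by (rule mat_measurable_entry[OF assms])
  qed
  moreover have "Determinant.det (A \<omega>) = (\<Sum>p\<in>{p. p permutes {0..<n}}. signof p * (\<Prod>i = 0..<n. A \<omega> $$ (i, p i)))"
    if "\<omega> \<in> space F" for \<omega> by (rule det_def'[OF mat_measurable_carrier[OF assms that]])
  ultimately show ?thesis by (simp cong: measurable_cong)
qed

lemma mat_inv_eq_adj:
  assumes A: "A \<in> carrier_mat n n" and d: "Determinant.det A \<noteq> 0"
  shows "mat_inv A = inverse (Determinant.det A) \<cdot>\<^sub>m adj_mat A"
proof (rule mat_inv_eqI[OF A])
  note a = adj_mat[OF A]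
  show "inverse (Determinant.det A) \<cdot>\<^sub>m adj_mat A \<in> carrier_mat n n" using a(1) by simp
  have "inverse (Determinant.det A) \<cdot>\<^sub>m (Determinant.det A \<cdot>\<^sub>m 1\<^sub>m n) = 1\<^sub>m n"
    using d by (intro eq_matI) auto
  thus "A * (inverse (Determinant.det A) \<cdot>\<^sub>m adj_mat A) = 1\<^sub>m n"
    "(inverse (Determinant.det A) \<cdot>\<^sub>m adj_mat A) * A = 1\<^sub>m n"
    using mult_smult_distrib[OF A a(1)] mult_smult_assoc_mat[OF a(1) A] a by auto
qed

text \<open>Cramer's rule: the entries of the inverse are quotients of determinants.\<close>

lemma mat_measurable_inv:
  assumes "mat_measurable F n n A" and d: "\<And>\<omega>. \<omega> \<in> space F \<Longrightarrow> Determinant.det (A \<omega>) \<noteq> 0"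
  shows "mat_measurable F n n (\<lambda>\<omega>. mat_inv (A \<omega>))"
proof -
  note c = mat_measurable_carrier[OF assms(1)]
  have del: "mat_measurable F (n - 1) (n - 1) (\<lambda>\<omega>. mat_delete (A \<omega>) j i)" for i j
  proof (rule mat_measurableI[where f = "\<lambda>i' j' \<omega>. A \<omega> $$ (if i' < j then i' else Suc i', if j' < i then j' else Suc j')"])
    show "mat_delete (A \<omega>) j i \<in> carrier_mat (n - 1) (n - 1)" if "\<omega> \<in> space F" for \<omega>
      by (rule mat_delete_carrier[OF c[OF that]])
    show "mat_delete (A \<omega>) j i $$ (i', j') = A \<omega> $$ (if i' < j then i' else Suc i', if j' < i then j' else Suc j')"
      if "i' < n - 1" "j' < n - 1" "\<omega> \<in> space F" for i' j' \<omega>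
      using c[OF that(3)] that by (simp add: mat_delete_def)
    show "(\<lambda>\<omega>. A \<omega> $$ (if i' < j then i' else Suc i', if j' < i then j' else Suc j')) \<in> borel_measurable F"
      if "i' < n - 1" "j' < n - 1" for i' j'
      using that by (intro mat_measurable_entry[OF assms(1)]) auto
  qed
  have adj: "mat_measurable F n n (\<lambda>\<omega>. adj_mat (A \<omega>))"
  proof (rule mat_measurableI[where f = "\<lambda>i j \<omega>. (-1) ^ (j + i) * Determinant.det (mat_delete (A \<omega>) j i)"])
    show "adj_mat (A \<omega>) \<in> carrier_mat n n" if "\<omega> \<in> space F" for \<omega> by (rule adj_mat(1)[OF c[OF that]])
    show "adj_mat (A \<omega>) $$ (i, j) = (- 1) ^ (j + i) * Determinant.det (mat_delete (A \<omega>) j i)"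
      if "i < n" "j < n" "\<omega> \<in> space F" for i j \<omega> using c[OF that(3)] that by (simp add: adj_mat_def cofactor_def)
    show "(\<lambda>\<omega>. (- 1) ^ (j + i) * Determinant.det (mat_delete (A \<omega>) j i)) \<in> borel_measurable F" for i j
      by (intro borel_measurable_times borel_measurable_const det_measurable[OF del])
  qed
  show ?thesis
    by (rule mat_measurable_cong[OF mat_measurable_smult[OF adj borel_measurable_inverse[OF det_measurable[OF assms(1)]]]])
      (rule mat_inv_eq_adj[OF c d])
qed

lemma ge_one_mat_det: "ge_one_mat n A \<Longrightarrow> Determinant.det A \<noteq> 0"
  unfolding ge_one_mat_def by (fastforce simp: spec_mat_det)

lemma mat_measurable_signal_cov:
  fixes X h :: "'a \<Rightarrow> 'u::finite \<Rightarrow> complex mat"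
  assumes "\<And>k. mat_measurable F (M k) (M k) (\<lambda>\<omega>. X \<omega> k)" "\<And>k. mat_measurable F N (M k) (\<lambda>\<omega>. h \<omega> k)"
  shows "mat_measurable F N N (\<lambda>\<omega>. signal_cov N P S (X \<omega>) (h \<omega>))"
proof (rule mat_measurableI[OF _ signal_cov_entry])
  fix i j assume ij: "i < N" "j < N"
  show "(\<lambda>\<omega>. (if i = j then 1 else 0) + (\<Sum>l\<in>S. complex_of_real (P l) *
      (h \<omega> l * X \<omega> l * mat_adjoint (h \<omega> l)) $$ (i, j))) \<in> borel_measurable F"
    by (intro borel_measurable_add borel_measurable_const borel_measurable_sum borel_measurable_times
      mat_measurable_entry[OF mat_measurable_mult[OF mat_measurable_mult[OF assms(2,1)] mat_measurable_adjoint[OF assms(2)]] ij])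
qed (auto intro: signal_cov_carrier)

lemma mat_measurable_grad_inst:
  fixes X h :: "'a \<Rightarrow> 'u::finite \<Rightarrow> complex mat"
  assumes X: "\<And>k. mat_measurable F (M k) (M k) (\<lambda>\<omega>. X \<omega> k)" and h: "\<And>k. mat_measurable F N (M k) (\<lambda>\<omega>. h \<omega> k)"
    and psd: "\<And>\<omega> k. \<omega> \<in> space F \<Longrightarrow> psd_mat (M k) (X \<omega> k)" and P: "\<And>k. 0 \<le> P k"
  shows "mat_measurable F (M k) (M k) (\<lambda>\<omega>. grad_inst N P k (X \<omega>) (h \<omega>))"
  unfolding grad_inst_def
  by (intro mat_measurable_mult[OF mat_measurable_mult[OF mat_measurable_adjoint[OF h]] h] mat_measurable_inv
      mat_measurable_signal_cov[OF X h] ge_one_mat_det[of N] signal_cov_ge_one[OF mat_measurable_carrier[OF h] psd P])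

lemma log_det_measurable:
  assumes "mat_measurable F n n A"
  shows "(\<lambda>\<omega>. log_det (A \<omega>)) \<in> borel_measurable F"
  unfolding log_det_def using det_measurable[OF assms] by measurable

lemma frob_measurable:
  assumes "mat_measurable F n n A" "mat_measurable F n n B"
  shows "(\<lambda>\<omega>. frob n (A \<omega>) (B \<omega>)) \<in> borel_measurable F"
  unfolding frob_def
  by (intro borel_measurable_sum measurable_compose[OF _ borel_measurable_Re] borel_measurable_times cnj_measurable
     mat_measurable_entry[OF assms(1)] mat_measurable_entry[OF assms(2)]; simp only: lessThan_iff)

section \<open>Gibbs states and the variational principle\<close>

text \<open>The function whose supremum over \<open>Y\<close> is the negative von Neumann entropy of \<open>p\<close>. Writing \<open>p\<close> as a Gibbs state
amounts to attaining the supremum.\<close>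

definition gibbs_objective :: "nat \<Rightarrow> complex mat \<Rightarrow> complex mat \<Rightarrow> real" where
  "gibbs_objective n p Y = frob n p Y - log_trace_exp Y"

lemma gibbs_objective_max:
  assumes "hermitian_mat n Y" "hermitian_mat n Z" "0 < n"
  shows "gibbs_objective n (gibbs Y) Z \<le> gibbs_objective n (gibbs Y) Y"
  using log_trace_exp_tangent[OF assms] frob_diff_right[OF hermitian_carrier[OF assms(2)] hermitian_carrier[OF assms(1)]]
  by (simp add: gibbs_objective_def)

text \<open>The pairing averages the eigenvalues of \<open>Y\<close> with weights that sum to one, and each of them is at most
\<open>log_trace_exp Y\<close>. Hence negative entropies are at most 0.\<close>

lemma gibbs_objective_nonpos:
  assumes X: "X \<in> action_set n" and Y: "hermitian_mat n Y" and n: "0 < n"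
  shows "gibbs_objective n X Y \<le> 0"
proof -
  obtain U x where U: "unitary_mat n U" "X = spec_mat n U x" and x: "\<And>l. l < n \<Longrightarrow> 0 \<le> x l" "(\<Sum>l<n. x l) = 1"
    using action_set_spec[OF X] by metis
  obtain V y where V: "unitary_mat n V" "Y = spec_mat n V y" using hermitian_spectral[OF Y] .
  let ?w = "overlap n U V" and ?s = "ln (\<Sum>l<n. exp (y l))"
  have "y m \<le> ?s" if "m < n" for m
  proof -
    have "exp (y m) \<le> (\<Sum>l<n. exp (y l))" using that by (intro member_le_sum) auto
    thus ?thesis using ln_le_cancel_iff[of "exp (y m)" "\<Sum>l<n. exp (y l)"] exp_gt_zero[of "y m"]
      by (metis ln_exp less_le_trans)
  qed
  hence "frob n X Y \<le> (\<Sum>l<n. \<Sum>m<n. ?w l m * (x l * ?s))"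
    unfolding U(2) V(2) frob_spec_mixed(1)[OF U(1) V(1)] using x
    by (intro sum_mono mult_left_mono overlap_nonneg) auto
  also have "\<dots> = (\<Sum>l<n. (\<Sum>m<n. ?w l m) * (x l * ?s))" by (simp add: sum_distrib_right)
  also have "\<dots> = ?s" using x(2) by (simp add: overlap_row_sum[OF U(1) V(1)] flip: sum_distrib_right)
  finally show ?thesis unfolding gibbs_objective_def V(2) spec_log_trace_exp[OF V(1)] by simp
qed

text \<open>A quantitative form of uniqueness, akin to Pinsker's inequality: unless \<open>p\<close> is the Gibbs state of \<open>Y\<close>, a step from \<open>Y\<close>
in the direction \<open>p - gibbs Y\<close>, which is the gradient of the objective at \<open>Y\<close>, improves the objective.\<close>

lemma gibbs_objective_improve:
  assumes p: "p \<in> action_set n" and Y: "hermitian_mat n Y" and n: "0 < n" and R: "fnorm n Y \<le> R"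
  obtains Z where "hermitian_mat n Z"
    "gibbs_objective n p Y + exp (- 2 * (R + 2)) / 4 * frob n (p - gibbs Y) (p - gibbs Y) \<le> gibbs_objective n p Z"
proof -
  define X where "X = gibbs Y"
  have X: "X \<in> action_set n" unfolding X_def by (rule gibbs_action_set[OF Y n])
  note c = action_set_carrier[OF p] action_set_carrier[OF X] hermitian_carrier[OF Y]
  \<comment> \<open>Both \<open>Y\<close> and \<open>Z\<close> lie in the ball of radius \<open>R + 2\<close>; this step length makes the quadratic loss half of the gain.\<close>
  define s where "s = exp (- 2 * (R + 2)) / 2"
  have R0: "0 \<le> R" using R by (rule order_trans[rotated]) (simp add: frob_self_nonneg)
  have "exp (- 2 * (R + 2)) \<le> 1" using R0 by simp
  hence s: "0 < s" "s \<le> 1" unfolding s_def using exp_gt_zero[of "- 2 * (R + 2)"] by linarith+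
  define Z where "Z = Y + complex_of_real s \<cdot>\<^sub>m (p - X)"
  have D: "p - X \<in> carrier_mat n n" using c(2) by (rule minus_carrier_mat)
  have Z: "hermitian_mat n Z" unfolding Z_def
    by (intro hermitian_lincomb Y hermitian_diff action_set_hermitian[OF p] action_set_hermitian[OF X])
  have fD: "fnorm n (p - X) \<le> 2"
    using fnorm_diff_triangle[OF c(1,2)] action_set_frob_le[OF p] action_set_frob_le[OF X]
    by (smt (verit) real_sqrt_le_1_iff)
  have "fnorm n Z \<le> fnorm n Y + s * fnorm n (p - X)"
    unfolding Z_def using fnorm_triangle[OF c(3) smult_carrier_mat[OF D, of "complex_of_real s"]] fnorm_smult[OF D, of s] s
    by linarith
  also have "\<dots> \<le> R + 1 * 2" using R fD s by (intro add_mono mult_mono) (auto simp: frob_self_nonneg)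
  finally have fZ: "frob n Z Z \<le> (R + 2)\<^sup>2" using R0 by (simp add: sqrt_le_D)
  have fY: "frob n Y Y \<le> (R + 2)\<^sup>2" using R R0 by (intro sqrt_le_D) simp
  have ZY: "Z - Y = complex_of_real s \<cdot>\<^sub>m (p - X)"
    unfolding Z_def using c D by (intro eq_matI) auto
  have "log_trace_exp Z \<le> log_trace_exp Y + s * frob n X (p - X) + exp (2 * (R + 2)) * (s * (s * frob n (p - X) (p - X)))"
    using log_trace_exp_smooth[OF Y Z n fY fZ] R0 unfolding ZY X_def[symmetric]
    by (simp add: frob_smult_left[OF D] frob_smult_right[OF D])
  also have "exp (2 * (R + 2)) * (s * (s * frob n (p - X) (p - X))) = s / 2 * frob n (p - X) (p - X)"
    by (simp add: s_def exp_minus exp_add[symmetric] field_simps)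
  finally have 1: "log_trace_exp Z \<le> log_trace_exp Y + s * frob n X (p - X) + s / 2 * frob n (p - X) (p - X)" .
  have "frob n p Z = frob n p Y + s * frob n p (p - X)"
    unfolding Z_def using c D by (simp add: frob_add_right frob_smult_right)
  moreover have "frob n p (p - X) - frob n X (p - X) = frob n (p - X) (p - X)"
    using c by (simp add: frob_diff_left)
  hence "s * frob n p (p - X) = s * frob n X (p - X) + s * frob n (p - X) (p - X)"
    by (simp flip: distrib_left)
  ultimately have "gibbs_objective n p Y + s / 2 * frob n (p - X) (p - X) \<le> gibbs_objective n p Z"
    unfolding gibbs_objective_def using 1 by (simp add: field_simps)
  thus ?thesis using that[OF Z] unfolding s_def X_def by simp
qed

lemma gibbs_objective_affine:
  assumes "A \<in> carrier_mat n n" "B \<in> carrier_mat n n"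
  shows "gibbs_objective n (A + complex_of_real t \<cdot>\<^sub>m (B - A)) Y =
    (1 - t) * gibbs_objective n A Y + t * gibbs_objective n B Y"
  using assms minus_carrier_mat[OF assms(1), of B] unfolding gibbs_objective_def
  by (simp add: frob_add_left frob_smult_left frob_diff_left algebra_simps)

section \<open>Compactness of the strategy space\<close>

definition strategy_profile :: "('u \<Rightarrow> nat) \<Rightarrow> ('u \<Rightarrow> complex mat) \<Rightarrow> bool" where
  "strategy_profile M X \<longleftrightarrow> (\<forall>k. X k \<in> action_set (M k))"

lemma strategy_profileD:
  assumes "strategy_profile M X"
  shows "X k \<in> action_set (M k)" "psd_mat (M k) (X k)" "X k \<in> carrier_mat (M k) (M k)"
    "hermitian_mat (M k) (X k)"
  using assms action_set_carrier action_set_hermitian by (auto simp: strategy_profile_def action_set_def)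

lemma profile_dist_frob:
  assumes "\<And>k. A k \<in> carrier_mat (M k) (M k)" "\<And>k. B k \<in> carrier_mat (M k) (M k)"
  shows "profile_dist M A B = sqrt (\<Sum>k\<in>UNIV. frob (M k) (A k - B k) (A k - B k))"
  unfolding profile_dist_def frob_self
proof (intro arg_cong[where f = sqrt] sum.cong refl)
  fix k i j assume "i \<in> {..<M k}" "j \<in> {..<M k}"
  thus "(cmod (A k $$ (i, j) - B k $$ (i, j)))\<^sup>2 = (cmod ((A k - B k) $$ (i, j)))\<^sup>2"
    using assms(1)[of k] assms(2)[of k] by simp
qed

lemma psd_zero: "psd_mat n (0\<^sub>m n n)"
  by (auto simp: psd_mat_def hermitian_entry quadratic_form_entry[OF zero_carrier_mat])

text \<open>Bolzano-Weierstrass, one coordinate at a time.\<close>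

lemma finite_index_subsequence:
  fixes f :: "nat \<Rightarrow> 'i \<Rightarrow> complex"
  assumes "finite I" "\<And>n i. i \<in> I \<Longrightarrow> cmod (f n i) \<le> c"
  shows "\<exists>r l. strict_mono (r :: nat \<Rightarrow> nat) \<and> (\<forall>i\<in>I. (\<lambda>n. f (r n) i) \<longlonglongrightarrow> l i)"
  using assms
proof (induction I)
  case empty
  show ?case by (intro exI[of _ id]) (auto simp: strict_mono_def)
next
  case (insert x I)
  obtain r l where r: "strict_mono (r :: nat \<Rightarrow> nat)" "\<forall>i\<in>I. (\<lambda>n. f (r n) i) \<longlonglongrightarrow> l i"
    using insert by auto
  have "bounded (range (\<lambda>n. f (r n) x))"
    using insert.prems[of x] by (intro boundedI[where B = c]) auto
  then obtain s lx where s: "strict_mono (s :: nat \<Rightarrow> nat)" "(\<lambda>n. f (r (s n)) x) \<longlonglongrightarrow> lx"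
    using bounded_imp_convergent_subsequence[of "\<lambda>n. f (r n) x"] by (auto simp: o_def)
  have "(\<lambda>n. f (r (s n)) i) \<longlonglongrightarrow> l i" if "i \<in> I" for i
    using LIMSEQ_subseq_LIMSEQ[OF r(2)[rule_format, OF that] s(1)] by (simp add: o_def)
  hence "\<forall>i\<in>insert x I. (\<lambda>n. f ((r \<circ> s) n) i) \<longlonglongrightarrow> (l(x := lx)) i"
    using s(2) insert.hyps(2) by auto
  thus ?case using strict_mono_o[OF r(1) s(1)] by blast
qed

lemma action_set_closed:
  assumes X: "\<And>n. X n \<in> action_set m" and L: "L \<in> carrier_mat m m"
    and lim: "\<And>i j. i < m \<Longrightarrow> j < m \<Longrightarrow> (\<lambda>n. X n $$ (i, j)) \<longlonglongrightarrow> L $$ (i, j)"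
  shows "L \<in> action_set m"
proof -
  note Xc = action_set_carrier[OF X]
  have "hermitian_mat m L" unfolding hermitian_entry
  proof (intro conjI L allI impI)
    fix i j assume ij: "i < m" "j < m"
    have e: "X n $$ (j, i) = cnj (X n $$ (i, j))" for n
      using action_set_hermitian[OF X, of n] ij unfolding hermitian_entry by blast
    have "(\<lambda>n. X n $$ (j, i)) \<longlonglongrightarrow> cnj (L $$ (i, j))"
      unfolding e by (intro tendsto_cnj lim ij)
    thus "L $$ (j, i) = cnj (L $$ (i, j))" using lim[OF ij(2,1)] LIMSEQ_unique by blast
  qed
  moreover have "0 \<le> Re ((L *\<^sub>v v) \<bullet>c v)" if v: "v \<in> carrier_vec m" for v
  proof -
    have "(\<lambda>n. Re ((X n *\<^sub>v v) \<bullet>c v)) \<longlonglongrightarrow> Re ((L *\<^sub>v v) \<bullet>c v)"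
      unfolding quadratic_form_entry[OF L v] quadratic_form_entry[OF Xc v]
      by (intro tendsto_sum tendsto_Re tendsto_mult tendsto_const lim) auto
    thus ?thesis by (rule LIMSEQ_le_const) (use X v in \<open>auto simp: action_set_def psd_mat_def\<close>)
  qed
  moreover have "mat_trace L = 1"
  proof -
    have "mat_trace (X n) = (\<Sum>i<m. X n $$ (i, i))" for n using Xc[of n] by (auto simp: mat_trace_def)
    hence "(\<lambda>n. mat_trace (X n)) \<longlonglongrightarrow> (\<Sum>i<m. L $$ (i, i))"
      by (simp only:) (intro tendsto_sum lim, auto)
    also have "(\<Sum>i<m. L $$ (i, i)) = mat_trace L" using L by (auto simp: mat_trace_def)
    finally have "(\<lambda>n. mat_trace (X n)) \<longlonglongrightarrow> mat_trace L" .
    moreover have "(\<lambda>n. mat_trace (X n)) = (\<lambda>_. 1)" using X by (auto simp: action_set_def)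
    ultimately show ?thesis by (simp add: LIMSEQ_const_iff)
  qed
  ultimately show ?thesis by (auto simp: action_set_def psd_mat_def)
qed

lemma strategy_profile_compact:
  fixes X :: "nat \<Rightarrow> 'u::finite \<Rightarrow> complex mat"
  assumes X: "\<And>n. strategy_profile M (X n)"
  obtains r L where "strict_mono (r :: nat \<Rightarrow> nat)" "strategy_profile M L"
    "\<forall>k. (\<lambda>n. frob (M k) (X (r n) k - L k) (X (r n) k - L k)) \<longlonglongrightarrow> 0"
proof -
  let ?I = "SIGMA k:UNIV. {..<M k} \<times> {..<M k}"
  have "cmod (X n k $$ (i, j)) \<le> 1" if "i < M k" "j < M k" for n k i j
    by (rule frob_entry_bound[OF _ _ that]) (use action_set_frob_le[OF strategy_profileD(1)[OF X]] in auto)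
  hence "\<exists>r l. strict_mono (r :: nat \<Rightarrow> nat) \<and> (\<forall>x\<in>?I. (\<lambda>n. (\<lambda>n (k, ij). X n k $$ ij) (r n) x) \<longlonglongrightarrow> l x)"
    by (intro finite_index_subsequence[where c = 1]) auto
  then obtain r l where r: "strict_mono r"
    and l: "\<forall>x\<in>?I. (\<lambda>n. (\<lambda>n (k, ij). X n k $$ ij) (r n) x) \<longlonglongrightarrow> l x" by blast
  define L where "L k = mat (M k) (M k) (\<lambda>ij. l (k, ij))" for k
  have Lc: "L k \<in> carrier_mat (M k) (M k)" for k by (simp add: L_def)
  have lim: "(\<lambda>n. X (r n) k $$ (i, j)) \<longlonglongrightarrow> L k $$ (i, j)" if "i < M k" "j < M k" for k i j
    using bspec[OF l, of "(k, i, j)"] that by (simp add: L_def)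
  have L: "strategy_profile M L" unfolding strategy_profile_def
    using action_set_closed[OF strategy_profileD(1)[OF X] Lc lim] by blast
  have "(\<lambda>n. frob (M k) (X (r n) k - L k) (X (r n) k - L k)) \<longlonglongrightarrow> 0" for k
  proof -
    have "(\<lambda>n. \<Sum>i<M k. \<Sum>j<M k. (cmod (X (r n) k $$ (i, j) - L k $$ (i, j)))\<^sup>2) \<longlonglongrightarrow>
      (\<Sum>i<M k. \<Sum>j<M k. (cmod (L k $$ (i, j) - L k $$ (i, j)))\<^sup>2)"
      by (intro tendsto_sum tendsto_power tendsto_norm tendsto_diff tendsto_const lim) auto
    moreover have "frob (M k) (X (r n) k - L k) (X (r n) k - L k) =
      (\<Sum>i<M k. \<Sum>j<M k. (cmod (X (r n) k $$ (i, j) - L k $$ (i, j)))\<^sup>2)" for n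
      unfolding frob_self using Lc[of k] by (intro sum.cong refl) auto
    ultimately show ?thesis by simp
  qed
  thus ?thesis using that[OF r L] by blast
qed

section \<open>The expected gradients\<close>

locale channel_game = prob_space \<Omega> for \<Omega> :: "'w measure" +
  fixes N :: nat and M :: "'u::finite \<Rightarrow> nat" and P :: "'u \<Rightarrow> real"
    and H :: "nat \<Rightarrow> 'w \<Rightarrow> 'u \<Rightarrow> complex mat"
  assumes M_pos: "\<And>k. 0 < M k" and P_pos: "\<And>k. 0 < P k" and channel: "channel_process \<Omega> N M H"
begin

lemma P_nonneg: "0 \<le> P k" using P_pos less_imp_le by blast

lemma H_carrier: "1 \<le> n \<Longrightarrow> \<omega> \<in> space \<Omega> \<Longrightarrow> H n \<omega> k \<in> carrier_mat N (M k)"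
  using channel by (auto simp: channel_process_def)

lemma H_measurable:
  assumes "1 \<le> n"
  shows "mat_measurable \<Omega> N (M k) (\<lambda>\<omega>. H n \<omega> k)"
proof -
  have "(\<lambda>\<omega>. H n \<omega> k $$ (i, j)) \<in> borel_measurable \<Omega>" if ij: "i < N" "j < M k" for i j
  proof -
    have mem: "(k, i, j) \<in> channel_idx N M" using ij by (simp add: channel_idx_def)
    have "(\<lambda>\<omega>. channel_entries N M (H n \<omega>)) \<in> measurable \<Omega> (channel_space N M)"
      using channel assms by (simp add: channel_process_def)
    from measurable_compose[OF this[unfolded channel_space_def] measurable_component_singleton[OF mem]]
    show ?thesis using mem by (simp add: channel_entries_def)
  qed
  thus ?thesis using H_carrier[OF assms] by (simp add: mat_measurable_def)
qed

definition channel_bound :: real where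
  "channel_bound = (SOME B. AE \<omega> in \<Omega>. \<forall>n\<ge>1. \<forall>k. \<forall>i<N. \<forall>j<M k. cmod (H n \<omega> k $$ (i, j)) \<le> B)"

lemma channel_bound:
  "AE \<omega> in \<Omega>. \<forall>n\<ge>1. \<forall>k. \<forall>i<N. \<forall>j<M k. cmod (H n \<omega> k $$ (i, j)) \<le> channel_bound"
  unfolding channel_bound_def
proof (rule someI_ex)
  obtain B where B: "\<forall>n\<ge>1. AE \<omega> in \<Omega>. \<forall>k. \<forall>i<N. \<forall>j<M k. cmod (H n \<omega> k $$ (i, j)) \<le> B"
    using channel by (auto simp: channel_process_def)
  have "AE \<omega> in \<Omega>. \<forall>n. 1 \<le> n \<longrightarrow> (\<forall>k. \<forall>i<N. \<forall>j<M k. cmod (H n \<omega> k $$ (i, j)) \<le> B)"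
  proof (rule AE_all_countable[THEN iffD2], rule allI)
    fix n :: nat
    show "AE \<omega> in \<Omega>. 1 \<le> n \<longrightarrow> (\<forall>k. \<forall>i<N. \<forall>j<M k. cmod (H n \<omega> k $$ (i, j)) \<le> B)"
    proof (cases "1 \<le> n")
      case True
      from B[rule_format, OF this] show ?thesis by (rule eventually_mono) blast
    qed simp
  qed
  thus "\<exists>B. AE \<omega> in \<Omega>. \<forall>n\<ge>1. \<forall>k. \<forall>i<N. \<forall>j<M k. cmod (H n \<omega> k $$ (i, j)) \<le> B" by blast
qed

definition grad_bound :: real where
  "grad_bound = (real N)\<^sup>2 * (channel_bound\<^sup>2 * sqrt (real N))"

lemma grad_bound_nonneg: "0 \<le> grad_bound" by (simp add: grad_bound_def)

lemma grad_inst_bound: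
  "AE \<omega> in \<Omega>. \<forall>n\<ge>1. \<forall>X. (\<forall>k. psd_mat (M k) (X k)) \<longrightarrow>
    (\<forall>k. \<forall>i<M k. \<forall>j<M k. cmod (grad_inst N P k X (H n \<omega>) $$ (i, j)) \<le> grad_bound)"
  using channel_bound AE_space
proof eventually_elim
  fix \<omega> assume B: "\<forall>n\<ge>1. \<forall>k. \<forall>i<N. \<forall>j<M k. cmod (H n \<omega> k $$ (i, j)) \<le> channel_bound" and \<omega>: "\<omega> \<in> space \<Omega>"
  show "\<forall>n\<ge>1. \<forall>X. (\<forall>k. psd_mat (M k) (X k)) \<longrightarrow>
    (\<forall>k. \<forall>i<M k. \<forall>j<M k. cmod (grad_inst N P k X (H n \<omega>) $$ (i, j)) \<le> grad_bound)"
    unfolding grad_bound_def using B \<omega> by (auto intro!: grad_inst_entry_bound H_carrier P_nonneg)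
qed

lemma grad_inst_measurable:
  assumes "\<And>k. psd_mat (M k) (X k)"
  shows "mat_measurable \<Omega> (M k) (M k) (\<lambda>\<omega>. grad_inst N P k X (H 1 \<omega>))"
  using assms by (intro mat_measurable_grad_inst[where X = "\<lambda>_. X"] mat_measurable_const H_measurable P_nonneg)
    (auto intro: hermitian_carrier psd_hermitian)

lemma grad_inst_integrable:
  assumes X: "\<And>k. psd_mat (M k) (X k)" and ij: "i < M k" "j < M k"
  shows "integrable \<Omega> (\<lambda>\<omega>. grad_inst N P k X (H 1 \<omega>) $$ (i, j))"
proof (rule integrable_const_bound)
  show "AE \<omega> in \<Omega>. norm (grad_inst N P k X (H 1 \<omega>) $$ (i, j)) \<le> grad_bound"
    using grad_inst_bound by eventually_elim (use X ij in auto)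
qed (rule mat_measurable_entry[OF grad_inst_measurable[OF X] ij])

abbreviation grad :: "'u \<Rightarrow> ('u \<Rightarrow> complex mat) \<Rightarrow> complex mat" where
  "grad \<equiv> grad_rate \<Omega> N M P H"

lemma grad_entry:
  "i < M k \<Longrightarrow> j < M k \<Longrightarrow> grad k X $$ (i, j) = (\<integral>\<omega>. grad_inst N P k X (H 1 \<omega>) $$ (i, j) \<partial>\<Omega>)"
  by (simp add: grad_rate_def)

lemma grad_carrier: "grad k X \<in> carrier_mat (M k) (M k)"
  by (simp add: grad_rate_def)

lemma grad_hermitian:
  assumes X: "\<And>k. psd_mat (M k) (X k)"
  shows "hermitian_mat (M k) (grad k X)"
  unfolding hermitian_entry
proof (intro conjI grad_carrier allI impI)
  fix i j assume ij: "i < M k" "j < M k"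
  have "(\<integral>\<omega>. grad_inst N P k X (H 1 \<omega>) $$ (j, i) \<partial>\<Omega>) = (\<integral>\<omega>. cnj (grad_inst N P k X (H 1 \<omega>) $$ (i, j)) \<partial>\<Omega>)"
  proof (rule Bochner_Integration.integral_cong[OF refl])
    fix \<omega> assume "\<omega> \<in> space \<Omega>"
    hence "hermitian_mat (M k) (grad_inst N P k X (H 1 \<omega>))"
      by (intro grad_inst_hermitian H_carrier X P_nonneg) auto
    thus "grad_inst N P k X (H 1 \<omega>) $$ (j, i) = cnj (grad_inst N P k X (H 1 \<omega>) $$ (i, j))"
      using ij unfolding hermitian_entry by blast
  qed
  thus "grad k X $$ (j, i) = cnj (grad k X $$ (i, j))" by (simp add: grad_entry ij)
qed

lemma grad_fnorm_bound:
  assumes X: "\<And>k. psd_mat (M k) (X k)"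
  shows "fnorm (M k) (grad k X) \<le> real (M k) * grad_bound"
proof -
  have "frob (M k) (grad k X) (grad k X) \<le> (real (M k) * grad_bound)\<^sup>2"
  proof (rule frob_self_bound)
    fix i j assume ij: "i < M k" "j < M k"
    have "cmod (grad k X $$ (i, j)) \<le> (\<integral>\<omega>. cmod (grad_inst N P k X (H 1 \<omega>) $$ (i, j)) \<partial>\<Omega>)"
      unfolding grad_entry[OF ij] by (rule integral_norm_bound)
    also have "\<dots> \<le> (\<integral>\<omega>. grad_bound \<partial>\<Omega>)"
    proof (rule integral_mono_AE)
      show "AE \<omega> in \<Omega>. cmod (grad_inst N P k X (H 1 \<omega>) $$ (i, j)) \<le> grad_bound"
        using grad_inst_bound by eventually_elim (use X ij in auto)
    qed (use grad_inst_integrable[OF X ij] in auto)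
    finally show "cmod (grad k X $$ (i, j)) \<le> grad_bound" by (simp add: prob_space)
  qed
  thus ?thesis using grad_bound_nonneg by (intro real_le_lsqrt) (auto simp: frob_self_nonneg)
qed

lemma frob_grad:
  assumes X: "\<And>k. psd_mat (M k) (X k)"
  shows "integrable \<Omega> (\<lambda>\<omega>. frob (M k) A (grad_inst N P k X (H 1 \<omega>)))"
    and "frob (M k) A (grad k X) = (\<integral>\<omega>. frob (M k) A (grad_inst N P k X (H 1 \<omega>)) \<partial>\<Omega>)"
proof -
  have int: "integrable \<Omega> (\<lambda>\<omega>. Re (A $$ (i, j) * cnj (grad_inst N P k X (H 1 \<omega>) $$ (i, j))))"
    if "i < M k" "j < M k" for i j
    by (intro integrable_Re integrable_mult_right integrable_cnj grad_inst_integrable[OF X that])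
  show "integrable \<Omega> (\<lambda>\<omega>. frob (M k) A (grad_inst N P k X (H 1 \<omega>)))"
    unfolding frob_def using int by (intro Bochner_Integration.integrable_sum) auto
  have "(\<integral>\<omega>. frob (M k) A (grad_inst N P k X (H 1 \<omega>)) \<partial>\<Omega>) =
     (\<Sum>i<M k. \<Sum>j<M k. (\<integral>\<omega>. Re (A $$ (i, j) * cnj (grad_inst N P k X (H 1 \<omega>) $$ (i, j))) \<partial>\<Omega>))"
    unfolding frob_def using int
    by (subst Bochner_Integration.integral_sum; (intro sum.cong refl Bochner_Integration.integral_sum Bochner_Integration.integrable_sum)?) auto
  also have "\<dots> = frob (M k) A (grad k X)"
    unfolding frob_def
  proof (intro sum.cong refl)
    fix i j assume "i \<in> {..<M k}" "j \<in> {..<M k}"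
    hence ij: "i < M k" "j < M k" by auto
    have "(\<integral>\<omega>. Re (A $$ (i, j) * cnj (grad_inst N P k X (H 1 \<omega>) $$ (i, j))) \<partial>\<Omega>) =
       Re (\<integral>\<omega>. A $$ (i, j) * cnj (grad_inst N P k X (H 1 \<omega>) $$ (i, j)) \<partial>\<Omega>)"
      by (intro integral_Re integrable_mult_right integrable_cnj grad_inst_integrable[OF X ij])
    also have "\<dots> = Re (A $$ (i, j) * cnj (grad k X $$ (i, j)))"
      by (simp only: integral_mult_right_zero Bochner_Integration.integral_cnj grad_entry[OF ij])
    finally show "(\<integral>\<omega>. Re (A $$ (i, j) * cnj (grad_inst N P k X (H 1 \<omega>) $$ (i, j))) \<partial>\<Omega>) =
       Re (A $$ (i, j) * cnj (grad k X $$ (i, j)))" .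
  qed
  finally show "frob (M k) A (grad k X) = (\<integral>\<omega>. frob (M k) A (grad_inst N P k X (H 1 \<omega>)) \<partial>\<Omega>)" ..
qed

lemma sum_frob_grad:
  assumes X: "\<And>k. psd_mat (M k) (X k)"
  shows "integrable \<Omega> (\<lambda>\<omega>. \<Sum>k\<in>UNIV. P k * frob (M k) (A k) (grad_inst N P k X (H 1 \<omega>)))"
    and "(\<Sum>k\<in>UNIV. P k * frob (M k) (A k) (grad k X)) =
      (\<integral>\<omega>. (\<Sum>k\<in>UNIV. P k * frob (M k) (A k) (grad_inst N P k X (H 1 \<omega>))) \<partial>\<Omega>)"
  using frob_grad[OF X] by (auto intro!: Bochner_Integration.integrable_sum integrable_mult_right)

text \<open>For each channel realization the received covariances and their inverses move in opposite directions, in the sense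
of monotone operators; the expectation preserves this.\<close>

lemma grad_monotone:
  assumes X: "\<And>k. psd_mat (M k) (X k)" and Y: "\<And>k. psd_mat (M k) (Y k)"
  shows "(\<Sum>k\<in>UNIV. P k * frob (M k) (Y k - X k) (grad k Y - grad k X)) \<le> 0"
proof -
  let ?g = "\<lambda>Z \<omega>. \<Sum>k\<in>UNIV. P k * frob (M k) (Y k - X k) (grad_inst N P k Z (H 1 \<omega>))"
  have "(\<Sum>k\<in>UNIV. P k * frob (M k) (Y k - X k) (grad k Y - grad k X)) =
     (\<Sum>k\<in>UNIV. P k * frob (M k) (Y k - X k) (grad k Y)) - (\<Sum>k\<in>UNIV. P k * frob (M k) (Y k - X k) (grad k X))"
    by (simp add: frob_diff_right[OF grad_carrier grad_carrier] right_diff_distrib sum_subtractf)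
  also have "\<dots> = (\<integral>\<omega>. ?g Y \<omega> - ?g X \<omega> \<partial>\<Omega>)"
    unfolding sum_frob_grad(2)[OF X] sum_frob_grad(2)[OF Y]
    by (rule Bochner_Integration.integral_diff[symmetric]; rule sum_frob_grad(1)) (auto intro: X Y)
  also have "\<dots> \<le> (\<integral>\<omega>. 0 \<partial>\<Omega>)"
  proof (rule integral_mono)
    show "integrable \<Omega> (\<lambda>\<omega>. ?g Y \<omega> - ?g X \<omega>)"
      by (intro Bochner_Integration.integrable_diff sum_frob_grad(1) X Y)
    fix \<omega> assume "\<omega> \<in> space \<Omega>"
    hence "(\<Sum>k\<in>UNIV. P k * (frob (M k) (Y k - X k) (grad_inst N P k Y (H 1 \<omega>)) -
        frob (M k) (Y k - X k) (grad_inst N P k X (H 1 \<omega>)))) \<le> 0"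
      by (intro grad_inst_monotone H_carrier X Y P_nonneg) auto
    thus "?g Y \<omega> - ?g X \<omega> \<le> 0" by (simp add: right_diff_distrib sum_subtractf)
  qed simp
  finally show ?thesis by simp
qed

section \<open>The potential of the game\<close>

definition potential :: "('u \<Rightarrow> complex mat) \<Rightarrow> real" where
  "potential X = (\<integral>\<omega>. log_det (W_mat N P X (H 1 \<omega>)) \<partial>\<Omega>)"

text \<open>The tangent inequality at the zero profile, where the received covariance is the identity, bounds \<open>log det\<close> by the
bounded gradient.\<close>

lemma log_det_integrable:
  assumes X: "\<And>k. psd_mat (M k) (X k)"
  shows "integrable \<Omega> (\<lambda>\<omega>. log_det (W_mat N P X (H 1 \<omega>)))"
proof -
  define Z :: "'u \<Rightarrow> complex mat" where "Z k = 0\<^sub>m (M k) (M k)" for k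
  have Z: "psd_mat (M k) (Z k)" for k by (simp add: Z_def psd_zero)
  have XZ: "X k - Z k = X k" for k
    using hermitian_carrier[OF psd_hermitian[OF X[of k]]] by (intro eq_matI) (auto simp: Z_def)
  define c where "c = (\<Sum>k\<in>UNIV. P k * (fnorm (M k) (X k) * (real (M k) * grad_bound)))"
  show ?thesis
  proof (rule integrable_const_bound[where B = c])
    show "AE \<omega> in \<Omega>. norm (log_det (W_mat N P X (H 1 \<omega>))) \<le> c"
      using grad_inst_bound AE_space
    proof eventually_elim
      fix \<omega> assume b: "\<forall>n\<ge>1. \<forall>X. (\<forall>k. psd_mat (M k) (X k)) \<longrightarrow>
         (\<forall>k. \<forall>i<M k. \<forall>j<M k. cmod (grad_inst N P k X (H n \<omega>) $$ (i, j)) \<le> grad_bound)" and \<omega>: "\<omega> \<in> space \<Omega>"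
      have h: "H 1 \<omega> k \<in> carrier_mat N (M k)" for k using \<omega> by (intro H_carrier) auto
      have nonneg: "0 \<le> log_det (W_mat N P X (H 1 \<omega>))"
        by (rule log_det_nonneg[OF signal_cov_ge_one[OF h X P_nonneg]])
      have W0: "W_mat N P Z (H 1 \<omega>) = 1\<^sub>m N"
      proof (rule eq_matI)
        fix i j assume "i < dim_row (1\<^sub>m N :: complex mat)" "j < dim_col (1\<^sub>m N :: complex mat)"
        hence ij: "i < N" "j < N" by auto
        have "(H 1 \<omega> k * Z k * mat_adjoint (H 1 \<omega> k)) $$ (i, j) = 0" for k
          using conj_entry[OF _ h ij, of "Z k" k] by (simp add: Z_def)
        thus "W_mat N P Z (H 1 \<omega>) $$ (i, j) = 1\<^sub>m N $$ (i, j)"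
          using ij by (simp add: signal_cov_entry del: index_mult_mat)
      qed (use signal_cov_carrier[of N P UNIV Z "H 1 \<omega>"] in auto)
      have "log_det (W_mat N P X (H 1 \<omega>)) \<le> log_det (W_mat N P Z (H 1 \<omega>)) +
          (\<Sum>k\<in>UNIV. P k * frob (M k) (X k - Z k) (grad_inst N P k Z (H 1 \<omega>)))"
        by (rule log_det_W_tangent[OF h Z X P_nonneg])
      also have "\<dots> = (\<Sum>k\<in>UNIV. P k * frob (M k) (X k) (grad_inst N P k Z (H 1 \<omega>)))"
        unfolding W0 XZ by (simp add: log_det_def)
      also have "\<dots> \<le> c" unfolding c_def
      proof (intro sum_mono mult_left_mono P_nonneg order_trans[OF frob_le_fnorm])
        fix k
        have "frob (M k) (grad_inst N P k Z (H 1 \<omega>)) (grad_inst N P k Z (H 1 \<omega>)) \<le> (real (M k) * grad_bound)\<^sup>2"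
          using b[rule_format, OF order_refl Z] by (intro frob_self_bound) auto
        thus "fnorm (M k) (grad_inst N P k Z (H 1 \<omega>)) \<le> real (M k) * grad_bound"
          using grad_bound_nonneg by (intro real_le_lsqrt) (auto simp: frob_self_nonneg)
      qed (simp add: frob_self_nonneg)
      finally show "norm (log_det (W_mat N P X (H 1 \<omega>))) \<le> c"
        using nonneg by simp
    qed
    show "(\<lambda>\<omega>. log_det (W_mat N P X (H 1 \<omega>))) \<in> borel_measurable \<Omega>"
      using X by (intro log_det_measurable[of _ N] mat_measurable_signal_cov[where X = "\<lambda>_. X" and M = M] mat_measurable_const
          H_measurable order_refl)
        (auto intro: hermitian_carrier psd_hermitian)
  qed
qed

lemma potential_tangent:
  assumes X: "\<And>k. psd_mat (M k) (X k)" and Y: "\<And>k. psd_mat (M k) (Y k)"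
  shows "potential Y \<le> potential X + (\<Sum>k\<in>UNIV. P k * frob (M k) (Y k - X k) (grad k X))"
proof -
  let ?g = "\<lambda>\<omega>. \<Sum>k\<in>UNIV. P k * frob (M k) (Y k - X k) (grad_inst N P k X (H 1 \<omega>))"
  have "potential Y \<le> (\<integral>\<omega>. log_det (W_mat N P X (H 1 \<omega>)) + ?g \<omega> \<partial>\<Omega>)"
    unfolding potential_def
    by (intro integral_mono log_det_integrable Bochner_Integration.integrable_add sum_frob_grad(1) X Y
        log_det_W_tangent H_carrier P_nonneg) auto
  also have "\<dots> = potential X + (\<Sum>k\<in>UNIV. P k * frob (M k) (Y k - X k) (grad k X))"
    unfolding potential_def sum_frob_grad(2)[OF X]
    by (intro Bochner_Integration.integral_add log_det_integrable sum_frob_grad(1) X)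
  finally show ?thesis .
qed

lemma potential_lipschitz:
  assumes X: "\<And>k. psd_mat (M k) (X k)" and Y: "\<And>k. psd_mat (M k) (Y k)"
  shows "potential Y - potential X \<le> (\<Sum>k\<in>UNIV. P k * (fnorm (M k) (Y k - X k) * (real (M k) * grad_bound)))"
proof -
  have "(\<Sum>k\<in>UNIV. P k * frob (M k) (Y k - X k) (grad k X)) \<le>
      (\<Sum>k\<in>UNIV. P k * (fnorm (M k) (Y k - X k) * (real (M k) * grad_bound)))"
    by (intro sum_mono mult_left_mono P_nonneg order_trans[OF frob_le_fnorm] grad_fnorm_bound X)
      (simp add: frob_self_nonneg)
  thus ?thesis using potential_tangent[OF X Y] by linarith
qed

text \<open>Along a segment the concave potential has a quadratic lower model with a constant independent of \<open>t\<close>, because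
the received covariances at the end points are at bounded distance.\<close>

lemma potential_lower:
  assumes X: "strategy_profile M X" and Y: "strategy_profile M Y"
  obtains K where "\<forall>t\<in>{0..1}.
     potential X + t * (\<Sum>k\<in>UNIV. P k * frob (M k) (Y k - X k) (grad k X)) - K * t\<^sup>2
       \<le> potential (\<lambda>k. X k + complex_of_real t \<cdot>\<^sub>m (Y k - X k))"
proof (rule that, rule ballI)
  let ?Z = "\<lambda>t k. X k + complex_of_real t \<cdot>\<^sub>m (Y k - X k)"
  let ?s = "real N * (\<Sum>k\<in>UNIV. P k * ((real (M k))\<^sup>2 * (channel_bound\<^sup>2 * 2)))"
  fix t :: real assume "t \<in> {0..1}"
  hence t: "0 \<le> t" "t \<le> 1" by auto
  note Xc = strategy_profileD(3)[OF X] and Yc = strategy_profileD(3)[OF Y]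
  note Xp = strategy_profileD(2)[OF X]
  have Z: "strategy_profile M (?Z t)" unfolding strategy_profile_def
    using action_set_convex[OF strategy_profileD(1)[OF X] strategy_profileD(1)[OF Y] t] by blast
  note Zp = strategy_profileD(2)[OF Z] and Zc = strategy_profileD(3)[OF Z]
  have D: "Y k - X k \<in> carrier_mat (M k) (M k)" for k by (rule minus_carrier_mat[OF Xc])
  have ZX: "?Z t k - X k = complex_of_real t \<cdot>\<^sub>m (Y k - X k)" for k
    using Xc[of k] Yc[of k] by (intro eq_matI) auto
  let ?g = "\<lambda>\<omega>. \<Sum>k\<in>UNIV. P k * frob (M k) (?Z t k - X k) (grad_inst N P k X (H 1 \<omega>))"
  have "potential X + (\<Sum>k\<in>UNIV. P k * frob (M k) (?Z t k - X k) (grad k X)) - (t * ?s)\<^sup>2 =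
     (\<integral>\<omega>. log_det (W_mat N P X (H 1 \<omega>)) + ?g \<omega> - (t * ?s)\<^sup>2 \<partial>\<Omega>)"
    unfolding potential_def sum_frob_grad(2)[OF Xp]
    using log_det_integrable[OF Xp] sum_frob_grad(1)[OF Xp]
    by (subst Bochner_Integration.integral_diff) (auto simp: prob_space Bochner_Integration.integral_add)
  also have "\<dots> \<le> potential (?Z t)" unfolding potential_def
  proof (rule integral_mono_AE)
    show "integrable \<Omega> (\<lambda>\<omega>. log_det (W_mat N P X (H 1 \<omega>)) + ?g \<omega> - (t * ?s)\<^sup>2)"
      using log_det_integrable[OF Xp] sum_frob_grad(1)[OF Xp]
      by (intro Bochner_Integration.integrable_diff Bochner_Integration.integrable_add) auto
    show "integrable \<Omega> (\<lambda>\<omega>. log_det (W_mat N P (?Z t) (H 1 \<omega>)))" by (rule log_det_integrable[OF Zp])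
    show "AE \<omega> in \<Omega>. log_det (W_mat N P X (H 1 \<omega>)) + ?g \<omega> - (t * ?s)\<^sup>2 \<le> log_det (W_mat N P (?Z t) (H 1 \<omega>))"
      using channel_bound AE_space
    proof eventually_elim
      fix \<omega> assume B: "\<forall>n\<ge>1. \<forall>k. \<forall>i<N. \<forall>j<M k. cmod (H n \<omega> k $$ (i, j)) \<le> channel_bound" and \<omega>: "\<omega> \<in> space \<Omega>"
      have h: "H 1 \<omega> k \<in> carrier_mat N (M k)" for k using \<omega> by (intro H_carrier) auto
      have ent: "cmod (?Z t k $$ (i, j) - X k $$ (i, j)) \<le> 2 * t" if "i < M k" "j < M k" for k i j
      proof -
        have "cmod (X k $$ (i, j)) \<le> 1" "cmod (Y k $$ (i, j)) \<le> 1"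
          using action_set_frob_le[OF strategy_profileD(1)[OF X]] action_set_frob_le[OF strategy_profileD(1)[OF Y]]
          by (auto intro!: frob_entry_bound[OF _ _ that])
        hence "cmod (Y k $$ (i, j) - X k $$ (i, j)) \<le> 2" using norm_triangle_ineq4[of "Y k $$ (i, j)" "X k $$ (i, j)"] by linarith
        moreover have "?Z t k $$ (i, j) - X k $$ (i, j) = complex_of_real t * (Y k $$ (i, j) - X k $$ (i, j))"
          using that Xc[of k] Yc[of k] by simp
        ultimately show ?thesis using t by (simp add: norm_mult mult.commute mult_left_mono)
      qed
      have "frob N (W_mat N P (?Z t) (H 1 \<omega>) - W_mat N P X (H 1 \<omega>)) (W_mat N P (?Z t) (H 1 \<omega>) - W_mat N P X (H 1 \<omega>))
        \<le> (real N * (\<Sum>k\<in>UNIV. P k * ((real (M k))\<^sup>2 * (channel_bound\<^sup>2 * (2 * t)))))\<^sup>2"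
        using B t by (intro W_diff_frob_bound[OF h Xc Zc P_nonneg] ent) auto
      also have "real N * (\<Sum>k\<in>UNIV. P k * ((real (M k))\<^sup>2 * (channel_bound\<^sup>2 * (2 * t)))) = t * ?s"
        by (simp add: sum_distrib_left mult_ac)
      finally have "frob N (W_mat N P (?Z t) (H 1 \<omega>) - W_mat N P X (H 1 \<omega>)) (W_mat N P (?Z t) (H 1 \<omega>) - W_mat N P X (H 1 \<omega>))
        \<le> (t * ?s)\<^sup>2" .
      moreover have "log_det (W_mat N P X (H 1 \<omega>)) + ?g \<omega> -
          frob N (W_mat N P (?Z t) (H 1 \<omega>) - W_mat N P X (H 1 \<omega>)) (W_mat N P (?Z t) (H 1 \<omega>) - W_mat N P X (H 1 \<omega>))
        \<le> log_det (W_mat N P (?Z t) (H 1 \<omega>))"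
        by (rule log_det_W_lower[OF h Xp Zp P_nonneg])
      ultimately show "log_det (W_mat N P X (H 1 \<omega>)) + ?g \<omega> - (t * ?s)\<^sup>2 \<le> log_det (W_mat N P (?Z t) (H 1 \<omega>))"
        by linarith
    qed
  qed
  finally have *: "potential X + (\<Sum>k\<in>UNIV. P k * frob (M k) (?Z t k - X k) (grad k X)) - (t * ?s)\<^sup>2 \<le> potential (?Z t)" .
  have e: "(\<Sum>k\<in>UNIV. P k * (t * frob (M k) (Y k - X k) (grad k X))) =
      t * (\<Sum>k\<in>UNIV. P k * frob (M k) (Y k - X k) (grad k X))"
    by (simp add: sum_distrib_left mult_ac)
  show "potential X + t * (\<Sum>k\<in>UNIV. P k * frob (M k) (Y k - X k) (grad k X)) - ?s\<^sup>2 * t\<^sup>2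
       \<le> potential (?Z t)"
    using * unfolding ZX frob_smult_left[OF D] e power_mult_distrib[of t ?s] mult.commute[of "?s\<^sup>2"] .
qed

text \<open>Deleting user \<open>k\<close> from the received covariance is the same as giving this user the zero covariance. So each
utility is the potential minus a term that the user's own choice does not affect.\<close>

theorem potential_maximizer_nash:
  assumes X: "strategy_profile M X" and max: "\<And>Z. strategy_profile M Z \<Longrightarrow> potential Z \<le> potential X"
  shows "nash_equilibrium \<Omega> N M P H X"
proof -
  have drop: "utility \<Omega> N P H k Y = potential Y - potential (Y(k := 0\<^sub>m (M k) (M k)))"
    if Y: "strategy_profile M Y" for k Y
  proof -
    let ?Y0 = "Y(k := 0\<^sub>m (M k) (M k))"
    have Y0: "psd_mat (M l) (?Y0 l)" for l
      by (cases "l = k") (simp_all add: psd_zero strategy_profileD(2)[OF Y])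
    have "signal_cov N P (UNIV - {k}) Y (H 1 \<omega>) = W_mat N P ?Y0 (H 1 \<omega>)" if "\<omega> \<in> space \<Omega>" for \<omega>
    proof (rule eq_matI)
      fix i j assume "i < dim_row (W_mat N P ?Y0 (H 1 \<omega>))" "j < dim_col (W_mat N P ?Y0 (H 1 \<omega>))"
      hence ij: "i < N" "j < N" using signal_cov_carrier[of N P UNIV ?Y0 "H 1 \<omega>"] by auto
      have h: "H 1 \<omega> k \<in> carrier_mat N (M k)" using that by (intro H_carrier) auto
      have 0: "(H 1 \<omega> k * 0\<^sub>m (M k) (M k) * mat_adjoint (H 1 \<omega> k)) $$ (i, j) = 0"
        using conj_entry[OF zero_carrier_mat h ij] by simp
      show "signal_cov N P (UNIV - {k}) Y (H 1 \<omega>) $$ (i, j) = W_mat N P ?Y0 (H 1 \<omega>) $$ (i, j)"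
        unfolding signal_cov_entry[OF ij] sum.remove[OF finite UNIV_I, of _ k]
        using 0 by (auto simp del: index_mult_mat intro!: sum.cong)
    qed (use signal_cov_carrier[of N P UNIV ?Y0 "H 1 \<omega>"] signal_cov_carrier[of N P "UNIV - {k}" Y "H 1 \<omega>"] in auto)
    hence "utility \<Omega> N P H k Y = (\<integral>\<omega>. log_det (W_mat N P Y (H 1 \<omega>)) - log_det (W_mat N P ?Y0 (H 1 \<omega>)) \<partial>\<Omega>)"
      unfolding utility_def by (intro Bochner_Integration.integral_cong) auto
    also have "\<dots> = potential Y - potential ?Y0" unfolding potential_def
      by (rule Bochner_Integration.integral_diff[OF log_det_integrable[OF strategy_profileD(2)[OF Y]]
            log_det_integrable[of ?Y0, OF Y0]])
    finally show ?thesis .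
  qed
  have "utility \<Omega> N P H k (X(k := Z)) \<le> utility \<Omega> N P H k X" if "Z \<in> action_set (M k)" for k Z
  proof -
    have XZ: "strategy_profile M (X(k := Z))" using X that by (auto simp: strategy_profile_def)
    show ?thesis unfolding drop[OF X] drop[OF XZ] using max[OF XZ] by simp
  qed
  thus ?thesis using X by (auto simp: nash_equilibrium_def strategy_profile_def)
qed

end

section \<open>The regularized potential and its maximizers\<close>

context channel_game
begin

text \<open>The power-weighted negative von Neumann entropy, introduced as a supremum of affine functions. This form makes
convexity and lower semicontinuity immediate.\<close>

definition neg_entropy :: "('u \<Rightarrow> complex mat) \<Rightarrow> real" where
  "neg_entropy X = (SUP Y\<in>{Y. \<forall>k. hermitian_mat (M k) (Y k)}. \<Sum>k\<in>UNIV. P k * gibbs_objective (M k) (X k) (Y k))"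

definition entropy_bound :: real where
  "entropy_bound = (\<Sum>k\<in>UNIV. P k * \<bar>log_trace_exp (0\<^sub>m (M k) (M k))\<bar>)"

lemma neg_entropy_ge:
  assumes X: "strategy_profile M X" and Y: "\<And>k. hermitian_mat (M k) (Y k)"
  shows "(\<Sum>k\<in>UNIV. P k * gibbs_objective (M k) (X k) (Y k)) \<le> neg_entropy X"
  unfolding neg_entropy_def
proof (rule cSUP_upper)
  show "bdd_above ((\<lambda>Y. \<Sum>k\<in>UNIV. P k * gibbs_objective (M k) (X k) (Y k)) ` {Y. \<forall>k. hermitian_mat (M k) (Y k)})"
    by (rule bdd_aboveI2[where M = 0])
      (auto intro!: sum_nonpos mult_nonneg_nonpos P_nonneg gibbs_objective_nonpos strategy_profileD(1)[OF X] M_pos)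
qed (use Y in auto)

lemma hermitian_zero: "hermitian_mat n (0\<^sub>m n n)"
  by (rule psd_hermitian[OF psd_zero])

lemma neg_entropy_le:
  assumes "\<And>Y. (\<And>k. hermitian_mat (M k) (Y k)) \<Longrightarrow> (\<Sum>k\<in>UNIV. P k * gibbs_objective (M k) (X k) (Y k)) \<le> c"
  shows "neg_entropy X \<le> c"
  unfolding neg_entropy_def
proof (rule cSUP_least)
  have "(\<lambda>k. 0\<^sub>m (M k) (M k)) \<in> {Y. \<forall>k. hermitian_mat (M k) (Y k)}" using hermitian_zero by blast
  thus "{Y. \<forall>k. hermitian_mat (M k) (Y k)} \<noteq> {}" by (metis empty_iff)
qed (use assms in blast)

lemma neg_entropy_abs_le:
  assumes X: "strategy_profile M X"
  shows "\<bar>neg_entropy X\<bar> \<le> entropy_bound"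
proof -
  have "neg_entropy X \<le> 0"
    by (rule neg_entropy_le) (auto intro!: sum_nonpos mult_nonneg_nonpos P_nonneg gibbs_objective_nonpos strategy_profileD(1)[OF X] M_pos)
  moreover have "- entropy_bound \<le> (\<Sum>k\<in>UNIV. P k * gibbs_objective (M k) (X k) (0\<^sub>m (M k) (M k)))"
    unfolding entropy_bound_def sum_negf[symmetric]
  proof (rule sum_mono)
    fix k
    have "frob (M k) (X k) (0\<^sub>m (M k) (M k)) = 0" by (simp add: frob_def)
    hence "- \<bar>log_trace_exp (0\<^sub>m (M k) (M k))\<bar> \<le> gibbs_objective (M k) (X k) (0\<^sub>m (M k) (M k))"
      by (simp add: gibbs_objective_def)
    thus "- (P k * \<bar>log_trace_exp (0\<^sub>m (M k) (M k))\<bar>) \<le> P k * gibbs_objective (M k) (X k) (0\<^sub>m (M k) (M k))"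
      using mult_left_mono[OF _ P_nonneg[of k]] by fastforce
  qed
  ultimately show ?thesis using neg_entropy_ge[OF X hermitian_zero] by linarith
qed

definition regularized :: "real \<Rightarrow> ('u \<Rightarrow> complex mat) \<Rightarrow> real" where
  "regularized \<tau> X = potential X - \<tau> * neg_entropy X"

lemma potential_tendsto:
  assumes X: "\<And>n. strategy_profile M (X n)" and L: "strategy_profile M L"
    and lim: "\<And>k. (\<lambda>n. frob (M k) (X n k - L k) (X n k - L k)) \<longlonglongrightarrow> 0"
  shows "(\<lambda>n. potential (X n)) \<longlonglongrightarrow> potential L"
proof -
  let ?b = "\<lambda>n. \<Sum>k\<in>UNIV. P k * (fnorm (M k) (X n k - L k) * (real (M k) * grad_bound))"
  have sym: "fnorm (M k) (L k - X n k) = fnorm (M k) (X n k - L k)" for n k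
    unfolding frob_self using strategy_profileD(3)[OF X[of n], of k] strategy_profileD(3)[OF L, of k]
    by (intro arg_cong[where f = sqrt] sum.cong refl) (simp add: norm_minus_commute)
  have "norm (potential (X n) - potential L) \<le> ?b n" for n
    unfolding real_norm_def
    using potential_lipschitz[OF strategy_profileD(2)[OF L] strategy_profileD(2)[OF X[of n]]]
      potential_lipschitz[OF strategy_profileD(2)[OF X[of n]] strategy_profileD(2)[OF L]] unfolding sym by linarith
  moreover have "?b \<longlonglongrightarrow> (\<Sum>k\<in>UNIV. P k * (sqrt 0 * (real (M k) * grad_bound)))"
    by (intro tendsto_sum tendsto_mult tendsto_const tendsto_real_sqrt lim)
  hence "?b \<longlonglongrightarrow> 0" by simp
  ultimately have "(\<lambda>n. potential (X n) - potential L) \<longlonglongrightarrow> 0"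
    by (rule Lim_null_comparison[OF always_eventually[OF allI]])
  thus ?thesis by (simp add: LIM_zero_iff)
qed

lemma objective_tendsto:
  assumes X: "\<And>n. strategy_profile M (X n)" and L: "strategy_profile M L"
    and lim: "\<And>k. (\<lambda>n. frob (M k) (X n k - L k) (X n k - L k)) \<longlonglongrightarrow> 0"
  shows "(\<lambda>n. \<Sum>k\<in>UNIV. P k * gibbs_objective (M k) (X n k) (Y k)) \<longlonglongrightarrow> (\<Sum>k\<in>UNIV. P k * gibbs_objective (M k) (L k) (Y k))"
proof (intro tendsto_sum tendsto_mult tendsto_const)
  fix k
  have "(\<lambda>n. fnorm (M k) (X n k - L k) * fnorm (M k) (Y k)) \<longlonglongrightarrow> sqrt 0 * fnorm (M k) (Y k)"
    by (intro tendsto_mult tendsto_const tendsto_real_sqrt lim)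
  hence lim0: "(\<lambda>n. fnorm (M k) (X n k - L k) * fnorm (M k) (Y k)) \<longlonglongrightarrow> 0" by simp
  have "norm (gibbs_objective (M k) (X n k) (Y k) - gibbs_objective (M k) (L k) (Y k)) \<le>
      fnorm (M k) (X n k - L k) * fnorm (M k) (Y k)" for n
    using frob_cauchy_schwarz[of "M k" "X n k - L k" "Y k"]
    by (simp add: gibbs_objective_def frob_diff_left[OF strategy_profileD(3)[OF X] strategy_profileD(3)[OF L]])
  hence "(\<lambda>n. gibbs_objective (M k) (X n k) (Y k) - gibbs_objective (M k) (L k) (Y k)) \<longlonglongrightarrow> 0"
    by (rule Lim_null_comparison[OF always_eventually[OF allI] lim0])
  thus "(\<lambda>n. gibbs_objective (M k) (X n k) (Y k)) \<longlonglongrightarrow> gibbs_objective (M k) (L k) (Y k)"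
    by (simp add: LIM_zero_iff)
qed

lemma strategy_profile_exists: "\<exists>X. strategy_profile M X"
proof -
  have "strategy_profile M (\<lambda>k. gibbs (0\<^sub>m (M k) (M k)))"
    unfolding strategy_profile_def by (intro allI gibbs_action_set hermitian_zero M_pos)
  thus ?thesis by blast
qed

text \<open>Lower semicontinuity of the negative entropy is enough. A maximizing sequence has a convergent subsequence, and for
each fixed \<open>Y\<close> the bound with the continuous affine function of \<open>Y\<close> in place of the entropy passes to the limit;
then take the supremum over \<open>Y\<close>.\<close>

theorem regularized_maximizer_exists:
  assumes \<tau>: "0 \<le> \<tau>"
  obtains X where "strategy_profile M X" "\<And>Z. strategy_profile M Z \<Longrightarrow> regularized \<tau> Z \<le> regularized \<tau> X"
proof -
  let ?S = "{X. strategy_profile M X}"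
  obtain X0 where X0: "strategy_profile M X0" using strategy_profile_exists by blast
  have bdd: "bdd_above (regularized \<tau> ` ?S)"
  proof (rule bdd_aboveI2)
    fix X assume "X \<in> ?S"
    hence X: "strategy_profile M X" by simp
    have "potential X \<le> potential X0 + (\<Sum>k\<in>UNIV. P k * (fnorm (M k) (X k - X0 k) * (real (M k) * grad_bound)))"
      using potential_lipschitz[OF strategy_profileD(2)[OF X0] strategy_profileD(2)[OF X]] by simp
    also have "\<dots> \<le> potential X0 + (\<Sum>k\<in>UNIV. P k * (2 * (real (M k) * grad_bound)))"
    proof (intro add_left_mono sum_mono mult_left_mono mult_right_mono P_nonneg)
      fix k
      have "fnorm (M k) (X k) \<le> 1" "fnorm (M k) (X0 k) \<le> 1"
        using action_set_frob_le[OF strategy_profileD(1)[OF X]] action_set_frob_le[OF strategy_profileD(1)[OF X0]] by auto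
      thus "fnorm (M k) (X k - X0 k) \<le> 2"
        using fnorm_diff_triangle[OF strategy_profileD(3)[OF X] strategy_profileD(3)[OF X0], of k] by linarith
    qed (use grad_bound_nonneg in auto)
    finally have "potential X \<le> potential X0 + (\<Sum>k\<in>UNIV. P k * (2 * (real (M k) * grad_bound)))" .
    moreover have "- (\<tau> * neg_entropy X) \<le> \<tau> * entropy_bound"
      using mult_left_mono[OF _ \<tau>, of "- neg_entropy X" entropy_bound] neg_entropy_abs_le[OF X] by simp
    ultimately show "regularized \<tau> X \<le> potential X0 + (\<Sum>k\<in>UNIV. P k * (2 * (real (M k) * grad_bound))) + \<tau> * entropy_bound"
      unfolding regularized_def by linarith
  qed
  define s where "s = (SUP X\<in>?S. regularized \<tau> X)"
  have "\<exists>X. strategy_profile M X \<and> s - 1 / real (Suc n) < regularized \<tau> X" for n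
    using less_cSUP_iff[OF _ bdd, of "s - 1 / real (Suc n)"] X0 unfolding s_def by fastforce
  then obtain X where X: "\<And>n. strategy_profile M (X n)" and Xs: "\<And>n. s - 1 / real (Suc n) < regularized \<tau> (X n)" by metis
  obtain r L where r: "strict_mono (r :: nat \<Rightarrow> nat)" and L: "strategy_profile M L"
    and lim': "\<forall>k. (\<lambda>n. frob (M k) (X (r n) k - L k) (X (r n) k - L k)) \<longlonglongrightarrow> 0"
    using strategy_profile_compact[of M X, OF X] .
  note lim = lim'[rule_format]
  have inv: "(\<lambda>n. s - 1 / real (Suc (r n))) \<longlonglongrightarrow> s - 0"
    using LIMSEQ_subseq_LIMSEQ[OF LIMSEQ_inverse_real_of_nat r]
    by (intro tendsto_diff tendsto_const) (simp add: o_def inverse_eq_divide)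
  have key: "s \<le> potential L - \<tau> * (\<Sum>k\<in>UNIV. P k * gibbs_objective (M k) (L k) (Y k))"
    if Y: "\<And>k. hermitian_mat (M k) (Y k)" for Y
  proof (rule LIMSEQ_le[OF inv[simplified]])
    show "(\<lambda>n. potential (X (r n)) - \<tau> * (\<Sum>k\<in>UNIV. P k * gibbs_objective (M k) (X (r n) k) (Y k))) \<longlonglongrightarrow>
      potential L - \<tau> * (\<Sum>k\<in>UNIV. P k * gibbs_objective (M k) (L k) (Y k))"
      by (intro tendsto_diff tendsto_mult tendsto_const potential_tendsto[OF X L lim] objective_tendsto[OF X L lim])
    have "s - 1 / real (Suc (r n)) \<le> potential (X (r n)) - \<tau> * (\<Sum>k\<in>UNIV. P k * gibbs_objective (M k) (X (r n) k) (Y k))" for n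
      using Xs[of "r n"] mult_left_mono[OF neg_entropy_ge[OF X Y] \<tau>, of "r n"] unfolding regularized_def by linarith
    thus "\<exists>N. \<forall>n\<ge>N. s - 1 / (1 + real (r n)) \<le> potential (X (r n)) - \<tau> * (\<Sum>k\<in>UNIV. P k * gibbs_objective (M k) (X (r n) k) (Y k))"
      by simp
  qed
  have "s \<le> regularized \<tau> L"
  proof (cases "\<tau> = 0")
    case True
    thus ?thesis using key[of "\<lambda>k. 0\<^sub>m (M k) (M k)"] hermitian_zero by (simp add: regularized_def)
  next
    case False
    hence \<tau>: "0 < \<tau>" using \<tau> by simp
    have "neg_entropy L \<le> (potential L - s) / \<tau>"
    proof (rule neg_entropy_le)
      fix Y assume Y: "\<And>k. hermitian_mat (M k) (Y k)"
      show "(\<Sum>k\<in>UNIV. P k * gibbs_objective (M k) (L k) (Y k)) \<le> (potential L - s) / \<tau>"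
        using key[of Y] Y \<tau> by (simp add: field_simps)
    qed
    thus ?thesis using \<tau> by (simp add: regularized_def field_simps)
  qed
  moreover have "regularized \<tau> Z \<le> s" if "strategy_profile M Z" for Z
    unfolding s_def using that by (intro cSUP_upper bdd) auto
  ultimately show ?thesis using that[OF L] order_trans by blast
qed

text \<open>Move from the maximizer \<open>p\<close> towards \<open>q\<close>, the Gibbs states of \<open>V(p) / \<tau>\<close>. The first-order gain of the potential is
\<open>v\<close> and the negative entropy is convex, so optimality gives \<open>v \<le> \<tau> (neg_entropy q - neg_entropy p)\<close>. Since \<open>q\<close> attains its supremum at
\<open>Y = V(p) / \<tau>\<close>, while \<open>neg_entropy p\<close> exceeds the objective of \<open>p\<close> there by a multiple of the squared distance
to \<open>q\<close>, that distance is 0.\<close>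

theorem regularized_maximizer_fixed_point:
  assumes \<tau>: "0 < \<tau>" and p: "strategy_profile M p"
    and max: "\<And>Z. strategy_profile M Z \<Longrightarrow> regularized \<tau> Z \<le> regularized \<tau> p"
  shows "p k = gibbs (complex_of_real (1 / \<tau>) \<cdot>\<^sub>m grad k p)"
proof -
  define Y where "Y k = complex_of_real (1 / \<tau>) \<cdot>\<^sub>m grad k p" for k
  note pp = strategy_profileD(2)[OF p] and pc = strategy_profileD(3)[OF p]
  have Y: "hermitian_mat (M k) (Y k)" for k unfolding Y_def by (intro hermitian_smult grad_hermitian pp)
  define q where "q k = gibbs (Y k)" for k
  have q: "strategy_profile M q" unfolding strategy_profile_def q_def by (intro allI gibbs_action_set Y M_pos)
  note qc = strategy_profileD(3)[OF q]
  define R where "R = (\<Sum>k\<in>UNIV. fnorm (M k) (Y k))"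
  have R: "fnorm (M k) (Y k) \<le> R" for k unfolding R_def by (intro member_le_sum) (auto simp: frob_self_nonneg)
  define c where "c = exp (- 2 * (R + 2)) / 4"
  have c0: "0 < c" by (simp add: c_def)
  define d where "d k = frob (M k) (p k - q k) (p k - q k)" for k
  define g where "g X = (\<Sum>k\<in>UNIV. P k * gibbs_objective (M k) (X k) (Y k))" for X
  have "\<exists>Z. hermitian_mat (M k) Z \<and> gibbs_objective (M k) (p k) (Y k) + c * d k \<le> gibbs_objective (M k) (p k) Z" for k
    using gibbs_objective_improve[OF strategy_profileD(1)[OF p] Y M_pos R] unfolding c_def d_def q_def by metis
  then obtain Z where Z: "\<And>k. hermitian_mat (M k) (Z k)"
    and Zp: "\<And>k. gibbs_objective (M k) (p k) (Y k) + c * d k \<le> gibbs_objective (M k) (p k) (Z k)" by metis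
  have "g p + c * (\<Sum>k\<in>UNIV. P k * d k) = (\<Sum>k\<in>UNIV. P k * (gibbs_objective (M k) (p k) (Y k) + c * d k))"
    by (simp add: g_def sum_distrib_left sum.distrib algebra_simps)
  also have "\<dots> \<le> (\<Sum>k\<in>UNIV. P k * gibbs_objective (M k) (p k) (Z k))"
    by (intro sum_mono mult_left_mono Zp P_nonneg)
  also have "\<dots> \<le> neg_entropy p" by (rule neg_entropy_ge[OF p Z])
  finally have entp: "g p + c * (\<Sum>k\<in>UNIV. P k * d k) \<le> neg_entropy p" .
  have entq: "neg_entropy q \<le> g q"
  proof (rule neg_entropy_le)
    fix Y' assume Y': "\<And>k. hermitian_mat (M k) (Y' k)"
    show "(\<Sum>k\<in>UNIV. P k * gibbs_objective (M k) (q k) (Y' k)) \<le> g q"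
      unfolding g_def q_def by (intro sum_mono mult_left_mono P_nonneg gibbs_objective_max Y Y' M_pos)
  qed
  define v where "v = (\<Sum>k\<in>UNIV. P k * frob (M k) (q k - p k) (grad k p))"
  have v: "v = \<tau> * (g q - g p)"
  proof -
    have "gibbs_objective (M k) (q k) (Y k) - gibbs_objective (M k) (p k) (Y k) = frob (M k) (q k - p k) (grad k p) / \<tau>" for k
      using frob_smult_right[OF grad_carrier, of k "q k - p k" "1 / \<tau>" p]
      by (simp add: gibbs_objective_def Y_def frob_diff_left[OF qc pc])
    hence fg: "frob (M k) (q k - p k) (grad k p) = \<tau> * (gibbs_objective (M k) (q k) (Y k) - gibbs_objective (M k) (p k) (Y k))" for k
      using \<tau> by simp
    show ?thesis unfolding v_def g_def fg by (simp add: sum_distrib_left sum_subtractf algebra_simps)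
  qed
  obtain K where K: "\<forall>t\<in>{0..1}. potential p + t * v - K * t\<^sup>2
      \<le> potential (\<lambda>k. p k + complex_of_real t \<cdot>\<^sub>m (q k - p k))"
    using potential_lower[OF p q] unfolding v_def .
  \<comment> \<open>Optimality of \<open>p\<close> against the point at time \<open>t\<close> on the segment, divided by \<open>t\<close>.\<close>
  have first_order: "v - \<tau> * (neg_entropy q - neg_entropy p) \<le> K * t" if t: "0 < t" "t \<le> 1" for t
  proof -
    let ?z = "\<lambda>k. p k + complex_of_real t \<cdot>\<^sub>m (q k - p k)"
    have z: "strategy_profile M ?z" unfolding strategy_profile_def
      using action_set_convex[OF strategy_profileD(1)[OF p] strategy_profileD(1)[OF q]] t by simp
    have "neg_entropy ?z \<le> (1 - t) * neg_entropy p + t * neg_entropy q"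
    proof (rule neg_entropy_le)
      fix Y' assume Y': "\<And>k. hermitian_mat (M k) (Y' k)"
      have "(\<Sum>k\<in>UNIV. P k * gibbs_objective (M k) (?z k) (Y' k)) =
        (1 - t) * (\<Sum>k\<in>UNIV. P k * gibbs_objective (M k) (p k) (Y' k)) + t * (\<Sum>k\<in>UNIV. P k * gibbs_objective (M k) (q k) (Y' k))"
        unfolding gibbs_objective_affine[OF pc qc] by (simp add: sum_distrib_left sum.distrib distrib_left mult.left_commute)
      also have "\<dots> \<le> (1 - t) * neg_entropy p + t * neg_entropy q"
        using t by (intro add_mono mult_left_mono neg_entropy_ge p q Y') auto
      finally show "(\<Sum>k\<in>UNIV. P k * gibbs_objective (M k) (?z k) (Y' k)) \<le> (1 - t) * neg_entropy p + t * neg_entropy q" .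
    qed
    hence "\<tau> * neg_entropy ?z \<le> \<tau> * ((1 - t) * neg_entropy p + t * neg_entropy q)" using \<tau> by (intro mult_left_mono) auto
    hence "t * (v - \<tau> * (neg_entropy q - neg_entropy p)) \<le> t * (K * t)"
      using max[OF z] bspec[OF K, of t] t unfolding regularized_def by (simp add: algebra_simps power2_eq_square)
    thus ?thesis using t by simp
  qed
  have "((\<lambda>t. K * t) \<longlongrightarrow> K * 0) (at_right 0)" by (intro tendsto_intros)
  moreover have "eventually (\<lambda>t. v - \<tau> * (neg_entropy q - neg_entropy p) \<le> K * t) (at_right 0)"
    using first_order by (intro eventually_at_rightI[of 0 1]) auto
  ultimately have "v - \<tau> * (neg_entropy q - neg_entropy p) \<le> K * 0"
    by (intro tendsto_lowerbound) auto
  hence "\<tau> * (g q - neg_entropy q + (neg_entropy p - g p)) \<le> 0" unfolding v by (simp add: algebra_simps)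
  hence "g q - neg_entropy q + (neg_entropy p - g p) \<le> 0" using \<tau> by (simp add: mult_le_0_iff)
  hence "c * (\<Sum>k\<in>UNIV. P k * d k) \<le> 0" using entp entq by linarith
  hence le0: "(\<Sum>k\<in>UNIV. P k * d k) \<le> 0" using c0 by (simp add: mult_le_0_iff)
  have "P k * d k \<le> (\<Sum>k\<in>UNIV. P k * d k)"
    by (intro member_le_sum) (auto simp: d_def P_nonneg frob_self_nonneg)
  hence "d k \<le> 0" using le0 P_pos[of k] by (smt (verit) mult_pos_pos)
  hence "p k = q k" unfolding d_def by (intro frob_diff_0_imp_eq[OF pc qc])
  thus ?thesis unfolding q_def Y_def .
qed

text \<open>Otherwise maximizers for parameters tending to 0 stay away from all equilibria. A limit point of them maximizes the
potential, because the entropies are uniformly bounded, so it is an equilibrium: a contradiction.\<close>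

theorem regularized_maximizers_approach_nash:
  assumes \<delta>: "0 < \<delta>"
  shows "\<exists>\<tau>0>0. \<forall>\<tau> X. 0 < \<tau> \<longrightarrow> \<tau> < \<tau>0 \<longrightarrow> strategy_profile M X \<longrightarrow>
     (\<forall>Z. strategy_profile M Z \<longrightarrow> regularized \<tau> Z \<le> regularized \<tau> X) \<longrightarrow>
     (\<exists>Xeq. nash_equilibrium \<Omega> N M P H Xeq \<and> profile_dist M X Xeq \<le> \<delta>)"
proof (rule ccontr)
  assume contra: "\<not> ?thesis"
  have "\<exists>\<tau> X. 0 < \<tau> \<and> \<tau> < 1 / real (Suc n) \<and> strategy_profile M X \<and>
     (\<forall>Z. strategy_profile M Z \<longrightarrow> regularized \<tau> Z \<le> regularized \<tau> X) \<and>
     (\<forall>Xeq. nash_equilibrium \<Omega> N M P H Xeq \<longrightarrow> \<delta> < profile_dist M X Xeq)" for n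
    using contra by (auto simp: not_le dest: spec[of _ "1 / real (Suc n)"])
  then obtain \<tau> X where \<tau>: "\<And>n. 0 < \<tau> n" "\<And>n. \<tau> n < 1 / real (Suc n)" and X: "\<And>n. strategy_profile M (X n)"
    and max: "\<And>n Z. strategy_profile M Z \<Longrightarrow> regularized (\<tau> n) Z \<le> regularized (\<tau> n) (X n)"
    and far: "\<And>n Xeq. nash_equilibrium \<Omega> N M P H Xeq \<Longrightarrow> \<delta> < profile_dist M (X n) Xeq"
    by metis
  obtain r L where r: "strict_mono (r :: nat \<Rightarrow> nat)" and L: "strategy_profile M L"
    and lim': "\<forall>k. (\<lambda>n. frob (M k) (X (r n) k - L k) (X (r n) k - L k)) \<longlonglongrightarrow> 0"
    using strategy_profile_compact[of M X, OF X] .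
  note lim = lim'[rule_format]
  have "\<tau> \<longlonglongrightarrow> 0"
    by (rule tendsto_sandwich[OF _ _ tendsto_const LIMSEQ_inverse_real_of_nat])
      (use \<tau> in \<open>auto simp: inverse_eq_divide less_imp_le\<close>)
  hence \<tau>lim: "(\<lambda>n. \<tau> (r n)) \<longlonglongrightarrow> 0" using LIMSEQ_subseq_LIMSEQ[OF _ r] by (simp add: o_def)
  have "nash_equilibrium \<Omega> N M P H L"
  proof (rule potential_maximizer_nash[OF L])
    fix Z assume Z: "strategy_profile M Z"
    have "potential Z - \<tau> (r n) * (2 * entropy_bound) \<le> potential (X (r n))" for n
    proof -
      have "neg_entropy Z - neg_entropy (X (r n)) \<le> 2 * entropy_bound"
        using neg_entropy_abs_le[OF Z] neg_entropy_abs_le[OF X, of "r n"] by linarith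
      hence "\<tau> (r n) * (neg_entropy Z - neg_entropy (X (r n))) \<le> \<tau> (r n) * (2 * entropy_bound)"
        using \<tau>(1)[of "r n"] by (intro mult_left_mono) auto
      thus ?thesis using max[OF Z, of "r n"] unfolding regularized_def by (simp add: algebra_simps)
    qed
    moreover have "(\<lambda>n. potential Z - \<tau> (r n) * (2 * entropy_bound)) \<longlonglongrightarrow> potential Z - 0 * (2 * entropy_bound)"
      by (intro tendsto_intros \<tau>lim)
    ultimately show "potential Z \<le> potential L"
      using LIMSEQ_le[OF _ potential_tendsto[of "\<lambda>n. X (r n)" L, OF X L lim]] by fastforce
  qed
  moreover have "(\<lambda>n. profile_dist M (X (r n)) L) \<longlonglongrightarrow> 0"
  proof -
    have "(\<lambda>n. sqrt (\<Sum>k\<in>UNIV. frob (M k) (X (r n) k - L k) (X (r n) k - L k))) \<longlonglongrightarrow> sqrt (\<Sum>k\<in>(UNIV :: 'u set). 0)"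
      by (intro tendsto_real_sqrt tendsto_sum lim)
    thus ?thesis by (simp add: profile_dist_frob[OF strategy_profileD(3)[OF X] strategy_profileD(3)[OF L]])
  qed
  hence "eventually (\<lambda>n. profile_dist M (X (r n)) L < \<delta>) sequentially" using \<delta> by (rule order_tendstoD)
  then obtain n where "profile_dist M (X (r n)) L < \<delta>" by (auto simp: eventually_sequentially)
  ultimately show False using far[of L "r n"] by simp
qed

end

section \<open>The matrix logarithm\<close>

text \<open>The Mercator series, which converges to the logarithm for eigenvalues in \<open>(0, 1]\<close>; as a series of polynomials in \<open>X\<close>
it is measurable in \<open>X\<close>. The term with \<open>r = 0\<close> vanishes, since division by zero gives zero.\<close>

definition mat_log :: "nat \<Rightarrow> complex mat \<Rightarrow> complex mat" where
  "mat_log n X = mat n n (\<lambda>(i, j). \<Sum>r. - (((1\<^sub>m n - X) ^\<^sub>m r) $$ (i, j)) / of_nat r)"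

lemma mat_log_spec:
  assumes U: "unitary_mat n U" and x: "\<And>l. l < n \<Longrightarrow> 0 < x l \<and> x l \<le> 1"
  shows "mat_log n (spec_mat n U x) = spec_mat n U (\<lambda>l. ln (x l))"
proof (rule eq_matI)
  note Uc = unitary_carrier[OF U]
  fix i j assume "i < dim_row (spec_mat n U (\<lambda>l. ln (x l)))" "j < dim_col (spec_mat n U (\<lambda>l. ln (x l)))"
  hence ij: "i < n" "j < n" using spec_mat_carrier[OF Uc, of "\<lambda>l. ln (x l)"] by auto
  have "- (((1\<^sub>m n - spec_mat n U x) ^\<^sub>m r) $$ (i, j)) / of_nat r =
      spec_mat n U (\<lambda>l. - ((- (x l - 1)) ^ r) / of_nat r) $$ (i, j)" for r
    unfolding spec_mat_one[OF U, symmetric] spec_mat_diff[OF Uc] spec_mat_pow[OF U]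
    by (simp add: spec_mat_entry[OF Uc ij] sum_divide_distrib sum_negf[symmetric])
  moreover have "(\<lambda>r. spec_mat n U (\<lambda>l. - ((- (x l - 1)) ^ r) / of_nat r) $$ (i, j)) sums
      spec_mat n U (\<lambda>l. ln (x l)) $$ (i, j)"
  proof (rule spec_mat_sums[OF Uc _ ij])
    fix l assume "l < n"
    hence "\<bar>x l - 1\<bar> < 1" using x[of l] by auto
    from ln_series'[OF this] show "(\<lambda>r. - ((- (x l - 1)) ^ r) / of_nat r) sums ln (x l)" by simp
  qed
  ultimately have "(\<lambda>r. - (((1\<^sub>m n - spec_mat n U x) ^\<^sub>m r) $$ (i, j)) / of_nat r) sums spec_mat n U (\<lambda>l. ln (x l)) $$ (i, j)"
    by simp
  thus "mat_log n (spec_mat n U x) $$ (i, j) = spec_mat n U (\<lambda>l. ln (x l)) $$ (i, j)"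
    using ij by (simp add: mat_log_def sums_iff)
qed (use spec_mat_carrier[OF unitary_carrier[OF U], of "\<lambda>l. ln (x l)"] in \<open>auto simp: mat_log_def\<close>)

text \<open>The logarithm of a Gibbs state is \<open>Y\<close> minus \<open>log_trace_exp Y\<close> times the identity, and the identity pairs to the trace
of \<open>p\<close>, which is one. So the objective depends on \<open>Y\<close> only through its Gibbs state.\<close>

lemma gibbs_objective_mat_log:
  assumes p: "p \<in> action_set n" and Y: "hermitian_mat n Y" and n: "0 < n"
  shows "gibbs_objective n p Y = frob n p (mat_log n (gibbs Y))"
proof -
  obtain U y where U: "unitary_mat n U" and Yd: "Y = spec_mat n U y" using hermitian_spectral[OF Y] .
  note Uc = unitary_carrier[OF U]
  obtain V q where V: "unitary_mat n V" and pd: "p = spec_mat n V q" and q: "(\<Sum>l<n. q l) = 1"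
    using action_set_spec[OF p] by metis
  define Z where "Z = (\<Sum>l<n. exp (y l))"
  have Z: "0 < Z" unfolding Z_def using n by (auto intro!: sum_pos)
  have x: "0 < exp (y l) / Z \<and> exp (y l) / Z \<le> 1" if "l < n" for l
    using member_le_sum[of l "{..<n}" "\<lambda>l. exp (y l)"] that Z unfolding Z_def by simp
  have one: "frob n p (1\<^sub>m n) = 1"
    unfolding pd spec_mat_one[OF V, symmetric] frob_spec_same[OF V] using q by simp
  have log: "mat_log n (gibbs Y) = spec_mat n U (\<lambda>l. y l - ln Z * 1)"
  proof -
    have "mat_log n (spec_mat n U (\<lambda>l. exp (y l) / Z)) = spec_mat n U (\<lambda>l. ln (exp (y l) / Z))"
      by (rule mat_log_spec[OF U x])
    thus ?thesis unfolding Yd spec_gibbs[OF U] Z_def[symmetric] using Z by (simp add: ln_div)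
  qed
  have "frob n p (mat_log n (gibbs Y)) = frob n p Y - ln Z * frob n p (1\<^sub>m n)"
    unfolding log spec_mat_diff[OF Uc, symmetric] spec_mat_smult[OF Uc, symmetric] spec_mat_one[OF U]
    by (subst frob_diff_right) (auto simp: Yd spec_mat_carrier[OF Uc] frob_smult_right)
  thus ?thesis unfolding one by (simp add: gibbs_objective_def Yd spec_log_trace_exp[OF U] Z_def)
qed

lemma mat_measurable_log:
  assumes X: "mat_measurable F n n X"
  shows "mat_measurable F n n (\<lambda>\<omega>. mat_log n (X \<omega>))"
proof (rule mat_measurableI[where f = "\<lambda>i j \<omega>. \<Sum>r. - (((1\<^sub>m n - X \<omega>) ^\<^sub>m r) $$ (i, j)) / of_nat r"])
  have pow: "mat_measurable F n n (\<lambda>\<omega>. (1\<^sub>m n - X \<omega>) ^\<^sub>m r)" for r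
    by (intro mat_measurable_pow mat_measurable_diff mat_measurable_const X) simp
  show "(\<lambda>\<omega>. \<Sum>r. - (((1\<^sub>m n - X \<omega>) ^\<^sub>m r) $$ (i, j)) / of_nat r) \<in> borel_measurable F" if "i < n" "j < n" for i j
    by (intro borel_measurable_suminf borel_measurable_divide borel_measurable_uminus borel_measurable_const
        mat_measurable_entry[OF pow that])
qed (auto simp: mat_log_def)

section \<open>The Lyapunov function\<close>

context channel_game
begin

text \<open>The Bregman divergence of \<open>log_trace_exp\<close> from the rest scores \<open>Ys\<close> to \<open>Y\<close>, summed over the users with weights \<open>P\<close>. With
these weights the individual gradients add up to the gradient of the potential.\<close>

definition lyapunov :: "('u \<Rightarrow> complex mat) \<Rightarrow> ('u \<Rightarrow> complex mat) \<Rightarrow> real" where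
  "lyapunov Ys Y = (\<Sum>k\<in>UNIV. P k * (gibbs_objective (M k) (gibbs (Ys k)) (Ys k) - gibbs_objective (M k) (gibbs (Ys k)) (Y k)))"

lemma lyapunov_nonneg:
  assumes "\<And>k. hermitian_mat (M k) (Ys k)" "\<And>k. hermitian_mat (M k) (Y k)"
  shows "0 \<le> lyapunov Ys Y"
  unfolding lyapunov_def using gibbs_objective_max[OF assms M_pos]
  by (intro sum_nonneg mult_nonneg_nonneg P_nonneg) simp

text \<open>The right-hand side is the symmetrized divergence, that is, the left-hand side plus the divergence in the reverse direction.\<close>

lemma lyapunov_le_pairing:
  assumes Ys: "\<And>k. hermitian_mat (M k) (Ys k)" and Y: "\<And>k. hermitian_mat (M k) (Y k)"
  shows "lyapunov Ys Y \<le> (\<Sum>k\<in>UNIV. P k * frob (M k) (gibbs (Y k) - gibbs (Ys k)) (Y k - Ys k))"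
  unfolding lyapunov_def
proof (intro sum_mono mult_left_mono P_nonneg)
  fix k
  note c = hermitian_carrier[OF Ys[of k]] hermitian_carrier[OF Y[of k]]
    action_set_carrier[OF gibbs_action_set[OF Ys M_pos], of k] action_set_carrier[OF gibbs_action_set[OF Y M_pos], of k]
  have "frob (M k) (gibbs (Y k) - gibbs (Ys k)) (Y k - Ys k) =
    frob (M k) (gibbs (Y k)) (Y k) - frob (M k) (gibbs (Y k)) (Ys k)
      - frob (M k) (gibbs (Ys k)) (Y k) + frob (M k) (gibbs (Ys k)) (Ys k)"
    by (simp add: frob_diff_left[OF c(4,3)] frob_diff_right[OF c(2,1)])
  thus "gibbs_objective (M k) (gibbs (Ys k)) (Ys k) - gibbs_objective (M k) (gibbs (Ys k)) (Y k)
      \<le> frob (M k) (gibbs (Y k) - gibbs (Ys k)) (Y k - Ys k)"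
    using gibbs_objective_max[OF Y[of k] Ys[of k] M_pos] by (simp add: gibbs_objective_def)
qed

text \<open>At \<open>Ys\<close> the objective of the rest state is maximal, so the improvement that is possible at \<open>Y\<close> bounds the gap.\<close>

lemma lyapunov_ge_dist:
  assumes Ys: "\<And>k. hermitian_mat (M k) (Ys k)" and Y: "\<And>k. hermitian_mat (M k) (Y k)"
    and R: "\<And>k. fnorm (M k) (Y k) \<le> R"
  shows "P k * (exp (- 2 * (R + 2)) / 4 * frob (M k) (gibbs (Y k) - gibbs (Ys k)) (gibbs (Y k) - gibbs (Ys k))) \<le> lyapunov Ys Y"
proof -
  let ?d = "\<lambda>k. frob (M k) (gibbs (Ys k) - gibbs (Y k)) (gibbs (Ys k) - gibbs (Y k))"
  let ?g = "\<lambda>k. gibbs_objective (M k) (gibbs (Ys k)) (Ys k) - gibbs_objective (M k) (gibbs (Ys k)) (Y k)"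
  have le: "exp (- 2 * (R + 2)) / 4 * ?d k \<le> ?g k" for k
  proof -
    obtain Z where Z: "hermitian_mat (M k) Z"
      "gibbs_objective (M k) (gibbs (Ys k)) (Y k) + exp (- 2 * (R + 2)) / 4 * ?d k \<le> gibbs_objective (M k) (gibbs (Ys k)) Z"
      using gibbs_objective_improve[OF gibbs_action_set[OF Ys M_pos] Y M_pos R] .
    thus ?thesis using gibbs_objective_max[OF Ys Z(1) M_pos] by linarith
  qed
  have "P k * (exp (- 2 * (R + 2)) / 4 * ?d k) \<le> P k * ?g k" by (intro mult_left_mono le P_nonneg)
  also have "\<dots> \<le> lyapunov Ys Y" unfolding lyapunov_def
    using gibbs_objective_max[OF Ys Y M_pos] by (intro member_le_sum mult_nonneg_nonneg P_nonneg) auto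
  finally show ?thesis
    using frob_diff_swap[OF action_set_carrier[OF gibbs_action_set[OF Ys M_pos]] action_set_carrier[OF gibbs_action_set[OF Y M_pos]], of k]
    by simp
qed

text \<open>Smoothness of \<open>log_trace_exp\<close> leaves the pairing of \<open>X - p\<close> with the increment, and the increment is the sum of the
gradient error, the difference \<open>V(X) - V(p)\<close> and \<open>-\<tau>\<close> times \<open>Y - Ys\<close>, because \<open>V(p) = \<tau> Ys\<close> by
the fixed-point equation.\<close>

lemma lyapunov_step:
  assumes \<tau>: "0 < \<tau>" and Ys: "\<And>k. hermitian_mat (M k) (Ys k)" and Y: "\<And>k. hermitian_mat (M k) (Y k)"
    and fp: "\<And>k. grad k (\<lambda>k. gibbs (Ys k)) = complex_of_real \<tau> \<cdot>\<^sub>m Ys k"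
    and V: "\<And>k. hermitian_mat (M k) (V k)" and Vb: "\<And>k. fnorm (M k) (V k) \<le> G"
    and R: "\<And>k. fnorm (M k) (Y k) \<le> R" "\<And>k. fnorm (M k) (Y k + complex_of_real \<gamma> \<cdot>\<^sub>m (V k - complex_of_real \<tau> \<cdot>\<^sub>m Y k)) \<le> R"
    and \<gamma>: "0 \<le> \<gamma>"
  shows "lyapunov Ys (\<lambda>k. Y k + complex_of_real \<gamma> \<cdot>\<^sub>m (V k - complex_of_real \<tau> \<cdot>\<^sub>m Y k)) \<le>
    (1 - \<tau> * \<gamma>) * lyapunov Ys Y
    + \<gamma> * (\<Sum>k\<in>UNIV. P k * frob (M k) (gibbs (Y k) - gibbs (Ys k)) (V k - grad k (\<lambda>k. gibbs (Y k))))
    + (\<Sum>k\<in>UNIV. P k * (exp (2 * R) * (G + \<tau> * R)\<^sup>2)) * \<gamma>\<^sup>2"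
proof -
  define X where "X k = gibbs (Y k)" for k
  define p where "p k = gibbs (Ys k)" for k
  define Z where "Z k = V k - complex_of_real \<tau> \<cdot>\<^sub>m Y k" for k
  define c where "c = exp (2 * R) * (G + \<tau> * R)\<^sup>2"
  have X: "strategy_profile M X" unfolding strategy_profile_def X_def by (intro allI gibbs_action_set Y M_pos)
  have p: "strategy_profile M p" unfolding strategy_profile_def p_def by (intro allI gibbs_action_set Ys M_pos)
  note Xc = strategy_profileD(3)[OF X] and pc = strategy_profileD(3)[OF p]
  note Yc = hermitian_carrier[OF Y] and Ysc = hermitian_carrier[OF Ys] and Vc = hermitian_carrier[OF V]
  have Zh: "hermitian_mat (M k) (Z k)" for k unfolding Z_def by (intro hermitian_diff hermitian_smult V Y)
  note Zc = hermitian_carrier[OF Zh]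
  have R0: "0 \<le> R" using R(1)[of undefined] by (rule order_trans[rotated]) (simp add: frob_self_nonneg)
  have Zn: "frob (M k) (Z k) (Z k) \<le> (G + \<tau> * R)\<^sup>2" for k
  proof -
    have "fnorm (M k) (Z k) \<le> fnorm (M k) (V k) + \<tau> * fnorm (M k) (Y k)"
      unfolding Z_def using fnorm_diff_triangle[OF Vc[of k] smult_carrier_mat[OF Yc[of k], of "complex_of_real \<tau>"]]
        fnorm_smult[OF Yc[of k], of \<tau>] \<tau> by simp
    also have "\<dots> \<le> G + \<tau> * R" using Vb[of k] R(1)[of k] \<tau> by (intro add_mono mult_left_mono) auto
    finally show ?thesis by (rule sqrt_le_D)
  qed
  have Yn: "frob (M k) (Y k) (Y k) \<le> R\<^sup>2" for k using R(1)[of k] by (rule sqrt_le_D)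
  have Yn': "frob (M k) (Y k + complex_of_real \<gamma> \<cdot>\<^sub>m Z k) (Y k + complex_of_real \<gamma> \<cdot>\<^sub>m Z k) \<le> R\<^sup>2" for k
    using R(2)[of k] unfolding Z_def by (rule sqrt_le_D)
  have diff: "Y k + complex_of_real \<gamma> \<cdot>\<^sub>m Z k - Y k = complex_of_real \<gamma> \<cdot>\<^sub>m Z k" for k
    using Yc[of k] Zc[of k] by (intro eq_matI) auto
  have obj: "gibbs_objective (M k) (p k) (Y k) - \<gamma> * frob (M k) (X k - p k) (Z k) - c * \<gamma>\<^sup>2
      \<le> gibbs_objective (M k) (p k) (Y k + complex_of_real \<gamma> \<cdot>\<^sub>m Z k)" for k
  proof -
    have "log_trace_exp (Y k + complex_of_real \<gamma> \<cdot>\<^sub>m Z k) \<le> log_trace_exp (Y k) + \<gamma> * frob (M k) (X k) (Z k)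
        + exp (2 * R) * (\<gamma> * (\<gamma> * frob (M k) (Z k) (Z k)))"
      using log_trace_exp_smooth[OF Y hermitian_lincomb[OF Y Zh] M_pos Yn Yn' R0] unfolding diff X_def
      by (simp add: frob_smult_left[OF Zc] frob_smult_right[OF Zc])
    moreover have "exp (2 * R) * (\<gamma> * (\<gamma> * frob (M k) (Z k) (Z k))) \<le> c * \<gamma>\<^sup>2"
    proof -
      have "\<gamma>\<^sup>2 * (exp (2 * R) * frob (M k) (Z k) (Z k)) \<le> \<gamma>\<^sup>2 * c"
        unfolding c_def by (intro mult_left_mono Zn) auto
      thus ?thesis by (simp add: power2_eq_square mult_ac)
    qed
    moreover have "frob (M k) (p k) (Y k + complex_of_real \<gamma> \<cdot>\<^sub>m Z k) = frob (M k) (p k) (Y k) + \<gamma> * frob (M k) (p k) (Z k)"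
      by (simp add: frob_add_right[OF Yc smult_carrier_mat[OF Zc]] frob_smult_right[OF Zc])
    moreover have "frob (M k) (X k - p k) (Z k) = frob (M k) (X k) (Z k) - frob (M k) (p k) (Z k)"
      by (rule frob_diff_left[OF Xc pc])
    ultimately show ?thesis unfolding gibbs_objective_def by (simp add: right_diff_distrib)
  qed
  have "lyapunov Ys (\<lambda>k. Y k + complex_of_real \<gamma> \<cdot>\<^sub>m Z k) \<le>
    (\<Sum>k\<in>UNIV. P k * (gibbs_objective (M k) (p k) (Ys k) -
       (gibbs_objective (M k) (p k) (Y k) - \<gamma> * frob (M k) (X k - p k) (Z k) - c * \<gamma>\<^sup>2)))"
    unfolding lyapunov_def p_def[symmetric] by (intro sum_mono mult_left_mono diff_left_mono obj P_nonneg)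
  also have "\<dots> = lyapunov Ys Y + \<gamma> * (\<Sum>k\<in>UNIV. P k * frob (M k) (X k - p k) (Z k)) + (\<Sum>k\<in>UNIV. P k * c) * \<gamma>\<^sup>2"
    unfolding lyapunov_def p_def[symmetric] sum_distrib_left sum_distrib_right sum.distrib[symmetric]
    by (intro sum.cong refl) (simp add: algebra_simps)
  also have "(\<Sum>k\<in>UNIV. P k * frob (M k) (X k - p k) (Z k)) \<le>
     (\<Sum>k\<in>UNIV. P k * frob (M k) (X k - p k) (V k - grad k X)) - \<tau> * lyapunov Ys Y"
  proof -
    have split: "frob (M k) (X k - p k) (Z k) = frob (M k) (X k - p k) (V k - grad k X)
       + frob (M k) (X k - p k) (grad k X - grad k p) - \<tau> * frob (M k) (X k - p k) (Y k - Ys k)" for k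
    proof -
      have g: "grad k p = complex_of_real \<tau> \<cdot>\<^sub>m Ys k" unfolding p_def by (rule fp)
      have "frob (M k) (X k - p k) (grad k p) = \<tau> * frob (M k) (X k - p k) (Ys k)"
        unfolding g by (rule frob_smult_right[OF Ysc])
      thus ?thesis unfolding Z_def
        by (simp add: frob_diff_right[OF Vc grad_carrier] frob_diff_right[OF grad_carrier grad_carrier]
            frob_diff_right[OF Yc Ysc] frob_diff_right[OF Vc smult_carrier_mat[OF Yc]] frob_smult_right[OF Yc] right_diff_distrib)
    qed
    have "(\<Sum>k\<in>UNIV. P k * frob (M k) (X k - p k) (Z k)) =
       (\<Sum>k\<in>UNIV. P k * frob (M k) (X k - p k) (V k - grad k X))
       + (\<Sum>k\<in>UNIV. P k * frob (M k) (X k - p k) (grad k X - grad k p))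
       - \<tau> * (\<Sum>k\<in>UNIV. P k * frob (M k) (X k - p k) (Y k - Ys k))"
      unfolding split by (simp add: sum_distrib_left sum.distrib sum_subtractf algebra_simps)
    moreover have "(\<Sum>k\<in>UNIV. P k * frob (M k) (X k - p k) (grad k X - grad k p)) \<le> 0"
      by (rule grad_monotone[OF strategy_profileD(2)[OF p] strategy_profileD(2)[OF X]])
    moreover have "\<tau> * lyapunov Ys Y \<le> \<tau> * (\<Sum>k\<in>UNIV. P k * frob (M k) (X k - p k) (Y k - Ys k))"
      using lyapunov_le_pairing[OF Ys Y] \<tau> unfolding X_def p_def by (intro mult_left_mono) auto
    ultimately show ?thesis by linarith
  qed
  finally have "lyapunov Ys (\<lambda>k. Y k + complex_of_real \<gamma> \<cdot>\<^sub>m Z k) \<le> lyapunov Ys Y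
      + \<gamma> * ((\<Sum>k\<in>UNIV. P k * frob (M k) (X k - p k) (V k - grad k X)) - \<tau> * lyapunov Ys Y) + (\<Sum>k\<in>UNIV. P k * c) * \<gamma>\<^sup>2"
    using \<gamma> by (simp add: mult_left_mono)
  also have "\<dots> = (1 - \<tau> * \<gamma>) * lyapunov Ys Y + \<gamma> * (\<Sum>k\<in>UNIV. P k * frob (M k) (X k - p k) (V k - grad k X))
     + (\<Sum>k\<in>UNIV. P k * c) * \<gamma>\<^sup>2" by (simp add: algebra_simps)
  finally show ?thesis unfolding X_def p_def Z_def c_def .
qed

end

section \<open>Runs of the learning scheme\<close>

locale learning_run = channel_game \<Omega> N M P H
  for \<Omega> :: "'w measure" and N M and P :: "'u::finite \<Rightarrow> real" and H +
  fixes \<tau> :: real and \<gamma> :: "nat \<Rightarrow> real" and Y1 :: "'u \<Rightarrow> complex mat"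
    and Y X :: "nat \<Rightarrow> 'w \<Rightarrow> 'u \<Rightarrow> complex mat"
  assumes \<tau>_pos: "0 < \<tau>" and \<gamma>_pos: "\<And>n. 1 \<le> n \<Longrightarrow> 0 < \<gamma> n"
    and \<gamma>_sq: "summable (\<lambda>n. (\<gamma> (n + 1))\<^sup>2)"
    and \<gamma>_div: "filterlim (\<lambda>n. \<Sum>m=1..n. \<gamma> m) at_top sequentially"
    and Y1: "\<And>k. hermitian_mat (M k) (Y1 k)"
    and iterates: "learning_iterates \<Omega> N P H \<tau> \<gamma> Y1 Y X"
    and unbiased: "unbiased_gradients \<Omega> N M P H X"
begin

text \<open>The observed gradient, an unbiased estimate of the expected gradient at the current profile.\<close>

definition V :: "nat \<Rightarrow> 'w \<Rightarrow> 'u \<Rightarrow> complex mat" where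
  "V n \<omega> k = grad_inst N P k (X n \<omega>) (H n \<omega>)"

lemma Y_1: "\<omega> \<in> space \<Omega> \<Longrightarrow> Y 1 \<omega> k = Y1 k"
  and X_eq: "\<omega> \<in> space \<Omega> \<Longrightarrow> 1 \<le> n \<Longrightarrow> X n \<omega> k = gibbs (Y n \<omega> k)"
  and Y_Suc: "\<omega> \<in> space \<Omega> \<Longrightarrow> 1 \<le> n \<Longrightarrow> Y (Suc n) \<omega> k =
     Y n \<omega> k + complex_of_real (\<gamma> n) \<cdot>\<^sub>m (V n \<omega> k - complex_of_real \<tau> \<cdot>\<^sub>m Y n \<omega> k)"
  using iterates by (auto simp: learning_iterates_def V_def)

lemma Y_hermitian:
  assumes "\<omega> \<in> space \<Omega>" "1 \<le> n"
  shows "hermitian_mat (M k) (Y n \<omega> k)"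
  using assms(2)
proof (induction n arbitrary: k rule: dec_induct)
  case base
  show ?case unfolding Y_1[OF assms(1)] by (rule Y1)
next
  case (step n)
  have "psd_mat (M k) (X n \<omega> k)" for k
    using gibbs_action_set[OF step.IH M_pos] X_eq[OF assms(1) step.hyps(1)] by (simp add: action_set_def)
  hence "hermitian_mat (M k) (V n \<omega> k)" unfolding V_def
    by (intro grad_inst_hermitian H_carrier assms step.hyps P_nonneg)
  thus ?case unfolding Y_Suc[OF assms(1) step.hyps(1)]
    by (intro hermitian_lincomb hermitian_diff hermitian_smult step.IH)
qed

lemma X_strategy:
  assumes "\<omega> \<in> space \<Omega>" "1 \<le> n"
  shows "strategy_profile M (X n \<omega>)"
  unfolding strategy_profile_def X_eq[OF assms] by (intro allI gibbs_action_set Y_hermitian assms M_pos)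

lemma V_hermitian:
  assumes "\<omega> \<in> space \<Omega>" "1 \<le> n"
  shows "hermitian_mat (M k) (V n \<omega> k)"
  unfolding V_def by (intro grad_inst_hermitian H_carrier assms P_nonneg strategy_profileD(2)[OF X_strategy])

lemma X_measurable_if:
  assumes "\<And>k. mat_measurable \<Omega> (M k) (M k) (\<lambda>\<omega>. Y n \<omega> k)" "1 \<le> n"
  shows "mat_measurable \<Omega> (M k) (M k) (\<lambda>\<omega>. X n \<omega> k)"
  by (rule mat_measurable_cong[OF mat_measurable_gibbs[OF assms(1)]]) (rule X_eq[OF _ assms(2)])

lemma V_measurable_if:
  assumes "\<And>k. mat_measurable \<Omega> (M k) (M k) (\<lambda>\<omega>. X n \<omega> k)" "1 \<le> n"
  shows "mat_measurable \<Omega> (M k) (M k) (\<lambda>\<omega>. V n \<omega> k)"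
  unfolding V_def
  by (intro mat_measurable_grad_inst assms H_measurable P_nonneg strategy_profileD(2)[OF X_strategy])

lemma Y_measurable:
  assumes "1 \<le> n"
  shows "mat_measurable \<Omega> (M k) (M k) (\<lambda>\<omega>. Y n \<omega> k)"
  using assms
proof (induction n arbitrary: k rule: dec_induct)
  case base
  show ?case by (rule mat_measurable_cong[OF mat_measurable_const[OF hermitian_carrier[OF Y1]]]) (rule Y_1)
next
  case (step n)
  note V = V_measurable_if[OF X_measurable_if[OF step.IH step.hyps(1)] step.hyps(1)]
  show ?case
    by (rule mat_measurable_cong[OF mat_measurable_add[OF step.IH mat_measurable_smult[OF mat_measurable_diff[OF V
      mat_measurable_smult[OF step.IH borel_measurable_const]] borel_measurable_const]]])
      (rule Y_Suc[OF _ step.hyps(1)])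
qed

lemmas X_measurable = X_measurable_if[OF Y_measurable]
lemmas V_measurable = V_measurable_if[OF X_measurable]

lemma history_sets: "sets (history \<Omega> M X n) = sigma_sets (space \<Omega>)
     {{\<omega> \<in> space \<Omega>. X m \<omega> k $$ (i, j) \<in> B} | m k i j B.
        1 \<le> m \<and> m \<le> n \<and> i < M k \<and> j < M k \<and> B \<in> sets borel}"
  unfolding history_def by (rule sets_measure_of) auto

lemma history_space: "space (history \<Omega> M X n) = space \<Omega>"
  unfolding history_def by (rule space_measure_of) auto

lemma history_subalgebra: "subalgebra \<Omega> (history \<Omega> M X n)"
  unfolding subalgebra_def
proof (intro conjI history_space)
  show "sets (history \<Omega> M X n) \<subseteq> sets \<Omega>" unfolding history_sets
  proof (rule sets.sigma_sets_subset, safe)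
    fix m :: nat and k i j and B :: "complex set" assume "1 \<le> m" "i < M k" "j < M k" "B \<in> sets borel"
    hence "(\<lambda>\<omega>. X m \<omega> k $$ (i, j)) -` B \<inter> space \<Omega> \<in> sets \<Omega>"
      using mat_measurable_entry[OF X_measurable] by (intro measurable_sets)
    thus "{\<omega> \<in> space \<Omega>. X m \<omega> k $$ (i, j) \<in> B} \<in> sets \<Omega>" by (simp add: vimage_def Int_def conj_commute)
  qed
qed

lemma X_history_measurable:
  assumes "1 \<le> m" "m \<le> n"
  shows "mat_measurable (history \<Omega> M X n) (M k) (M k) (\<lambda>\<omega>. X m \<omega> k)"
  unfolding mat_measurable_def history_space
proof (intro conjI ballI allI impI)
  fix i j assume ij: "i < M k" "j < M k"
  show "(\<lambda>\<omega>. X m \<omega> k $$ (i, j)) \<in> borel_measurable (history \<Omega> M X n)"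
  proof (rule measurableI)
    fix B :: "complex set" assume B: "B \<in> sets borel"
    have "{\<omega> \<in> space \<Omega>. X m \<omega> k $$ (i, j) \<in> B} \<in> sets (history \<Omega> M X n)"
      unfolding history_sets using ij assms B by (intro sigma_sets.Basic) blast
    thus "(\<lambda>\<omega>. X m \<omega> k $$ (i, j)) -` B \<inter> space (history \<Omega> M X n) \<in> sets (history \<Omega> M X n)"
      by (simp add: history_space vimage_def Int_def conj_commute)
  qed simp
qed (use strategy_profileD(3)[OF X_strategy[OF _ assms(1)]] in auto)

definition total_grad_bound :: real where
  "total_grad_bound = (\<Sum>k\<in>UNIV. real (M k) * grad_bound)"

lemma V_bound:
  "AE \<omega> in \<Omega>. \<forall>n\<ge>1. \<forall>k. (\<forall>i<M k. \<forall>j<M k. cmod (V n \<omega> k $$ (i, j)) \<le> grad_bound) \<and> fnorm (M k) (V n \<omega> k) \<le> total_grad_bound"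
  using grad_inst_bound AE_space
proof eventually_elim
  fix \<omega> assume b: "\<forall>n\<ge>1. \<forall>X. (\<forall>k. psd_mat (M k) (X k)) \<longrightarrow>
    (\<forall>k. \<forall>i<M k. \<forall>j<M k. cmod (grad_inst N P k X (H n \<omega>) $$ (i, j)) \<le> grad_bound)" and \<omega>: "\<omega> \<in> space \<Omega>"
  show "\<forall>n\<ge>1. \<forall>k. (\<forall>i<M k. \<forall>j<M k. cmod (V n \<omega> k $$ (i, j)) \<le> grad_bound) \<and> fnorm (M k) (V n \<omega> k) \<le> total_grad_bound"
  proof (intro allI impI)
    fix n :: nat and k assume n: "1 \<le> n"
    have e: "\<forall>i<M k. \<forall>j<M k. cmod (V n \<omega> k $$ (i, j)) \<le> grad_bound"
      unfolding V_def using b n strategy_profileD(2)[OF X_strategy[OF \<omega> n]] by blast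
    hence "frob (M k) (V n \<omega> k) (V n \<omega> k) \<le> (real (M k) * grad_bound)\<^sup>2" by (intro frob_self_bound) blast
    hence "fnorm (M k) (V n \<omega> k) \<le> real (M k) * grad_bound"
      using grad_bound_nonneg by (intro real_le_lsqrt) (auto simp: frob_self_nonneg)
    also have "\<dots> \<le> total_grad_bound" unfolding total_grad_bound_def
      using grad_bound_nonneg by (intro member_le_sum) auto
    finally show "(\<forall>i<M k. \<forall>j<M k. cmod (V n \<omega> k $$ (i, j)) \<le> grad_bound) \<and> fnorm (M k) (V n \<omega> k) \<le> total_grad_bound"
      using e by blast
  qed
qed

lemma total_grad_bound_nonneg: "0 \<le> total_grad_bound"
  unfolding total_grad_bound_def using grad_bound_nonneg by (intro sum_nonneg) auto

lemma \<gamma>_not_summable: "\<not> summable (\<lambda>n. \<gamma> (Suc n))"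
proof
  assume "summable (\<lambda>n. \<gamma> (Suc n))"
  hence "(\<lambda>n. \<Sum>m<n. \<gamma> (Suc m)) \<longlonglongrightarrow> (\<Sum>m. \<gamma> (Suc m))" by (rule summable_LIMSEQ)
  moreover have "(\<Sum>m<n. \<gamma> (Suc m)) = (\<Sum>m=1..n. \<gamma> m)" for n
    using sum.atLeast1_atMost_eq[of \<gamma> n] by simp
  ultimately have "(\<lambda>n. \<Sum>m=1..n. \<gamma> m) \<longlonglongrightarrow> (\<Sum>m. \<gamma> (Suc m))" by simp
  thus False using not_tendsto_and_filterlim_at_infinity[OF trivial_limit_sequentially _ filterlim_at_top_imp_at_infinity[OF \<gamma>_div]]
    by blast
qed

text \<open>The score norms are dominated by the deterministic recursion of \<open>stepsize_recursion_bounded\<close>, so the bound holds for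
all times simultaneously and does not depend on the realization.\<close>

lemma Y_bound:
  obtains R where "0 \<le> R" "AE \<omega> in \<Omega>. \<forall>n\<ge>1. \<forall>k. fnorm (M k) (Y n \<omega> k) \<le> R"
proof -
  have "(\<lambda>n. sqrt ((\<gamma> (n + 1))\<^sup>2)) \<longlonglongrightarrow> sqrt 0" by (intro tendsto_real_sqrt summable_LIMSEQ_zero \<gamma>_sq)
  hence "(\<lambda>n. \<bar>\<gamma> (Suc n)\<bar>) \<longlonglongrightarrow> 0" by simp
  hence \<gamma>0: "(\<lambda>n. \<gamma> (Suc n)) \<longlonglongrightarrow> 0" by (rule tendsto_rabs_zero_cancel)
  define r where "r = rec_nat (\<Sum>k\<in>UNIV. fnorm (M k) (Y1 k)) (\<lambda>n s. \<bar>1 - \<tau> * \<gamma> (Suc n)\<bar> * s + \<gamma> (Suc n) * total_grad_bound)"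
  obtain R where R: "0 \<le> R" "\<And>n. r n \<le> R"
    by (rule stepsize_recursion_bounded[OF \<tau>_pos _ \<gamma>0 total_grad_bound_nonneg, of r]) (auto simp: r_def \<gamma>_pos)
  have "AE \<omega> in \<Omega>. \<forall>n\<ge>1. \<forall>k. fnorm (M k) (Y n \<omega> k) \<le> R"
    using V_bound AE_space
  proof eventually_elim
    fix \<omega> assume b: "\<forall>n\<ge>1. \<forall>k. (\<forall>i<M k. \<forall>j<M k. cmod (V n \<omega> k $$ (i, j)) \<le> grad_bound) \<and>
      fnorm (M k) (V n \<omega> k) \<le> total_grad_bound" and \<omega>: "\<omega> \<in> space \<Omega>"
    have le: "fnorm (M k) (Y (Suc n) \<omega> k) \<le> r n" for n k
    proof (induction n)
      case 0
      show ?case using Y_1[OF \<omega>, of k] member_le_sum[of k UNIV "\<lambda>k. fnorm (M k) (Y1 k)"]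
        by (simp add: r_def frob_self_nonneg)
    next
      case (Suc n)
      let ?m = "Suc n"
      have m: "1 \<le> ?m" by simp
      note Yc = hermitian_carrier[OF Y_hermitian[OF \<omega> m, of k]] and Vc = hermitian_carrier[OF V_hermitian[OF \<omega> m, of k]]
      have "Y (Suc ?m) \<omega> k = complex_of_real (1 - \<tau> * \<gamma> ?m) \<cdot>\<^sub>m Y ?m \<omega> k + complex_of_real (\<gamma> ?m) \<cdot>\<^sub>m V ?m \<omega> k"
        unfolding Y_Suc[OF \<omega> m] using Yc Vc by (intro eq_matI) (auto simp: algebra_simps)
      hence "fnorm (M k) (Y (Suc ?m) \<omega> k) \<le> \<bar>1 - \<tau> * \<gamma> ?m\<bar> * fnorm (M k) (Y ?m \<omega> k) + \<bar>\<gamma> ?m\<bar> * fnorm (M k) (V ?m \<omega> k)"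
        using fnorm_triangle[OF smult_carrier_mat[OF Yc, of "complex_of_real (1 - \<tau> * \<gamma> ?m)"] smult_carrier_mat[OF Vc, of "complex_of_real (\<gamma> ?m)"]]
        unfolding fnorm_smult[OF Yc] fnorm_smult[OF Vc] by presburger
      also have "\<dots> \<le> \<bar>1 - \<tau> * \<gamma> ?m\<bar> * r n + \<gamma> ?m * total_grad_bound"
      proof (intro add_mono mult_left_mono Suc.IH)
        have "fnorm (M k) (V ?m \<omega> k) \<le> total_grad_bound" using b m by blast
        thus "\<bar>\<gamma> ?m\<bar> * fnorm (M k) (V ?m \<omega> k) \<le> \<gamma> ?m * total_grad_bound"
          using \<gamma>_pos[OF m] by (simp add: mult_left_mono)
      qed simp
      also have "\<dots> = r (Suc n)" by (simp add: r_def)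
      finally show ?case .
    qed
    show "\<forall>n\<ge>1. \<forall>k. fnorm (M k) (Y n \<omega> k) \<le> R"
    proof (intro allI impI)
      fix n :: nat and k assume "1 \<le> n"
      then obtain n' where "n = Suc n'" by (cases n) auto
      thus "fnorm (M k) (Y n \<omega> k) \<le> R" using le[of k n'] R(2)[of n'] by simp
    qed
  qed
  thus ?thesis using that[OF R(1)] by blast
qed

definition expected_Re :: "nat \<Rightarrow> 'u \<Rightarrow> nat \<Rightarrow> nat \<Rightarrow> 'w \<Rightarrow> real" where
  "expected_Re n k i j = real_cond_exp \<Omega> (history \<Omega> M X n) (\<lambda>\<omega>. Re (V n \<omega> k $$ (i, j)))"

definition expected_Im :: "nat \<Rightarrow> 'u \<Rightarrow> nat \<Rightarrow> nat \<Rightarrow> 'w \<Rightarrow> real" where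
  "expected_Im n k i j = real_cond_exp \<Omega> (history \<Omega> M X n) (\<lambda>\<omega>. Im (V n \<omega> k $$ (i, j)))"

text \<open>The gradient error paired with the displacement from \<open>p\<close>. It refers to conditional expectations instead of the
expected gradient at \<open>X n\<close>, to which they are almost surely equal, because the former are measurable by construction.\<close>

definition noise :: "('u \<Rightarrow> complex mat) \<Rightarrow> nat \<Rightarrow> 'w \<Rightarrow> real" where
  "noise p n \<omega> = (\<Sum>k\<in>UNIV. P k * (\<Sum>i<M k. \<Sum>j<M k.
      Re (X n \<omega> k $$ (i, j) - p k $$ (i, j)) * (Re (V n \<omega> k $$ (i, j)) - expected_Re n k i j \<omega>) +
      Im (X n \<omega> k $$ (i, j) - p k $$ (i, j)) * (Im (V n \<omega> k $$ (i, j)) - expected_Im n k i j \<omega>)))"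

lemma noise_eq:
  assumes p: "strategy_profile M p" and n: "1 \<le> n"
  shows "AE \<omega> in \<Omega>. noise p n \<omega> = (\<Sum>k\<in>UNIV. P k * frob (M k) (X n \<omega> k - p k) (V n \<omega> k - grad k (X n \<omega>)))"
proof -
  have "AE \<omega> in \<Omega>. \<forall>k. \<forall>i\<in>{..<M k}. \<forall>j\<in>{..<M k}. expected_Re n k i j \<omega> = Re (grad k (X n \<omega>) $$ (i, j)) \<and>
      expected_Im n k i j \<omega> = Im (grad k (X n \<omega>) $$ (i, j))"
    using unbiased n unfolding unbiased_gradients_def expected_Re_def expected_Im_def V_def
    by (subst AE_all_countable, intro allI AE_finite_allI) auto
  thus ?thesis using AE_space
  proof eventually_elim
    fix \<omega> assume e: "\<forall>k. \<forall>i\<in>{..<M k}. \<forall>j\<in>{..<M k}. expected_Re n k i j \<omega> = Re (grad k (X n \<omega>) $$ (i, j)) \<and>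
      expected_Im n k i j \<omega> = Im (grad k (X n \<omega>) $$ (i, j))" and \<omega>: "\<omega> \<in> space \<Omega>"
    show "noise p n \<omega> = (\<Sum>k\<in>UNIV. P k * frob (M k) (X n \<omega> k - p k) (V n \<omega> k - grad k (X n \<omega>)))"
      unfolding noise_def frob_def
    proof (intro sum.cong refl arg_cong2[where f = "(*)"])
      fix k i j assume "i \<in> {..<M k}" "j \<in> {..<M k}"
      hence ij: "i < M k" "j < M k" and e': "expected_Re n k i j \<omega> = Re (grad k (X n \<omega>) $$ (i, j))"
        "expected_Im n k i j \<omega> = Im (grad k (X n \<omega>) $$ (i, j))" using e by auto
      have diffs: "(X n \<omega> k - p k) $$ (i, j) = X n \<omega> k $$ (i, j) - p k $$ (i, j)"
        "(V n \<omega> k - grad k (X n \<omega>)) $$ (i, j) = V n \<omega> k $$ (i, j) - grad k (X n \<omega>) $$ (i, j)"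
        using ij strategy_profileD(3)[OF p, of k] grad_carrier[of k "X n \<omega>"] by auto
      show "Re (X n \<omega> k $$ (i, j) - p k $$ (i, j)) * (Re (V n \<omega> k $$ (i, j)) - expected_Re n k i j \<omega>) +
          Im (X n \<omega> k $$ (i, j) - p k $$ (i, j)) * (Im (V n \<omega> k $$ (i, j)) - expected_Im n k i j \<omega>) =
        Re ((X n \<omega> k - p k) $$ (i, j) * cnj ((V n \<omega> k - grad k (X n \<omega>)) $$ (i, j)))"
        unfolding e' diffs by (simp add: algebra_simps)
    qed
  qed
qed

lemma centered_integral:
  assumes n: "1 \<le> n" and f: "f \<in> borel_measurable (history \<Omega> M X n)" and fb: "\<And>\<omega>. \<omega> \<in> space \<Omega> \<Longrightarrow> \<bar>f \<omega>\<bar> \<le> c"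
    and g: "g \<in> borel_measurable \<Omega>" and gb: "AE \<omega> in \<Omega>. \<bar>g \<omega>\<bar> \<le> d" and c: "0 \<le> c"
  shows "integrable \<Omega> (\<lambda>\<omega>. f \<omega> * (g \<omega> - real_cond_exp \<Omega> (history \<Omega> M X n) g \<omega>))"
    and "(\<integral>\<omega>. f \<omega> * (g \<omega> - real_cond_exp \<Omega> (history \<Omega> M X n) g \<omega>) \<partial>\<Omega>) = 0"
proof -
  interpret finite_measure_subalgebra \<Omega> "history \<Omega> M X n"
    by unfold_locales (rule history_subalgebra)
  have fM: "f \<in> borel_measurable \<Omega>" by (rule measurable_from_subalg[OF history_subalgebra f])
  have int: "integrable \<Omega> (\<lambda>\<omega>. f \<omega> * g \<omega>)"
  proof (rule integrable_const_bound[where B = "c * d"])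
    show "AE \<omega> in \<Omega>. norm (f \<omega> * g \<omega>) \<le> c * d" using gb AE_space
      by eventually_elim (use fb c in \<open>auto simp: abs_mult intro!: mult_mono\<close>)
  qed (use fM g in measurable)
  note ce = real_cond_exp_intg[OF int f g]
  have e: "(\<lambda>\<omega>. f \<omega> * (g \<omega> - real_cond_exp \<Omega> (history \<Omega> M X n) g \<omega>)) =
     (\<lambda>\<omega>. f \<omega> * g \<omega> - f \<omega> * real_cond_exp \<Omega> (history \<Omega> M X n) g \<omega>)" by (auto simp: right_diff_distrib)
  show "integrable \<Omega> (\<lambda>\<omega>. f \<omega> * (g \<omega> - real_cond_exp \<Omega> (history \<Omega> M X n) g \<omega>))"
    unfolding e by (intro Bochner_Integration.integrable_diff int ce(1))
  show "(\<integral>\<omega>. f \<omega> * (g \<omega> - real_cond_exp \<Omega> (history \<Omega> M X n) g \<omega>) \<partial>\<Omega>) = 0"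
    unfolding e using Bochner_Integration.integral_diff[OF int ce(1)] ce(2) by simp
qed

text \<open>The displacement is known given the history, and conditional expectations may be integrated against known
bounded factors. This includes the indicators of past events that the supermartingale estimate requires.\<close>

lemma noise_centered:
  assumes p: "strategy_profile M p" and n: "1 \<le> n" and A: "A \<in> sets (history \<Omega> M X n)"
  shows "integrable \<Omega> (\<lambda>\<omega>. indicator A \<omega> * noise p n \<omega>)" and "(\<integral>\<omega>. indicator A \<omega> * noise p n \<omega> \<partial>\<Omega>) = 0"
proof -
  let ?R = "\<lambda>k i j \<omega>. (indicator A \<omega> * Re (X n \<omega> k $$ (i, j) - p k $$ (i, j))) * (Re (V n \<omega> k $$ (i, j)) - expected_Re n k i j \<omega>)"
  let ?I = "\<lambda>k i j \<omega>. (indicator A \<omega> * Im (X n \<omega> k $$ (i, j) - p k $$ (i, j))) * (Im (V n \<omega> k $$ (i, j)) - expected_Im n k i j \<omega>)"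
  have e: "indicator A \<omega> * noise p n \<omega> = (\<Sum>k\<in>UNIV. P k * (\<Sum>i<M k. \<Sum>j<M k. ?R k i j \<omega> + ?I k i j \<omega>))" for \<omega>
    unfolding noise_def sum_distrib_left by (intro sum.cong refl) (simp add: algebra_simps)
  have terms: "integrable \<Omega> (?R k i j)" "integral\<^sup>L \<Omega> (?R k i j) = 0" "integrable \<Omega> (?I k i j)" "integral\<^sup>L \<Omega> (?I k i j) = 0"
    if ij: "i < M k" "j < M k" for k i j
  proof -
    note Xm = mat_measurable_entry[OF X_history_measurable[OF n order_refl] ij]
    have D: "cmod (X n \<omega> k $$ (i, j) - p k $$ (i, j)) \<le> 2" if "\<omega> \<in> space \<Omega>" for \<omega>
    proof -
      have "cmod (X n \<omega> k $$ (i, j)) \<le> 1" "cmod (p k $$ (i, j)) \<le> 1"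
        using action_set_frob_le[OF strategy_profileD(1)[OF p]] action_set_frob_le[OF strategy_profileD(1)[OF X_strategy[OF that n]]]
        by (auto intro!: frob_entry_bound[OF _ _ ij])
      thus ?thesis using norm_triangle_ineq4[of "X n \<omega> k $$ (i, j)" "p k $$ (i, j)"] by linarith
    qed
    have ind: "indicator A \<in> borel_measurable (history \<Omega> M X n)" using A by simp
    have mRe: "(\<lambda>\<omega>. indicator A \<omega> * Re (X n \<omega> k $$ (i, j) - p k $$ (i, j))) \<in> borel_measurable (history \<Omega> M X n)"
      by (intro borel_measurable_times ind measurable_compose[OF borel_measurable_diff[OF Xm borel_measurable_const] borel_measurable_Re])
    have mIm: "(\<lambda>\<omega>. indicator A \<omega> * Im (X n \<omega> k $$ (i, j) - p k $$ (i, j))) \<in> borel_measurable (history \<Omega> M X n)"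
      by (intro borel_measurable_times ind measurable_compose[OF borel_measurable_diff[OF Xm borel_measurable_const] borel_measurable_Im])
    have bRe: "\<bar>indicator A \<omega> * Re (X n \<omega> k $$ (i, j) - p k $$ (i, j))\<bar> \<le> 2" if "\<omega> \<in> space \<Omega>" for \<omega>
      using D[OF that] abs_Re_le_cmod[of "X n \<omega> k $$ (i, j) - p k $$ (i, j)"] by (auto simp: indicator_def)
    have bIm: "\<bar>indicator A \<omega> * Im (X n \<omega> k $$ (i, j) - p k $$ (i, j))\<bar> \<le> 2" if "\<omega> \<in> space \<Omega>" for \<omega>
      using D[OF that] abs_Im_le_cmod[of "X n \<omega> k $$ (i, j) - p k $$ (i, j)"] by (auto simp: indicator_def)
    note Vm = mat_measurable_entry[OF V_measurable[OF n n n] ij]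
    have Vb: "AE \<omega> in \<Omega>. cmod (V n \<omega> k $$ (i, j)) \<le> grad_bound"
      using V_bound by eventually_elim (use n ij in blast)
    have VRe: "AE \<omega> in \<Omega>. \<bar>Re (V n \<omega> k $$ (i, j))\<bar> \<le> grad_bound"
      using Vb by eventually_elim (use abs_Re_le_cmod order_trans in blast)
    have VIm: "AE \<omega> in \<Omega>. \<bar>Im (V n \<omega> k $$ (i, j))\<bar> \<le> grad_bound"
      using Vb by eventually_elim (use abs_Im_le_cmod order_trans in blast)
    show "integrable \<Omega> (?R k i j)" "integral\<^sup>L \<Omega> (?R k i j) = 0"
      unfolding expected_Re_def
      using centered_integral[OF n mRe bRe measurable_compose[OF Vm borel_measurable_Re] VRe] by simp_all
    show "integrable \<Omega> (?I k i j)" "integral\<^sup>L \<Omega> (?I k i j) = 0"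
      unfolding expected_Im_def
      using centered_integral[OF n mIm bIm measurable_compose[OF Vm borel_measurable_Im] VIm] by simp_all
  qed
  have hb: "has_bochner_integral \<Omega> (\<lambda>\<omega>. indicator A \<omega> * noise p n \<omega>) (\<Sum>k\<in>UNIV. P k * (\<Sum>i<M k. \<Sum>j<M k. 0 + 0))"
    unfolding e
  proof (intro has_bochner_integral_sum has_bochner_integral_mult_right has_bochner_integral_add)
    fix k i j assume "i \<in> {..<M k}" "j \<in> {..<M k}"
    hence ij: "i < M k" "j < M k" by auto
    show "has_bochner_integral \<Omega> (?R k i j) 0" using terms(1,2)[OF ij] by (simp only: has_bochner_integral_iff)
    show "has_bochner_integral \<Omega> (?I k i j) 0" using terms(3,4)[OF ij] by (simp only: has_bochner_integral_iff)
  qed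
  show "integrable \<Omega> (\<lambda>\<omega>. indicator A \<omega> * noise p n \<omega>)" using hb by (simp only: has_bochner_integral_iff)
  show "(\<integral>\<omega>. indicator A \<omega> * noise p n \<omega> \<partial>\<Omega>) = 0"
    using hb by (simp add: has_bochner_integral_iff)
qed

text \<open>The Lyapunov function along the run satisfies the hypotheses of \<open>almost_supermartingale_contraction\<close>: it is a function
of the current profile, it is bounded because the scores are, and its drift is given by \<open>lyapunov_step\<close>. Times
are shifted by one, since runs start at time 1.\<close>

theorem iterates_converge:
  assumes p: "strategy_profile M p" and fp: "\<And>k. p k = gibbs (complex_of_real (1 / \<tau>) \<cdot>\<^sub>m grad k p)"
  shows "AE \<omega> in \<Omega>. (\<lambda>n. profile_dist M (X n \<omega>) p) \<longlonglongrightarrow> 0"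
proof -
  define Ys where "Ys k = complex_of_real (1 / \<tau>) \<cdot>\<^sub>m grad k p" for k
  have Ys: "hermitian_mat (M k) (Ys k)" for k
    unfolding Ys_def by (intro hermitian_smult grad_hermitian strategy_profileD(2)[OF p])
  have pY: "p = (\<lambda>k. gibbs (Ys k))" using fp unfolding Ys_def by blast
  have gY: "grad k (\<lambda>k. gibbs (Ys k)) = complex_of_real \<tau> \<cdot>\<^sub>m Ys k" for k
  proof -
    have "grad k p = complex_of_real \<tau> \<cdot>\<^sub>m Ys k"
      unfolding Ys_def using grad_carrier[of k p] \<tau>_pos by (intro eq_matI) auto
    thus ?thesis by (simp only: pY[symmetric])
  qed
  obtain R where R0: "0 \<le> R" and R: "AE \<omega> in \<Omega>. \<forall>n\<ge>1. \<forall>k. fnorm (M k) (Y n \<omega> k) \<le> R" using Y_bound .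
  define C where "C = (\<Sum>k\<in>UNIV. P k * (exp (2 * R) * (total_grad_bound + \<tau> * R)\<^sup>2))"
  have C0: "0 \<le> C" unfolding C_def by (intro sum_nonneg mult_nonneg_nonneg P_nonneg) auto
  define U where "U n \<omega> = lyapunov Ys (Y (Suc n) \<omega>)" for n \<omega>
  define F where "F n = history \<Omega> M X (Suc n)" for n
  have Unn: "0 \<le> U n \<omega>" if "\<omega> \<in> space \<Omega>" for n \<omega>
    unfolding U_def by (intro lyapunov_nonneg Ys Y_hermitian that) simp
  have Uform: "U n \<omega> = (\<Sum>k\<in>UNIV. P k * (gibbs_objective (M k) (p k) (Ys k) - frob (M k) (p k) (mat_log (M k) (X (Suc n) \<omega> k))))"
    if "\<omega> \<in> space \<Omega>" for n \<omega>
  proof -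
    have "gibbs_objective (M k) (p k) (Y (Suc n) \<omega> k) = frob (M k) (p k) (mat_log (M k) (X (Suc n) \<omega> k))" for k
      using gibbs_objective_mat_log[OF strategy_profileD(1)[OF p] Y_hermitian[OF that] M_pos, of "Suc n" k] X_eq[OF that, of "Suc n" k] by simp
    thus ?thesis unfolding U_def lyapunov_def pY by simp
  qed
  have Umeas: "U m \<in> borel_measurable (F n)" if "m \<le> n" for m n
  proof -
    have "(\<lambda>\<omega>. \<Sum>k\<in>UNIV. P k * (gibbs_objective (M k) (p k) (Ys k) - frob (M k) (p k) (mat_log (M k) (X (Suc m) \<omega> k)))) \<in> borel_measurable (F n)"
      unfolding F_def using that
      by (intro borel_measurable_sum borel_measurable_times borel_measurable_diff borel_measurable_const frob_measurable
          mat_measurable_const mat_measurable_log X_history_measurable strategy_profileD(3)[OF p]) auto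
    thus ?thesis
      by (subst measurable_cong[where g = "\<lambda>\<omega>. \<Sum>k\<in>UNIV. P k * (gibbs_objective (M k) (p k) (Ys k) - frob (M k) (p k) (mat_log (M k) (X (Suc m) \<omega> k)))"])
        (use Uform in \<open>auto simp: F_def history_space\<close>)
  qed
  have sub: "subalgebra \<Omega> (F n)" for n unfolding F_def by (rule history_subalgebra)
  have FM: "A \<in> sets \<Omega>" if "A \<in> sets (F n)" for A n using that sub[of n] by (auto simp: subalgebra_def)
  define b where "b = (\<Sum>k\<in>UNIV. P k * (2 * (R + fnorm (M k) (Ys k))))"
  have Uint: "integrable \<Omega> (U n)" for n
  proof (rule integrable_const_bound[where B = b])
    show "AE \<omega> in \<Omega>. norm (U n \<omega>) \<le> b" using R AE_space
    proof eventually_elim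
      fix \<omega> assume r: "\<forall>n\<ge>1. \<forall>k. fnorm (M k) (Y n \<omega> k) \<le> R" and \<omega>: "\<omega> \<in> space \<Omega>"
      have Yh: "hermitian_mat (M k) (Y (Suc n) \<omega> k)" for k by (rule Y_hermitian[OF \<omega>]) simp
      have "U n \<omega> \<le> (\<Sum>k\<in>UNIV. P k * frob (M k) (gibbs (Y (Suc n) \<omega> k) - gibbs (Ys k)) (Y (Suc n) \<omega> k - Ys k))"
        unfolding U_def by (rule lyapunov_le_pairing[OF Ys Yh])
      also have "\<dots> \<le> b" unfolding b_def
      proof (intro sum_mono mult_left_mono P_nonneg order_trans[OF frob_le_fnorm] mult_mono)
        fix k
        note a = gibbs_action_set[OF Yh M_pos, of k] gibbs_action_set[OF Ys M_pos, of k]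
        have "fnorm (M k) (gibbs (Y (Suc n) \<omega> k)) \<le> 1" "fnorm (M k) (gibbs (Ys k)) \<le> 1"
          using action_set_frob_le[OF a(1)] action_set_frob_le[OF a(2)] by auto
        thus "fnorm (M k) (gibbs (Y (Suc n) \<omega> k) - gibbs (Ys k)) \<le> 2"
          using fnorm_diff_triangle[OF action_set_carrier[OF a(1)] action_set_carrier[OF a(2)]] by linarith
        have "fnorm (M k) (Y (Suc n) \<omega> k) \<le> R" using r by simp
        thus "fnorm (M k) (Y (Suc n) \<omega> k - Ys k) \<le> R + fnorm (M k) (Ys k)"
          using fnorm_diff_triangle[OF hermitian_carrier[OF Yh] hermitian_carrier[OF Ys], of k] by linarith
      qed (auto simp: frob_self_nonneg)
      finally show "norm (U n \<omega>) \<le> b" using Unn[OF \<omega>] by simp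
    qed
    show "U n \<in> borel_measurable \<Omega>" by (rule measurable_from_subalg[OF sub Umeas[OF order_refl]])
  qed
  have step: "AE \<omega> in \<Omega>. U (Suc n) \<omega> \<le> (1 - \<tau> * \<gamma> (Suc n)) * U n \<omega> + \<gamma> (Suc n) * noise p (Suc n) \<omega> + C * (\<gamma> (Suc n))\<^sup>2" for n
    using R V_bound noise_eq[OF p, of "Suc n", simplified] AE_space
  proof eventually_elim
    fix \<omega> assume r: "\<forall>n\<ge>1. \<forall>k. fnorm (M k) (Y n \<omega> k) \<le> R" and \<omega>: "\<omega> \<in> space \<Omega>"
      and v: "\<forall>n\<ge>1. \<forall>k. (\<forall>i<M k. \<forall>j<M k. cmod (V n \<omega> k $$ (i, j)) \<le> grad_bound) \<and> fnorm (M k) (V n \<omega> k) \<le> total_grad_bound"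
      and nz: "noise p (Suc n) \<omega> = (\<Sum>k\<in>UNIV. P k * frob (M k) (X (Suc n) \<omega> k - p k) (V (Suc n) \<omega> k - grad k (X (Suc n) \<omega>)))"
    have n: "1 \<le> Suc n" by simp
    have Xe: "X (Suc n) \<omega> = (\<lambda>k. gibbs (Y (Suc n) \<omega> k))" using X_eq[OF \<omega> n] by blast
    have Ye: "Y (Suc (Suc n)) \<omega> = (\<lambda>k. Y (Suc n) \<omega> k + complex_of_real (\<gamma> (Suc n)) \<cdot>\<^sub>m
        (V (Suc n) \<omega> k - complex_of_real \<tau> \<cdot>\<^sub>m Y (Suc n) \<omega> k))" using Y_Suc[OF \<omega> n] by blast
    have r2: "fnorm (M k) (Y (Suc n) \<omega> k + complex_of_real (\<gamma> (Suc n)) \<cdot>\<^sub>m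
        (V (Suc n) \<omega> k - complex_of_real \<tau> \<cdot>\<^sub>m Y (Suc n) \<omega> k)) \<le> R" for k
      using r[rule_format, of "Suc (Suc n)" k] unfolding Ye by simp
    show "U (Suc n) \<omega> \<le> (1 - \<tau> * \<gamma> (Suc n)) * U n \<omega> + \<gamma> (Suc n) * noise p (Suc n) \<omega> + C * (\<gamma> (Suc n))\<^sup>2"
      unfolding U_def Ye nz Xe C_def unfolding pY
      by (rule lyapunov_step[OF \<tau>_pos Ys Y_hermitian[OF \<omega> n] gY V_hermitian[OF \<omega> n] _ _ r2])
        (use r v \<gamma>_pos[OF n] in auto)
  qed
  have "AE \<omega> in \<Omega>. (\<lambda>n. U n \<omega>) \<longlonglongrightarrow> 0"
  proof (rule almost_supermartingale_contraction[OF sub Umeas Uint _ \<tau>_pos _ _ \<gamma>_not_summable C0])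
    show "AE \<omega> in \<Omega>. 0 \<le> U n \<omega>" for n using Unn by (intro AE_I2)
    show "0 < \<gamma> (Suc n)" for n by (intro \<gamma>_pos) simp
    show "summable (\<lambda>n. (\<gamma> (Suc n))\<^sup>2)" using \<gamma>_sq by simp
    fix n A assume A: "A \<in> sets (F n)"
    have AM: "A \<in> sets \<Omega>" by (rule FM[OF A])
    note noise0 = noise_centered[OF p _ A[unfolded F_def]]
    have intA: "integrable \<Omega> (\<lambda>\<omega>. indicator A \<omega> * U m \<omega>)" for m
      using integrable_mult_indicator[OF AM Uint[of m]] by simp
    let ?f = "\<lambda>\<omega>. (1 - \<tau> * \<gamma> (Suc n)) * (indicator A \<omega> * U n \<omega>) + \<gamma> (Suc n) * (indicator A \<omega> * noise p (Suc n) \<omega>)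
        + C * (\<gamma> (Suc n))\<^sup>2 * indicator A \<omega>"
    have hb: "has_bochner_integral \<Omega> ?f ((1 - \<tau> * \<gamma> (Suc n)) * (\<integral>\<omega>. indicator A \<omega> * U n \<omega> \<partial>\<Omega>) + \<gamma> (Suc n) * 0 + C * (\<gamma> (Suc n))\<^sup>2 * prob A)"
      using intA noise0 AM
      by (intro has_bochner_integral_add has_bochner_integral_mult_right)
        (auto simp: has_bochner_integral_iff emeasure_eq_measure)
    have "(\<integral>\<omega>\<in>A. U (Suc n) \<omega> \<partial>\<Omega>) = (\<integral>\<omega>. indicator A \<omega> * U (Suc n) \<omega> \<partial>\<Omega>)" by (simp add: set_lebesgue_integral_def)
    also have "\<dots> \<le> (\<integral>\<omega>. ?f \<omega> \<partial>\<Omega>)"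
    proof (rule integral_mono_AE[OF intA])
      show "integrable \<Omega> ?f" using hb by (simp only: has_bochner_integral_iff)
      show "AE \<omega> in \<Omega>. indicator A \<omega> * U (Suc n) \<omega> \<le> ?f \<omega>"
        using step[of n] by eventually_elim (auto simp: indicator_def)
    qed
    also have "\<dots> = (1 - \<tau> * \<gamma> (Suc n)) * (\<integral>\<omega>\<in>A. U n \<omega> \<partial>\<Omega>) + C * (\<gamma> (Suc n))\<^sup>2 * prob A"
      using hb by (simp add: has_bochner_integral_iff set_lebesgue_integral_def)
    finally show "(\<integral>\<omega>\<in>A. U (Suc n) \<omega> \<partial>\<Omega>) \<le> (1 - \<tau> * \<gamma> (Suc n)) * (\<integral>\<omega>\<in>A. U n \<omega> \<partial>\<Omega>) + C * (\<gamma> (Suc n))\<^sup>2 * prob A" .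
  qed
  thus ?thesis using R AE_space
  proof eventually_elim
    fix \<omega> assume lim: "(\<lambda>n. U n \<omega>) \<longlonglongrightarrow> 0" and r: "\<forall>n\<ge>1. \<forall>k. fnorm (M k) (Y n \<omega> k) \<le> R" and \<omega>: "\<omega> \<in> space \<Omega>"
    define c where "c = exp (- 2 * (R + 2)) / 4"
    have c: "0 < c" by (simp add: c_def)
    have lim0: "(\<lambda>n. frob (M k) (X (Suc n) \<omega> k - p k) (X (Suc n) \<omega> k - p k)) \<longlonglongrightarrow> 0" for k
    proof (rule tendsto_sandwich[OF _ _ tendsto_const])
      show "\<forall>\<^sub>F n in sequentially. 0 \<le> frob (M k) (X (Suc n) \<omega> k - p k) (X (Suc n) \<omega> k - p k)" by (simp add: frob_self_nonneg)
      show "\<forall>\<^sub>F n in sequentially. frob (M k) (X (Suc n) \<omega> k - p k) (X (Suc n) \<omega> k - p k) \<le> U n \<omega> / (P k * c)"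
      proof (rule always_eventually, rule allI)
        fix n
        have Yh: "hermitian_mat (M k) (Y (Suc n) \<omega> k)" for k by (rule Y_hermitian[OF \<omega>]) simp
        have rn: "fnorm (M k) (Y (Suc n) \<omega> k) \<le> R" for k using r by simp
        have "P k * (c * frob (M k) (X (Suc n) \<omega> k - p k) (X (Suc n) \<omega> k - p k)) \<le> U n \<omega>"
          using lyapunov_ge_dist[OF Ys Yh rn, of k] X_eq[OF \<omega>, of "Suc n" k] unfolding U_def c_def pY by simp
        thus "frob (M k) (X (Suc n) \<omega> k - p k) (X (Suc n) \<omega> k - p k) \<le> U n \<omega> / (P k * c)"
          using P_pos[of k] c by (simp add: field_simps)
      qed
      show "(\<lambda>n. U n \<omega> / (P k * c)) \<longlonglongrightarrow> 0" using tendsto_divide[OF lim tendsto_const, of "P k * c"] P_pos[of k] c by simp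
    qed
    have "(\<lambda>n. sqrt (\<Sum>k\<in>UNIV. frob (M k) (X (Suc n) \<omega> k - p k) (X (Suc n) \<omega> k - p k))) \<longlonglongrightarrow> sqrt (\<Sum>k\<in>(UNIV :: 'u set). 0)"
      by (intro tendsto_real_sqrt tendsto_sum lim0)
    hence "(\<lambda>n. profile_dist M (X (Suc n) \<omega>) p) \<longlonglongrightarrow> 0"
      by (simp add: profile_dist_frob[OF strategy_profileD(3)[OF X_strategy[OF \<omega>]] strategy_profileD(3)[OF p]])
    thus "(\<lambda>n. profile_dist M (X n \<omega>) p) \<longlonglongrightarrow> 0" by (rule LIMSEQ_imp_Suc)
  qed
qed

end

section \<open>Convergence near a Nash equilibrium\<close>

theorem corollary4p1:
  fixes \<Omega> :: "'w measure"
    and N :: nat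
    and M :: "'u::finite \<Rightarrow> nat"
    and P :: "'u \<Rightarrow> real"
    and H :: "nat \<Rightarrow> 'w \<Rightarrow> 'u \<Rightarrow> complex mat"
  assumes "prob_space \<Omega>"
    and "0 < N"
    and "\<And>k. 0 < M k"
    and "\<And>k. 0 < P k"
    and "channel_process \<Omega> N M H"
  shows "\<exists>\<epsilon>::real \<Rightarrow> real. (\<epsilon> \<longlongrightarrow> 0) (at_right 0) \<and>
    (\<forall>\<tau>>0. \<forall>(\<gamma>::nat \<Rightarrow> real) Y1 Y X.
       (\<forall>n\<ge>1. 0 < \<gamma> n) \<longrightarrow>
       (\<forall>n\<ge>1. \<gamma> (n + 1) \<le> \<gamma> n) \<longrightarrow>
       summable (\<lambda>n. (\<gamma> (n + 1))\<^sup>2) \<longrightarrow>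
       filterlim (\<lambda>n. \<Sum>m=1..n. \<gamma> m) at_top sequentially \<longrightarrow>
       (\<forall>k. hermitian_mat (M k) (Y1 k)) \<longrightarrow>
       learning_iterates \<Omega> N P H \<tau> \<gamma> Y1 Y X \<longrightarrow>
       unbiased_gradients \<Omega> N M P H X \<longrightarrow>
       (\<exists>L Xeq.
          (\<forall>k. L k \<in> carrier_mat (M k) (M k)) \<and>
          nash_equilibrium \<Omega> N M P H Xeq \<and>
          profile_dist M L Xeq \<le> \<epsilon> \<tau> \<and>
          (AE \<omega> in \<Omega>. (\<lambda>n. profile_dist M (X n \<omega>) L) \<longlonglongrightarrow> 0)))"
proof -
  interpret channel_game \<Omega> N M P H
    using assms by (intro channel_game.intro channel_game_axioms.intro)
  let ?NE = "{Xeq. nash_equilibrium \<Omega> N M P H Xeq}"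
  have "\<exists>p. strategy_profile M p \<and> (\<forall>Z. strategy_profile M Z \<longrightarrow> regularized \<tau> Z \<le> regularized \<tau> p)" if "0 < \<tau>" for \<tau>
    using regularized_maximizer_exists[OF less_imp_le[OF that]] by metis
  then obtain p where p: "\<And>\<tau>. 0 < \<tau> \<Longrightarrow> strategy_profile M (p \<tau>)"
    and pmax: "\<And>\<tau> Z. 0 < \<tau> \<Longrightarrow> strategy_profile M Z \<Longrightarrow> regularized \<tau> Z \<le> regularized \<tau> (p \<tau>)" by metis
  \<comment> \<open>The infimum over the equilibria need not be attained; adding \<open>\<tau>\<close> leaves room for a near-minimizer.\<close>
  define \<epsilon> where "\<epsilon> \<tau> = (INF Xeq\<in>?NE. profile_dist M (p \<tau>) Xeq) + \<tau>" for \<tau>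
  have d0: "0 \<le> profile_dist M A B" for A B unfolding profile_dist_def by (intro real_sqrt_ge_zero sum_nonneg) auto
  have bdd: "bdd_below (profile_dist M A ` ?NE)" for A by (rule bdd_belowI2[where m = 0]) (rule d0)
  \<comment> \<open>For \<open>\<tau> = 0\<close> the regularized function is the potential itself.\<close>
  have ne: "?NE \<noteq> {}"
  proof -
    obtain X0 where "strategy_profile M X0" "\<And>Z. strategy_profile M Z \<Longrightarrow> regularized 0 Z \<le> regularized 0 X0"
      using regularized_maximizer_exists[of 0] by auto
    hence "nash_equilibrium \<Omega> N M P H X0" by (intro potential_maximizer_nash) (auto simp: regularized_def)
    thus ?thesis by blast
  qed
  have "(\<epsilon> \<longlongrightarrow> 0) (at_right 0)"
  proof (rule tendstoI)
    fix e :: real assume e: "0 < e"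
    obtain \<tau>0 where \<tau>0: "0 < \<tau>0" and near: "\<forall>\<tau> X. 0 < \<tau> \<longrightarrow> \<tau> < \<tau>0 \<longrightarrow> strategy_profile M X \<longrightarrow>
       (\<forall>Z. strategy_profile M Z \<longrightarrow> regularized \<tau> Z \<le> regularized \<tau> X) \<longrightarrow>
       (\<exists>Xeq. nash_equilibrium \<Omega> N M P H Xeq \<and> profile_dist M X Xeq \<le> e / 2)"
      using regularized_maximizers_approach_nash[of "e / 2"] e by auto
    show "\<forall>\<^sub>F \<tau> in at_right 0. dist (\<epsilon> \<tau>) 0 < e"
    proof (rule eventually_at_rightI[of 0 "min \<tau>0 (e / 2)"])
      fix \<tau> assume "\<tau> \<in> {0<..<min \<tau>0 (e / 2)}"
      hence \<tau>: "0 < \<tau>" "\<tau> < \<tau>0" "\<tau> < e / 2" by auto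
      obtain Xeq where Xeq: "Xeq \<in> ?NE" "profile_dist M (p \<tau>) Xeq \<le> e / 2"
        using near \<tau> p[OF \<tau>(1)] pmax[OF \<tau>(1)] by blast
      have "(INF Xeq\<in>?NE. profile_dist M (p \<tau>) Xeq) \<le> e / 2" by (rule order_trans[OF cINF_lower[OF bdd Xeq(1)] Xeq(2)])
      moreover have "0 \<le> (INF Xeq\<in>?NE. profile_dist M (p \<tau>) Xeq)" by (rule cINF_greatest[OF ne d0])
      ultimately show "dist (\<epsilon> \<tau>) 0 < e" using \<tau> by (simp add: \<epsilon>_def)
    qed (use \<tau>0 e in auto)
  qed
  moreover have "\<exists>L Xeq. (\<forall>k. L k \<in> carrier_mat (M k) (M k)) \<and> nash_equilibrium \<Omega> N M P H Xeq \<and>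
          profile_dist M L Xeq \<le> \<epsilon> \<tau> \<and> (AE \<omega> in \<Omega>. (\<lambda>n. profile_dist M (X n \<omega>) L) \<longlonglongrightarrow> 0)"
    if \<tau>: "0 < \<tau>" and \<gamma>: "\<forall>n\<ge>1. 0 < \<gamma> n" "summable (\<lambda>n. (\<gamma> (n + 1))\<^sup>2)"
      "filterlim (\<lambda>n. \<Sum>m=1..n. \<gamma> m) at_top sequentially"
      and run: "\<forall>k. hermitian_mat (M k) (Y1 k)" "learning_iterates \<Omega> N P H \<tau> \<gamma> Y1 Y X" "unbiased_gradients \<Omega> N M P H X"
    for \<tau> and \<gamma> :: "nat \<Rightarrow> real" and Y1 Y X
  proof -
    interpret learning_run \<Omega> N M P H \<tau> \<gamma> Y1 Y X
      by unfold_locales (use \<tau> \<gamma> run in auto)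
    obtain Xeq where Xeq: "nash_equilibrium \<Omega> N M P H Xeq" "profile_dist M (p \<tau>) Xeq < \<epsilon> \<tau>"
      using cINF_less_iff[OF ne bdd, of "p \<tau>" "\<epsilon> \<tau>"] \<tau> by (auto simp: \<epsilon>_def)
    have "AE \<omega> in \<Omega>. (\<lambda>n. profile_dist M (X n \<omega>) (p \<tau>)) \<longlonglongrightarrow> 0"
      by (rule iterates_converge[OF p[OF \<tau>] regularized_maximizer_fixed_point[OF \<tau> p[OF \<tau>] pmax[OF \<tau>]]])
    thus ?thesis using Xeq strategy_profileD(3)[OF p[OF \<tau>]] by (intro exI[of _ "p \<tau>"] exI[of _ Xeq]) auto
  qed
  ultimately show ?thesis by (intro exI[of _ \<epsilon>]) auto
qed

end
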